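(* Let $G=([n],E)$ be a graph. The Lasserre hierarchy of the problem $$\min\{x^T(A_G+I)x:\ x\in\Delta_n\}$$ has finite convergence if and only if the graph obtained from $G$ after contracting all twin pairs does not have critical edges.
   Context: Graphs are finite, simple and undirected; $[n]=\{1,\dots,n\}$. $A_G$ is the adjacency matrix of $G$, $I$ is the $n\times n$ identity matrix, and $\Delta_n=\{x\in\mathbb{R}^n:\sum_{i=1}^n x_i=1,\ x_i\ge 0 \text{ for } i\in[n]\}$ is the standard simplex. Stability number: $\alpha(G)$ is the maximum cardinality of a stable set of $G$ (a set of vertices no two distinct elements of which are adjacent). An edge $e$ of $G$ is critical if $\alpha(G\setminus e)=\alpha(G)+1$, where $G\setminus e$ is obtained from $G$ by deleting the edge $e$ (keeping all vertices). Twin pairs: a pair of vertices $(i,j)$ is a twin pair of $G$ if $\{i,j\}\in E$ and $N_G(i)\setminus\{j\}=N_G(j)\setminus\{i\}$, where $N_G(v)$ is the set of neighbours of $v$. Contracting the edge $\{i,j\}$ of a twin pair produces the same graph as deleting the vertex $i$ (isomorphically, deleting $j$). "The graph obtained after contracting all twin pairs" is the graph, unique up to isomorphism, obtained by repeatedly contracting twin pairs until none is left. Lasserre hierarchy: write $\mathbb{R}[x]=\mathbb{R}[x_1,\dots,x_n]$ and let $\Sigma$ be the cone of sums of squares of polynomials. For an integer $r\ge 1$ let $$\mathcal{M}(x_1,\dots,x_n)_r=\Big\{\sigma_0+\sum_{i=1}^n x_i\sigma_i:\ \sigma_0,\dots,\sigma_n\in\Sigma,\ \deg\sigma_0\le r,\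 \deg(x_i\sigma_i)\le r \text{ for } i\in[n]\Big\},$$ $$I_r=\Big\{q\Big(\sum_{i=1}^n x_i-1\Big):\ q\in\mathbb{R}[x],\ \deg\Big(q\Big(\sum_{i=1}^n x_i-1\Big)\Big)\le r\Big\}.$$ For a polynomial $f$ with $f^*=\min_{x\in\Delta_n}f(x)$, the Lasserre hierarchy of the problem $\min_{x\in\Delta_n}f(x)$ is the sequence $f^{(r)}=\sup\{\lambda\in\mathbb{R}: f-\lambda\in\mathcal{M}(x_1,\dots,x_n)_r+I_r\}$, $r\ge 1$ (with $\sup\emptyset=-\infty$); it has finite convergence if $f^{(r)}=f^*$ for some $r\ge 1$. *)

theory Defs
  imports "HOL-Analysis.Analysis" "HOL-Library.Poly_Mapping"
begin

text \<open>
  A graph is a pair \<open>(V, E)\<close> of a vertex set and a set of edges, the edges being two-element sets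
  of vertices.
\<close>

type_synonym 'v graph = "'v set \<times> 'v set set"

definition simple_graph :: "'v graph \<Rightarrow> bool" where
  "simple_graph G \<longleftrightarrow>
     finite (fst G) \<and> snd G \<subseteq> {{u, v} | u v. u \<in> fst G \<and> v \<in> fst G \<and> u \<noteq> v}"

definition neighbours :: "'v graph \<Rightarrow> 'v \<Rightarrow> 'v set" where
  "neighbours G v = {u. {u, v} \<in> snd G}"

definition stable_set :: "'v graph \<Rightarrow> 'v set \<Rightarrow> bool" where
  "stable_set G S \<longleftrightarrow> S \<subseteq> fst G \<and> (\<forall>u\<in>S. \<forall>v\<in>S. u \<noteq> v \<longrightarrow> {u, v} \<notin> snd G)"

definition stability_number :: "'v graph \<Rightarrow> nat" where
  "stability_number G = Max {card S | S. stable_set G S}"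

definition delete_edge :: "'v graph \<Rightarrow> 'v set \<Rightarrow> 'v graph" where
  "delete_edge G e = (fst G, snd G - {e})"

definition critical_edge :: "'v graph \<Rightarrow> 'v set \<Rightarrow> bool" where
  "critical_edge G e \<longleftrightarrow>
     e \<in> snd G \<and> stability_number (delete_edge G e) = stability_number G + 1"

definition twin_pair :: "'v graph \<Rightarrow> 'v \<Rightarrow> 'v \<Rightarrow> bool" where
  "twin_pair G i j \<longleftrightarrow> {i, j} \<in> snd G \<and> neighbours G i - {j} = neighbours G j - {i}"

text \<open>
  Contraction of the edge \<open>{i, j}\<close>. The vertex into which \<open>i\<close> and \<open>j\<close> are merged keeps the name \<open>j\<close>;
  the loop arising from \<open>{i, j}\<close> is dropped, and parallel edges are identified because edges form
  a set.
\<close>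

definition contract_edge :: "'v graph \<Rightarrow> 'v \<Rightarrow> 'v \<Rightarrow> 'v graph" where
  "contract_edge G i j =
     (fst G - {i}, (\<lambda>e. (\<lambda>v. if v = i then j else v) ` e) ` (snd G - {{i, j}}))"

definition contract_twin_step :: "'v graph \<Rightarrow> 'v graph \<Rightarrow> bool" where
  "contract_twin_step G H \<longleftrightarrow> (\<exists>i j. twin_pair G i j \<and> H = contract_edge G i j)"

text \<open>
  The graph left after contracting all twin pairs is unique only up to isomorphism, so it is
  introduced as a relation.
\<close>

definition twin_contraction :: "'v graph \<Rightarrow> 'v graph \<Rightarrow> bool" where
  "twin_contraction G H \<longleftrightarrow> contract_twin_step\<^sup>*\<^sup>* G H \<and> (\<nexists>i j. twin_pair H i j)"

lemma simple_graph_contract_edge: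
  assumes "simple_graph G" "twin_pair G i j"
  shows "simple_graph (contract_edge G i j)"
proof -
  have ij: "i \<in> fst G" "j \<in> fst G" "i \<noteq> j"
    using assms unfolding simple_graph_def twin_pair_def by (auto simp: doubleton_eq_iff)
  have "(\<lambda>v. if v = i then j else v) ` e
          \<in> {{u, v} | u v. u \<in> fst G - {i} \<and> v \<in> fst G - {i} \<and> u \<noteq> v}"
    if e: "e \<in> snd G" "e \<noteq> {i, j}" for e
  proof -
    obtain u v where uv: "e = {u, v}" "u \<in> fst G" "v \<in> fst G" "u \<noteq> v"
      using assms(1) e(1) unfolding simple_graph_def by blast
    let ?f = "\<lambda>v. if v = i then j else v"
    have "?f ` e = {?f u, ?f v}" using uv(1) by simp
    moreover have "?f u \<noteq> ?f v" using uv e(2) by (auto simp: insert_commute)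
    moreover have "?f u \<in> fst G - {i}" "?f v \<in> fst G - {i}" using uv ij by auto
    ultimately show ?thesis by blast
  qed
  then show ?thesis
    using assms(1) unfolding simple_graph_def contract_edge_def by auto
qed

lemma twin_contraction_exists:
  assumes "simple_graph G"
  shows "\<exists>H. twin_contraction G H"
  using assms
proof (induction "card (fst G)" arbitrary: G rule: less_induct)
  case less
  show ?case
  proof (cases "\<exists>i j. twin_pair G i j")
    case False
    then show ?thesis unfolding twin_contraction_def by blast
  next
    case True
    then obtain i j where tw: "twin_pair G i j" by blast
    let ?H = "contract_edge G i j"
    have "finite (fst G)" "i \<in> fst G"
      using less.prems tw unfolding simple_graph_def twin_pair_def
      by (auto simp: doubleton_eq_iff)
    then have "card (fst ?H) < card (fst G)"
      unfolding contract_edge_def by (simp add: card_Diff1_less del: card_Diff_singleton card_Diff_insert)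
    then obtain K where "twin_contraction ?H K"
      using less.hyps simple_graph_contract_edge[OF less.prems tw] by blast
    moreover have "contract_twin_step G ?H"
      using tw unfolding contract_twin_step_def by blast
    ultimately show ?thesis
      unfolding twin_contraction_def by (meson converse_rtranclp_into_rtranclp)
  qed
qed

definition adjacency_matrix :: "'v graph \<Rightarrow> 'v \<Rightarrow> 'v \<Rightarrow> real" where
  "adjacency_matrix G i j = (if {i, j} \<in> snd G then 1 else 0)"

definition identity_matrix :: "'v \<Rightarrow> 'v \<Rightarrow> real" where
  "identity_matrix i j = (if i = j then 1 else 0)"

text \<open>
  Real polynomials in commuting variables indexed by \<open>'v\<close>: finitely supported maps from monomials
  to coefficients, a monomial being a finitely supported map from variables to exponents.
  The ring of polynomials in the variables of a set \<open>V\<close> is the subset \<open>polys V\<close>.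
\<close>

type_synonym 'v rpoly = "('v \<Rightarrow>\<^sub>0 nat) \<Rightarrow>\<^sub>0 real"

definition polys :: "'v set \<Rightarrow> 'v rpoly set" where
  "polys V = {p. \<forall>m \<in> Poly_Mapping.keys p. Poly_Mapping.keys m \<subseteq> V}"

definition Var :: "'v \<Rightarrow> 'v rpoly" where
  "Var i = Poly_Mapping.single (Poly_Mapping.single i 1) 1"

definition Const :: "real \<Rightarrow> 'v rpoly" where
  "Const c = Poly_Mapping.single 0 c"

definition monomial_degree :: "('v \<Rightarrow>\<^sub>0 nat) \<Rightarrow> nat" where
  "monomial_degree m = (\<Sum>i\<in>Poly_Mapping.keys m. Poly_Mapping.lookup m i)"

text \<open>The zero polynomial gets degree \<open>0\<close>, so it meets every bound \<open>total_degree p \<le> r\<close>.\<close>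

definition total_degree :: "'v rpoly \<Rightarrow> nat" where
  "total_degree p = Max (insert 0 (monomial_degree ` Poly_Mapping.keys p))"

definition eval_poly :: "'v rpoly \<Rightarrow> ('v \<Rightarrow> real) \<Rightarrow> real" where
  "eval_poly p x =
     (\<Sum>m\<in>Poly_Mapping.keys p. Poly_Mapping.lookup p m *
        (\<Prod>i\<in>Poly_Mapping.keys m. x i ^ Poly_Mapping.lookup m i))"

definition sos :: "'v set \<Rightarrow> 'v rpoly set" where
  "sos V = {\<Sum>q\<leftarrow>qs. q ^ 2 | qs. set qs \<subseteq> polys V}"

definition quadratic_module :: "'v set \<Rightarrow> nat \<Rightarrow> 'v rpoly set" where
  "quadratic_module V r =
     {\<sigma>\<^sub>0 + (\<Sum>i\<in>V. Var i * \<sigma> i) | \<sigma>\<^sub>0 \<sigma>.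
        \<sigma>\<^sub>0 \<in> sos V \<and> (\<forall>i\<in>V. \<sigma> i \<in> sos V) \<and>
        total_degree \<sigma>\<^sub>0 \<le> r \<and> (\<forall>i\<in>V. total_degree (Var i * \<sigma> i) \<le> r)}"

definition simplex_ideal :: "'v set \<Rightarrow> nat \<Rightarrow> 'v rpoly set" where
  "simplex_ideal V r =
     {q * ((\<Sum>i\<in>V. Var i) - 1) | q.
        q \<in> polys V \<and> total_degree (q * ((\<Sum>i\<in>V. Var i) - 1)) \<le> r}"

text \<open>Points of the space with coordinates in \<open>V\<close> are functions that vanish outside \<open>V\<close>.\<close>

definition standard_simplex :: "'v set \<Rightarrow> ('v \<Rightarrow> real) set" where
  "standard_simplex V =
     {x. (\<Sum>i\<in>V. x i) = 1 \<and> (\<forall>i\<in>V. x i \<ge> 0) \<and> (\<forall>i. i \<notin> V \<longrightarrow> x i = 0)}"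

text \<open>In \<^typ>\<open>ereal\<close> the supremum of the empty set is \<open>-\<infinity>\<close>.\<close>

definition lasserre_bound :: "'v set \<Rightarrow> 'v rpoly \<Rightarrow> nat \<Rightarrow> ereal" where
  "lasserre_bound V f r =
     Sup {ereal c | c. \<exists>p\<in>quadratic_module V r. \<exists>q\<in>simplex_ideal V r. f - Const c = p + q}"

text \<open>
  For finite nonempty \<open>V\<close> the infimum is a minimum, the simplex being compact and nonempty.
\<close>

definition simplex_min :: "'v set \<Rightarrow> 'v rpoly \<Rightarrow> real" where
  "simplex_min V f = (INF x\<in>standard_simplex V. eval_poly f x)"

definition lasserre_finite_convergence :: "'v set \<Rightarrow> 'v rpoly \<Rightarrow> bool" where
  "lasserre_finite_convergence V f \<longleftrightarrow>
     (\<exists>r\<ge>1. lasserre_bound V f r = ereal (simplex_min V f))"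

definition quadratic_form :: "'v set \<Rightarrow> ('v \<Rightarrow> 'v \<Rightarrow> real) \<Rightarrow> 'v rpoly" where
  "quadratic_form V M = (\<Sum>i\<in>V. \<Sum>j\<in>V. Const (M i j) * Var i * Var j)"

end

theory Submission
  imports Defs "HOL-Computational_Algebra.Polynomial"
begin

text \<open>
  Write \<open>\<alpha>\<close> for the stability number and \<open>M = A + I\<close>. Twins have equal rows in \<open>M\<close>, so the form of \<open>G\<close>
  is the form of the contracted graph \<open>H\<close>, an induced subgraph of \<open>G\<close>, at the sums of the variables
  over the classes of twins (\<open>twin_contraction_retract\<close>, \<open>clique_form_retract\<close>). By
  \<open>Motzkin_Straus\<close> its minimum on the simplex is \<open>1 / \<alpha>\<close>, attained at \<open>\<chi>\<^sub>S / \<alpha>\<close> for the maximum stable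
  sets \<open>S\<close>.

  Suppose that \<open>H\<close> has a critical edge \<open>{i, j}\<close>. Then \<open>T \<union> {i}\<close> and \<open>T \<union> {j}\<close> are maximum stable sets for
  some \<open>T\<close>, and the whole segment between the two vectors consists of minimisers. As \<open>i\<close> and \<open>j\<close> are not
  twins, some \<open>k\<close> is adjacent to exactly one of them, and the slope of the form in the direction of
  \<open>x\<^sub>k\<close> is a nonconstant affine function of the position on the segment. In a representation
  \<open>f - f\<^sup>* = \<sigma>\<^sub>0 + \<Sum> x\<^sub>l \<sigma>\<^sub>l\<close> on the hyperplane \<open>\<Sum> x\<^sub>l = 1\<close> all other terms have derivative zero at the
  minimisers, so \<open>\<sigma>\<^sub>k\<close> coincides with this affine function on the segment and hence on the line through
  it. But \<open>\<sigma>\<^sub>k\<close> is a sum of squares and cannot become negative. The supremum in the definition of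
  the bound need not be attained, so the argument is carried out for almost optimal values, with
  estimates that depend only on the degree (\<open>no_finite_convergence\<close>).

  Suppose that \<open>H\<close> has no critical edge. Then every vertex outside a maximum stable set \<open>S\<close> has at least
  two neighbours in \<open>S\<close> (\<open>two_neighbours_if_no_critical_edge\<close>). This has two consequences: the vectors
  \<open>\<chi>\<^sub>S / \<alpha>\<close> are the only minimisers (\<open>Motzkin_Straus_equality\<close>), and at each of them the slope
  in the direction of every vanishing coordinate is positive, while the Hessian is definite along
  the face. Under such conditions \<open>f - f\<^sup>*\<close> lies in the quadratic module. For the
  proof, subtract \<open>\<Sum> x\<^sub>k \<sigma>\<^sub>k\<close> with squares \<open>\<sigma>\<^sub>k\<close> that reproduce the slopes and make the Hessian of the
  difference definite in all directions; the difference can then be written as \<open>f\<^sup>T G f\<close> where the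
  common zeros of the vector \<open>f\<close> on the simplex are the minimisers and \<open>G\<close> is a matrix of
  polynomials that is positive definite there (\<open>gap_form_in_module\<close>). Damping the \<open>\<sigma>\<^sub>k\<close> away from the
  minimisers and applying Finsler's lemma makes \<open>G\<close> definite on the whole simplex
  (\<open>boundary_hessian_certificate\<close>, \<open>positive_form_in_module\<close>). Completing squares with approximate
  inverses of the pivots then leaves a sum of squares with strictly positive
  multipliers (\<open>uniformly_definite_form_in_module\<close>), and these belong to the quadratic module by
  Putinar's theorem, which is proved with a maximal quadratic module (\<open>Putinar\<close>).

  All of this takes place in the polynomial ring of \<open>G\<close>. The variables of \<open>H\<close> are the sums over the classes
  of twins, which belong to the quadratic module of \<open>G\<close> together with their products with squares.
\<close>

section \<open>Polynomials as a ring: substitution, evaluation, degree\<close>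

lemma Const_0 [simp]: "Const 0 = 0"
  and Const_1 [simp]: "Const 1 = 1"
  and Const_numeral [simp]: "Const (numeral w) = numeral w"
  and Const_add: "Const (a + b) = Const a + Const b"
  and Const_diff: "Const (a - b) = Const a - Const b"
  and Const_minus: "Const (- a) = - Const a"
  and Const_mult: "Const (a * b) = Const a * Const b"
  by (simp_all add: Const_def single_add single_diff single_uminus mult_single)

lemmas Const_hom = Const_add Const_diff Const_minus Const_mult

lemma Const_power: "Const (a ^ k) = Const a ^ k"
  by (induction k) (simp_all add: Const_mult)

lemma Const_sum: "Const (sum f A) = (\<Sum>i\<in>A. Const (f i))"
  by (induction A rule: infinite_finite_induct) (simp_all add: Const_add)

lemma Const_inverse_mult: "c \<noteq> 0 \<Longrightarrow> Const (1 / c) * Const c = 1"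
  by (simp flip: Const_mult)

text \<open>
  The image of a polynomial under the ring homomorphism that acts as \<open>c\<close> on coefficients and sends
  the variables to prescribed elements. Evaluation at a point, restriction to a line, and setting
  some of the variables to zero are all of this form, so their algebraic laws are proved once.
\<close>

definition subst_poly :: "(real \<Rightarrow> 'b::comm_ring_1) \<Rightarrow> ('v \<Rightarrow> 'b) \<Rightarrow> 'v rpoly \<Rightarrow> 'b" where
  "subst_poly c \<phi> p = (\<Sum>m\<in>Poly_Mapping.keys p. c (Poly_Mapping.lookup p m) *
      (\<Prod>i\<in>Poly_Mapping.keys m. \<phi> i ^ Poly_Mapping.lookup m i))"

definition real_ring_hom :: "(real \<Rightarrow> 'b::comm_ring_1) \<Rightarrow> bool" where
  "real_ring_hom c \<longleftrightarrow> c 1 = 1 \<and> (\<forall>a b. c (a + b) = c a + c b) \<and> (\<forall>a b. c (a * b) = c a * c b)"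

lemma real_ring_hom_0: "real_ring_hom c \<Longrightarrow> c 0 = 0"
  unfolding real_ring_hom_def by (metis add_cancel_right_right)

lemma monomial_superset:
  assumes "finite A" "Poly_Mapping.keys m \<subseteq> A"
  shows "(\<Prod>i\<in>Poly_Mapping.keys m. \<phi> i ^ Poly_Mapping.lookup m i)
       = (\<Prod>i\<in>A. (\<phi> i :: 'b::comm_ring_1) ^ Poly_Mapping.lookup m i)"
  by (rule prod.mono_neutral_left) (use assms in \<open>auto simp: in_keys_iff\<close>)

lemma monomial_add:
  "(\<Prod>i\<in>Poly_Mapping.keys (m + m'). \<phi> i ^ Poly_Mapping.lookup (m + m') i)
     = (\<Prod>i\<in>Poly_Mapping.keys m. \<phi> i ^ Poly_Mapping.lookup m i) *
       (\<Prod>i\<in>Poly_Mapping.keys m'. (\<phi> i :: 'b::comm_ring_1) ^ Poly_Mapping.lookup m' i)"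
proof -
  let ?A = "Poly_Mapping.keys m \<union> Poly_Mapping.keys m'"
  have "Poly_Mapping.keys (m + m') \<subseteq> ?A" by (rule keys_add)
  then show ?thesis
    using monomial_superset[of ?A "m + m'" \<phi>] monomial_superset[of ?A m \<phi>]
      monomial_superset[of ?A m' \<phi>]
    by (simp add: lookup_add power_add prod.distrib)
qed

context
  fixes c :: "real \<Rightarrow> 'b::comm_ring_1" and \<phi> :: "'v \<Rightarrow> 'b"
  assumes c: "real_ring_hom c"
begin

lemma subst_poly_superset:
  assumes "finite A" "Poly_Mapping.keys p \<subseteq> A"
  shows "subst_poly c \<phi> p = (\<Sum>m\<in>A. c (Poly_Mapping.lookup p m) *
      (\<Prod>i\<in>Poly_Mapping.keys m. \<phi> i ^ Poly_Mapping.lookup m i))"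
  unfolding subst_poly_def
  by (rule sum.mono_neutral_left) (use assms real_ring_hom_0[OF c] in \<open>auto simp: in_keys_iff\<close>)

lemma subst_poly_add: "subst_poly c \<phi> (p + q) = subst_poly c \<phi> p + subst_poly c \<phi> q"
proof -
  let ?A = "Poly_Mapping.keys p \<union> Poly_Mapping.keys q"
  have "Poly_Mapping.keys (p + q) \<subseteq> ?A" by (rule keys_add)
  moreover have "c (a + b) = c a + c b" for a b using c unfolding real_ring_hom_def by blast
  ultimately show ?thesis
    using subst_poly_superset[of ?A "p + q"] subst_poly_superset[of ?A p]
      subst_poly_superset[of ?A q]
    by (simp add: lookup_add distrib_right sum.distrib)
qed

lemma subst_poly_0: "subst_poly c \<phi> 0 = 0"
  by (simp add: subst_poly_def)

lemma subst_poly_sum: "subst_poly c \<phi> (\<Sum>i\<in>A. f i) = (\<Sum>i\<in>A. subst_poly c \<phi> (f i))"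
  by (induction A rule: infinite_finite_induct) (auto simp: subst_poly_0 subst_poly_add)

lemma subst_poly_single:
  "subst_poly c \<phi> (Poly_Mapping.single m a)
     = c a * (\<Prod>i\<in>Poly_Mapping.keys m. \<phi> i ^ Poly_Mapping.lookup m i)"
  using subst_poly_superset[of "{m}" "Poly_Mapping.single m a"] by simp

lemma subst_poly_Const: "subst_poly c \<phi> (Const a) = c a"
  unfolding Const_def by (simp add: subst_poly_single)

lemma subst_poly_Var: "subst_poly c \<phi> (Var i) = \<phi> i"
  using c unfolding Var_def real_ring_hom_def by (simp add: subst_poly_single)

end

lemma rpoly_sum_singles:
  "p = (\<Sum>m\<in>Poly_Mapping.keys p. Poly_Mapping.single m (Poly_Mapping.lookup p m))"
proof (rule poly_mapping_eqI)
  fix k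
  show "Poly_Mapping.lookup p k = Poly_Mapping.lookup
    (\<Sum>m\<in>Poly_Mapping.keys p. Poly_Mapping.single m (Poly_Mapping.lookup p m)) k"
    by (simp add: lookup_sum lookup_single when_def sum.delta' in_keys_iff)
qed

lemma subst_poly_mult:
  assumes c: "real_ring_hom c"
  shows "subst_poly c \<phi> (p * q) = subst_poly c \<phi> p * subst_poly c \<phi> q"
proof -
  let ?s = "\<lambda>p m. Poly_Mapping.single m (Poly_Mapping.lookup p m)"
  have cm: "c (a * b) = c a * c b" for a b using c unfolding real_ring_hom_def by blast
  have "subst_poly c \<phi> (p * q)
      = subst_poly c \<phi> ((\<Sum>m\<in>Poly_Mapping.keys p. ?s p m) * (\<Sum>m\<in>Poly_Mapping.keys q. ?s q m))"
    using rpoly_sum_singles[of p] rpoly_sum_singles[of q] by metis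
  also have "\<dots> = (\<Sum>m\<in>Poly_Mapping.keys p. \<Sum>m'\<in>Poly_Mapping.keys q.
                    subst_poly c \<phi> (?s p m * ?s q m'))"
    by (simp add: sum_product subst_poly_sum[OF c])
  also have "\<dots> = (\<Sum>m\<in>Poly_Mapping.keys p. \<Sum>m'\<in>Poly_Mapping.keys q.
                    subst_poly c \<phi> (?s p m) * subst_poly c \<phi> (?s q m'))"
    by (simp add: mult_single subst_poly_single[OF c] monomial_add cm mult_ac)
  also have "\<dots> = subst_poly c \<phi> (\<Sum>m\<in>Poly_Mapping.keys p. ?s p m)
                * subst_poly c \<phi> (\<Sum>m\<in>Poly_Mapping.keys q. ?s q m)"
    by (simp add: sum_product subst_poly_sum[OF c])
  also have "\<dots> = subst_poly c \<phi> p * subst_poly c \<phi> q"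
    using rpoly_sum_singles[of p] rpoly_sum_singles[of q] by metis
  finally show ?thesis .
qed

lemma subst_poly_1: "real_ring_hom c \<Longrightarrow> subst_poly c \<phi> 1 = 1"
  using subst_poly_Const[of c \<phi> 1] by (simp add: real_ring_hom_def)

lemma subst_poly_minus: "real_ring_hom c \<Longrightarrow> subst_poly c \<phi> (- p) = - subst_poly c \<phi> p"
  using subst_poly_add[of c \<phi> p "- p"] subst_poly_0[of c \<phi>] by (simp add: eq_neg_iff_add_eq_0 add.commute)

lemma subst_poly_diff:
  "real_ring_hom c \<Longrightarrow> subst_poly c \<phi> (p - q) = subst_poly c \<phi> p - subst_poly c \<phi> q"
  using subst_poly_add[of c \<phi> p "- q"] subst_poly_minus[of c \<phi> q] by simp

lemma subst_poly_power: "real_ring_hom c \<Longrightarrow> subst_poly c \<phi> (p ^ k) = subst_poly c \<phi> p ^ k"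
  by (induction k) (simp_all add: subst_poly_1 subst_poly_mult)

lemmas subst_poly_hom = subst_poly_0 subst_poly_1 subst_poly_Const subst_poly_Var subst_poly_add
  subst_poly_diff subst_poly_minus subst_poly_mult subst_poly_power subst_poly_sum

lemma real_ring_hom_ident: "real_ring_hom (\<lambda>a. a :: real)"
  by (simp add: real_ring_hom_def)

lemma real_ring_hom_Const: "real_ring_hom (Const :: real \<Rightarrow> 'v rpoly)"
  by (simp add: real_ring_hom_def Const_hom)

lemma real_ring_hom_pCons: "real_ring_hom (\<lambda>a. [:a:] :: real poly)"
  by (simp add: real_ring_hom_def)

lemma eval_poly_subst: "eval_poly p x = subst_poly (\<lambda>a. a) x p"
  by (simp add: eval_poly_def subst_poly_def)

lemmas eval_poly_hom [simp] =
  subst_poly_hom[OF real_ring_hom_ident, folded eval_poly_subst]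

lemma eval_poly_numeral [simp]: "eval_poly (numeral w) x = numeral w"
  using eval_poly_hom(3)[of "numeral w" x] by simp

lemma eval_poly_prod [simp]: "eval_poly (\<Prod>i\<in>A. f i) x = (\<Prod>i\<in>A. eval_poly (f i) x)"
  by (induction A rule: infinite_finite_induct) auto

lemma continuous_on_eval_poly:
  "continuous_on S (\<lambda>x :: 'v \<Rightarrow> real. eval_poly p x)"
  unfolding eval_poly_def
  by (intro continuous_intros continuous_on_product_then_coordinatewise)

lemma rpoly_induct_on [consumes 1, case_names Const Var add mult]:
  assumes "p \<in> polys V"
    and Const: "\<And>a. P (Const a)" and Var: "\<And>i. i \<in> V \<Longrightarrow> P (Var i)"
    and add: "\<And>p q. P p \<Longrightarrow> P q \<Longrightarrow> P (p + q)" and mult: "\<And>p q. P p \<Longrightarrow> P q \<Longrightarrow> P (p * q)"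
  shows "P p"
proof -
  have pow: "P (Var i ^ k)" if "i \<in> V" for i k
    by (induction k) (use Const[of 1] Var[OF that] mult in auto)
  have psum: "P (\<Sum>i\<in>A. f i)" if "finite A" "\<And>i. i \<in> A \<Longrightarrow> P (f i)" for A :: "('v \<Rightarrow>\<^sub>0 nat) set" and f
    using that by (induction A rule: finite_induct) (use Const[of 0] add in auto)
  have pprod: "P (\<Prod>i\<in>A. f i)" if "finite A" "\<And>i. i \<in> A \<Longrightarrow> P (f i)" for A :: "'v set" and f
    using that by (induction A rule: finite_induct) (use Const[of 1] mult in auto)
  have varpow: "Var i ^ k = Poly_Mapping.single (Poly_Mapping.single i k) 1" for i :: 'v and k
    by (induction k) (auto simp: Var_def mult_single simp flip: single_add)
  have mono: "Poly_Mapping.single m a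
      = Const a * (\<Prod>i\<in>Poly_Mapping.keys m. Var i ^ Poly_Mapping.lookup m i)"
    for m :: "'v \<Rightarrow>\<^sub>0 nat" and a
  proof -
    have "(\<Prod>i\<in>A. Poly_Mapping.single (f i) 1)
        = (Poly_Mapping.single (\<Sum>i\<in>A. f i) 1 :: 'v rpoly)" for A :: "'v set" and f
      by (induction A rule: infinite_finite_induct) (auto simp: mult_single)
    moreover have "m = (\<Sum>i\<in>Poly_Mapping.keys m. Poly_Mapping.single i (Poly_Mapping.lookup m i))"
      by (rule poly_mapping_eqI)
        (simp add: lookup_sum lookup_single when_def sum.delta' in_keys_iff)
    ultimately show ?thesis
      by (simp add: varpow Const_def mult_single)
  qed
  have "P (Poly_Mapping.single m (Poly_Mapping.lookup p m))" if "m \<in> Poly_Mapping.keys p" for m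
  proof -
    have "Poly_Mapping.keys m \<subseteq> V" using assms(1) that unfolding polys_def by blast
    then show ?thesis
      unfolding mono by (intro mult Const pprod) (auto intro: pow)
  qed
  then have "P (\<Sum>m\<in>Poly_Mapping.keys p. Poly_Mapping.single m (Poly_Mapping.lookup p m))"
    by (intro psum) auto
  then show ?thesis using rpoly_sum_singles[of p] by simp
qed

lemma polys_UNIV [simp]: "polys UNIV = UNIV"
  by (simp add: polys_def)

lemma polys_Const [simp]: "Const a \<in> polys V"
  by (simp add: polys_def Const_def)

lemma polys_Var: "i \<in> V \<Longrightarrow> Var i \<in> polys V"
  by (simp add: polys_def Var_def)

lemma polys_add: "p \<in> polys V \<Longrightarrow> q \<in> polys V \<Longrightarrow> p + q \<in> polys V"
  using keys_add[of p q] unfolding polys_def by blast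

lemma polys_mult: "p \<in> polys V \<Longrightarrow> q \<in> polys V \<Longrightarrow> p * q \<in> polys V"
proof -
  assume p: "p \<in> polys V" and q: "q \<in> polys V"
  have "Poly_Mapping.keys m \<subseteq> V" if m: "m \<in> Poly_Mapping.keys (p * q)" for m
  proof -
    obtain a b where ab: "m = a + b" "a \<in> Poly_Mapping.keys p" "b \<in> Poly_Mapping.keys q"
      using m keys_mult[of p q] by blast
    then show ?thesis using p q keys_add[of a b] unfolding polys_def by blast
  qed
  then show ?thesis unfolding polys_def by blast
qed

lemma polys_0 [simp]: "0 \<in> polys V" and polys_1 [simp]: "1 \<in> polys V"
  using polys_Const[of 0 V] polys_Const[of 1 V] by simp_all

lemma polys_minus: "p \<in> polys V \<Longrightarrow> - p \<in> polys V"
  by (simp add: polys_def)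

lemma polys_diff: "p \<in> polys V \<Longrightarrow> q \<in> polys V \<Longrightarrow> p - q \<in> polys V"
  using polys_add[OF _ polys_minus, of p V q] by simp

lemma polys_sum: "(\<And>i. i \<in> A \<Longrightarrow> f i \<in> polys V) \<Longrightarrow> (\<Sum>i\<in>A. f i) \<in> polys V"
  by (induction A rule: infinite_finite_induct) (auto intro: polys_add)

lemma total_degree_le_iff:
  "total_degree p \<le> r \<longleftrightarrow> (\<forall>m\<in>Poly_Mapping.keys p. monomial_degree m \<le> r)"
  unfolding total_degree_def by auto

definition along_line :: "('v \<Rightarrow> real) \<Rightarrow> ('v \<Rightarrow> real) \<Rightarrow> 'v rpoly \<Rightarrow> real poly" where
  "along_line a b p = subst_poly (\<lambda>c. [:c:]) (\<lambda>i. [:a i, b i:]) p"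

lemmas along_line_hom = subst_poly_hom[OF real_ring_hom_pCons, of "\<lambda>i. [:a i, b i:]" for a b,
    folded along_line_def]

lemma poly_along_line: "poly (along_line a b p) s = eval_poly p (\<lambda>i. a i + s * b i)"
proof -
  have "p \<in> polys UNIV" by simp
  then show ?thesis
    by (induction p rule: rpoly_induct_on) (auto simp: along_line_hom)
qed

lemma degree_along_line: "total_degree p \<le> r \<Longrightarrow> degree (along_line a b p) \<le> r"
  unfolding along_line_def subst_poly_def
proof (rule degree_sum_le)
  fix m assume m: "m \<in> Poly_Mapping.keys p" and r: "total_degree p \<le> r"
  have "degree (\<Prod>i\<in>Poly_Mapping.keys m. [:a i, b i:] ^ Poly_Mapping.lookup m i)
      \<le> (\<Sum>i\<in>Poly_Mapping.keys m. degree ([:a i, b i:] ^ Poly_Mapping.lookup m i))"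
    using degree_prod_sum_le[of "Poly_Mapping.keys m"
        "\<lambda>i. [:a i, b i:] ^ Poly_Mapping.lookup m i"] by (simp add: o_def)
  also have "\<dots> \<le> (\<Sum>i\<in>Poly_Mapping.keys m. Poly_Mapping.lookup m i)"
  proof (rule sum_mono)
    fix i
    have "degree ([:a i, b i:] ^ Poly_Mapping.lookup m i)
        \<le> degree [:a i, b i:] * Poly_Mapping.lookup m i" by (rule degree_power_le)
    also have "\<dots> \<le> 1 * Poly_Mapping.lookup m i" by (rule mult_right_mono) auto
    finally show "degree ([:a i, b i:] ^ Poly_Mapping.lookup m i) \<le> Poly_Mapping.lookup m i" by simp
  qed
  also have "\<dots> \<le> r" using m r unfolding total_degree_le_iff monomial_degree_def by blast
  finally have "degree (\<Prod>i\<in>Poly_Mapping.keys m. [:a i, b i:] ^ Poly_Mapping.lookup m i) \<le> r" .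
  then show "degree ([:Poly_Mapping.lookup p m:] *
      (\<Prod>i\<in>Poly_Mapping.keys m. [:a i, b i:] ^ Poly_Mapping.lookup m i)) \<le> r"
    using degree_mult_le[of "[:Poly_Mapping.lookup p m:]"
      "\<Prod>i\<in>Poly_Mapping.keys m. [:a i, b i:] ^ Poly_Mapping.lookup m i"] by simp
qed simp

lemma lookup_single_mult:
  "Poly_Mapping.lookup (Poly_Mapping.single k a * p) (k + m) = a * Poly_Mapping.lookup p m"
  for p :: "'v rpoly"
proof -
  have "Poly_Mapping.single k a * p
      = (\<Sum>l\<in>Poly_Mapping.keys p. Poly_Mapping.single (k + l) (a * Poly_Mapping.lookup p l))"
    by (subst (1) rpoly_sum_singles[of p]) (simp add: sum_distrib_left mult_single)
  then show ?thesis
    by (simp add: lookup_sum lookup_single when_def sum.delta' in_keys_iff)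
qed

lemma total_degree_Var_mult:
  assumes "total_degree (Var i * p) \<le> r"
  shows "total_degree p \<le> r"
  unfolding total_degree_le_iff
proof
  fix m assume m: "m \<in> Poly_Mapping.keys p"
  let ?k = "Poly_Mapping.single i (1::nat)"
  have "?k + m \<in> Poly_Mapping.keys (Var i * p)"
    using m unfolding Var_def in_keys_iff by (simp add: lookup_single_mult)
  then have "monomial_degree (?k + m) \<le> r" using assms unfolding total_degree_le_iff by blast
  moreover have "monomial_degree m \<le> monomial_degree (?k + m)"
  proof -
    have "monomial_degree m \<le> (\<Sum>j\<in>Poly_Mapping.keys m. Poly_Mapping.lookup (?k + m) j)"
      unfolding monomial_degree_def by (rule sum_mono) (simp add: lookup_add)
    also have "\<dots> \<le> monomial_degree (?k + m)"
      unfolding monomial_degree_def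
      by (rule sum_mono2) (auto simp: in_keys_iff lookup_add)
    finally show ?thesis .
  qed
  ultimately show "monomial_degree m \<le> r" by linarith
qed

section \<open>Putinar's theorem for archimedean quadratic modules\<close>

definition quad_module :: "'v rpoly set \<Rightarrow> bool" where
  "quad_module Q \<longleftrightarrow> 1 \<in> Q \<and> (\<forall>a\<in>Q. \<forall>b\<in>Q. a + b \<in> Q) \<and> (\<forall>a\<in>Q. \<forall>b. b\<^sup>2 * a \<in> Q)"

definition archimedean :: "'v rpoly set \<Rightarrow> bool" where
  "archimedean Q \<longleftrightarrow> (\<forall>p. \<exists>N. Const N - p \<in> Q)"

lemma sos_0: "0 \<in> sos V"
  unfolding sos_def by (force intro: exI[of _ "[]"])

lemma sos_square: "p \<in> polys V \<Longrightarrow> p\<^sup>2 \<in> sos V"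
  unfolding sos_def by (force intro: exI[of _ "[p]"])

lemma sos_add:
  assumes "p \<in> sos V" "q \<in> sos V"
  shows "p + q \<in> sos V"
proof -
  obtain ps qs where "p = (\<Sum>q\<leftarrow>ps. q\<^sup>2)" "q = (\<Sum>q\<leftarrow>qs. q\<^sup>2)" "set ps \<subseteq> polys V" "set qs \<subseteq> polys V"
    using assms unfolding sos_def by blast
  then have "p + q = (\<Sum>q\<leftarrow>ps @ qs. q\<^sup>2)" "set (ps @ qs) \<subseteq> polys V" by auto
  then show ?thesis unfolding sos_def by blast
qed

lemma sos_induct [consumes 1, case_names zero add]:
  assumes "s \<in> sos V" "P 0" "\<And>q s. q \<in> polys V \<Longrightarrow> s \<in> sos V \<Longrightarrow> P s \<Longrightarrow> P (q\<^sup>2 + s)"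
  shows "P s"
proof -
  have "P (\<Sum>q\<leftarrow>qs. q\<^sup>2) \<and> (\<Sum>q\<leftarrow>qs. q\<^sup>2) \<in> sos V" if "set qs \<subseteq> polys V" for qs
    using that by (induction qs) (auto simp: assms sos_0 intro!: assms(3) sos_add sos_square)
  then show ?thesis using assms(1) unfolding sos_def by blast
qed

lemma sos_mult_square: "s \<in> sos V \<Longrightarrow> b \<in> polys V \<Longrightarrow> b\<^sup>2 * s \<in> sos V"
proof (induction rule: sos_induct)
  case (add q s)
  have "b\<^sup>2 * (q\<^sup>2 + s) = (b * q)\<^sup>2 + b\<^sup>2 * s" by (simp add: algebra_simps power_mult_distrib)
  then show ?case using add by (auto intro!: sos_add sos_square polys_mult)
qed (simp add: sos_0)

lemma eval_sos_nonneg: "s \<in> sos V \<Longrightarrow> 0 \<le> eval_poly s x"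
  by (induction rule: sos_induct) auto

lemma sos_Const: "0 \<le> c \<Longrightarrow> Const c \<in> sos V"
  using sos_square[of "Const (sqrt c)" V] by (simp flip: Const_power)

context
  fixes Q :: "'v rpoly set"
  assumes qm: "quad_module Q"
begin

lemma qm_1: "1 \<in> Q" and qm_add: "a \<in> Q \<Longrightarrow> b \<in> Q \<Longrightarrow> a + b \<in> Q"
  and qm_square_mult: "a \<in> Q \<Longrightarrow> b\<^sup>2 * a \<in> Q"
  using qm unfolding quad_module_def by blast+

lemma qm_0: "0 \<in> Q"
  using qm_square_mult[OF qm_1, of 0] by simp

lemma qm_square: "b\<^sup>2 \<in> Q"
  using qm_square_mult[OF qm_1, of b] by simp

lemma qm_sos_mult: "s \<in> sos V \<Longrightarrow> a \<in> Q \<Longrightarrow> s * a \<in> Q"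
  by (induction rule: sos_induct) (auto simp: distrib_right intro: qm_add qm_0 qm_square_mult)

lemma qm_sos: "s \<in> sos V \<Longrightarrow> s \<in> Q"
  using qm_sos_mult[OF _ qm_1] by simp

lemma qm_Const: "0 \<le> c \<Longrightarrow> Const c \<in> Q"
  using qm_sos[OF sos_Const, of c] by simp

lemma qm_scale: "0 \<le> c \<Longrightarrow> a \<in> Q \<Longrightarrow> Const c * a \<in> Q"
  using qm_sos_mult[OF sos_Const, of c a] by simp

lemma qm_scaleD: "0 < c \<Longrightarrow> Const c * a \<in> Q \<Longrightarrow> a \<in> Q"
  using qm_scale[of "1 / c" "Const c * a"] Const_inverse_mult[of c, where ?'a = 'v]
  by (simp add: mult.assoc[symmetric])

lemma qm_sum: "(\<And>i. i \<in> A \<Longrightarrow> f i \<in> Q) \<Longrightarrow> (\<Sum>i\<in>A. f i) \<in> Q"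
  by (induction A rule: infinite_finite_induct) (auto intro: qm_0 qm_add)

lemma qm_Const_mono: "Const M - p \<in> Q \<Longrightarrow> M \<le> N \<Longrightarrow> Const N - p \<in> Q"
  using qm_add[of "Const M - p" "Const (N - M)"] qm_Const[of "N - M"]
  by (simp add: Const_diff)

lemma qm_Const_neg:
  assumes "-1 \<notin> Q" "Const c \<in> Q"
  shows "0 \<le> c"
proof (rule ccontr)
  assume "\<not> 0 \<le> c"
  then have "Const (1 / (- c)) * Const c \<in> Q" using assms(2) by (intro qm_scale) auto
  moreover have "Const (1 / (- c)) * Const c = -1"
    using \<open>\<not> 0 \<le> c\<close> by (simp add: Const_minus flip: Const_mult)
  ultimately show False using assms(1) by metis
qed

text \<open>
  The elements whose square is bounded modulo \<open>Q\<close> form a subring, so bounds on the variables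
  propagate to all polynomials.
\<close>

lemma archimedean_from_variables:
  assumes "\<And>i. \<exists>N. Const N - (Var i)\<^sup>2 \<in> Q"
  shows "archimedean Q"
proof -
  have sq: "\<exists>N\<ge>0. Const N - p\<^sup>2 \<in> Q" for p
  proof -
    have "p \<in> polys UNIV" by simp
    then show ?thesis
    proof (induction p rule: rpoly_induct_on)
      case (Const a)
      have "Const (a\<^sup>2) - (Const a)\<^sup>2 \<in> Q" by (simp add: Const_power qm_0)
      then show ?case by (intro exI[of _ "a\<^sup>2"]) simp
    next
      case (Var i)
      then obtain N where "Const N - (Var i)\<^sup>2 \<in> Q" using assms by blast
      then show ?case using qm_Const_mono[of N _ "max 0 N"] by (intro exI[of _ "max 0 N"]) auto
    next
      case (add p q)
      then obtain M N where MN: "0 \<le> M" "0 \<le> N" "Const M - p\<^sup>2 \<in> Q" "Const N - q\<^sup>2 \<in> Q" by blast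
      have "Const (2 * M + 2 * N) - (p + q)\<^sup>2
          = Const 2 * (Const M - p\<^sup>2) + Const 2 * (Const N - q\<^sup>2) + (p - q)\<^sup>2"
        by (simp add: Const_hom power2_eq_square algebra_simps)
      moreover have "\<dots> \<in> Q" using MN by (intro qm_add qm_scale qm_square) auto
      ultimately show ?case using MN by (intro exI[of _ "2 * M + 2 * N"]) auto
    next
      case (mult p q)
      then obtain M N where MN: "0 \<le> M" "0 \<le> N" "Const M - p\<^sup>2 \<in> Q" "Const N - q\<^sup>2 \<in> Q" by blast
      have "Const (M * N) - (p * q)\<^sup>2 = q\<^sup>2 * (Const M - p\<^sup>2) + Const M * (Const N - q\<^sup>2)"
        by (simp add: Const_hom power2_eq_square algebra_simps)
      moreover have "\<dots> \<in> Q" using MN by (intro qm_add qm_scale qm_square_mult) auto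
      ultimately show ?case using MN by (intro exI[of _ "M * N"]) auto
    qed
  qed
  have "\<exists>N. Const N - p \<in> Q" for p
  proof -
    obtain N where N: "Const N - p\<^sup>2 \<in> Q" using sq by blast
    have "Const 2 * (Const ((N + 1) / 2) - p) = (Const N - p\<^sup>2) + (p - 1)\<^sup>2"
    proof -
      have "Const 2 * Const ((N + 1) / 2) = Const (2 * ((N + 1) / 2))" by (simp only: Const_mult)
      also have "2 * ((N + 1) / 2) = N + 1" by (simp add: field_simps)
      also have "Const (N + 1) = Const N + 1" by (simp add: Const_add)
      finally have "Const 2 * Const ((N + 1) / 2) = Const N + 1" .
      then show ?thesis by (simp add: algebra_simps power2_eq_square)
    qed
    moreover have "\<dots> \<in> Q" by (intro qm_add N qm_square)
    ultimately show ?thesis using qm_scaleD[of 2 "Const ((N + 1) / 2) - p"] by auto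
  qed
  then show ?thesis unfolding archimedean_def by blast
qed

end

text \<open>
  An archimedean quadratic module that does not contain \<open>-1\<close> and is total is a ring of bounded
  elements with one real value for each element, like an ordering. The value is multiplicative
  because \<open>(\<delta> - a)\<^sup>2 (\<delta> + a) + (\<delta> + a)\<^sup>2 (\<delta> - a) = 2 \<delta> (\<delta>\<^sup>2 - a\<^sup>2)\<close> turns the bound
  \<open>-\<delta> \<le> a \<le> \<delta>\<close> into \<open>a\<^sup>2 \<le> \<delta>\<^sup>2\<close>. So the value is evaluation at a point.
\<close>

lemma total_quad_module_point:
  fixes Q :: "'v rpoly set"
  assumes qm: "quad_module Q" and arch: "archimedean Q" and proper: "-1 \<notin> Q"
    and total: "\<And>a. a \<in> Q \<or> - a \<in> Q"
  shows "\<exists>x. \<forall>q\<in>Q. 0 \<le> eval_poly q x"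
proof -
  define val where "val a r \<longleftrightarrow> (\<forall>e>0. a - Const (r - e) \<in> Q \<and> Const (r + e) - a \<in> Q)" for a r
  have ex: "\<exists>r. val a r" for a
  proof -
    define S where "S = {r. a - Const r \<in> Q}"
    obtain N where N: "Const N - a \<in> Q" using arch unfolding archimedean_def by blast
    obtain N' where "Const N' - (- a) \<in> Q" using arch unfolding archimedean_def by blast
    then have ne: "S \<noteq> {}" unfolding S_def by (auto simp: Const_minus add.commute intro!: exI[of _ "- N'"])
    have bd: "bdd_above S"
    proof (rule bdd_aboveI)
      fix r assume "r \<in> S"
      then have "(Const N - a) + (a - Const r) \<in> Q" using N unfolding S_def by (intro qm_add[OF qm]) auto
      then have "Const (N - r) \<in> Q" by (simp add: Const_diff)
      then show "r \<le> N" using qm_Const_neg[OF qm proper] by force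
    qed
    have "val a (Sup S)"
      unfolding val_def
    proof (intro allI impI conjI)
      fix e :: real assume e: "0 < e"
      then obtain r where r: "r \<in> S" "Sup S - e < r"
        using less_cSupD[OF ne, of "Sup S - e"] by auto
      have "(a - Const r) + Const (r - (Sup S - e)) \<in> Q"
        using r unfolding S_def by (intro qm_add[OF qm] qm_Const[OF qm]) auto
      also have "(a - Const r) + Const (r - (Sup S - e)) = a - Const (Sup S - e)"
        by (simp add: Const_hom algebra_simps)
      finally show "a - Const (Sup S - e) \<in> Q" .
      have "Sup S + e \<notin> S" using cSup_upper[OF _ bd, of "Sup S + e"] e by force
      then have "- (a - Const (Sup S + e)) \<in> Q" using total unfolding S_def by blast
      then show "Const (Sup S + e) - a \<in> Q" by simp
    qed
    then show ?thesis by blast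
  qed
  have val_Const: "val (Const c) c" for c
    unfolding val_def by (auto simp: Const_hom intro: qm_Const[OF qm])
  have val_add: "val (a + b) (r + s)" if "val a r" "val b s" for a b r s
    unfolding val_def
  proof (intro allI impI conjI)
    fix e :: real assume e: "0 < e"
    have "(a - Const (r - e / 2)) + (b - Const (s - e / 2)) \<in> Q"
         "(Const (r + e / 2) - a) + (Const (s + e / 2) - b) \<in> Q"
      using that e unfolding val_def by (auto intro!: qm_add[OF qm])
    moreover have "(Const (r + s - e) :: 'v rpoly) = Const (r - e / 2) + Const (s - e / 2)"
         "(Const (r + s + e) :: 'v rpoly) = Const (r + e / 2) + Const (s + e / 2)"
      by (simp_all add: algebra_simps flip: Const_add)
    ultimately show "a + b - Const (r + s - e) \<in> Q" "Const (r + s + e) - (a + b) \<in> Q"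
      by (simp_all add: algebra_simps)
  qed
  have val_minus: "val (- a) (- r)" if "val a r" for a r
    using that unfolding val_def by (auto simp: Const_hom algebra_simps)
  have val_pos: "val (Const c * a) (c * r)" if "val a r" "0 < c" for a r c
    unfolding val_def
  proof (intro allI impI conjI)
    fix e :: real assume e: "0 < e"
    have "Const c * (a - Const (r - e / c)) \<in> Q" "Const c * (Const (r + e / c) - a) \<in> Q"
      using that e unfolding val_def by (auto intro!: qm_scale[OF qm])
    moreover have "(Const (c * r - e) :: 'v rpoly) = Const c * Const (r - e / c)"
         "(Const (c * r + e) :: 'v rpoly) = Const c * Const (r + e / c)"
      using that by (simp_all add: right_diff_distrib distrib_left flip: Const_mult)
    ultimately show "Const c * a - Const (c * r - e) \<in> Q" "Const (c * r + e) - Const c * a \<in> Q"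
      by (simp_all add: right_diff_distrib)
  qed
  have val_scale: "val (Const c * a) (c * r)" if "val a r" for a r c
  proof -
    consider "c = 0" | "0 < c" | "c < 0" by linarith
    then show ?thesis
    proof cases
      case 1 then show ?thesis using val_Const[of 0] by simp
    next
      case 2 then show ?thesis using val_pos that by blast
    next
      case 3 then show ?thesis using val_minus[OF val_pos[OF that, of "- c"]] by (simp add: Const_minus)
    qed
  qed
  have val_square0: "val (a\<^sup>2) 0" if a: "val a 0" for a
    unfolding val_def
  proof (intro allI impI conjI)
    fix e :: real assume e: "0 < e"
    have "a\<^sup>2 + Const e \<in> Q" using e by (intro qm_add[OF qm] qm_square[OF qm] qm_Const[OF qm]) auto
    then show "a\<^sup>2 - Const (0 - e) \<in> Q" by (simp add: Const_minus)
    define d where "d = sqrt e"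
    have d: "0 < d" "d\<^sup>2 = e" using e by (auto simp: d_def)
    have "Const d + a \<in> Q" "Const d - a \<in> Q"
      using a d unfolding val_def by (auto simp: Const_minus add.commute)
    then have "(Const d - a)\<^sup>2 * (Const d + a) + (Const d + a)\<^sup>2 * (Const d - a) \<in> Q"
      by (intro qm_add[OF qm, OF qm_square_mult[OF qm] qm_square_mult[OF qm]])
    also have "(Const d - a)\<^sup>2 * (Const d + a) + (Const d + a)\<^sup>2 * (Const d - a)
        = Const (2 * d) * (Const e - a\<^sup>2)"
      unfolding d(2)[symmetric] by (simp add: Const_mult Const_power power2_eq_square algebra_simps)
    finally show "Const (0 + e) - a\<^sup>2 \<in> Q" using qm_scaleD[OF qm, of "2 * d"] d by simp
  qed
  have val_square: "val (a\<^sup>2) (r\<^sup>2)" if a: "val a r" for a r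
  proof -
    have "val (a + Const (- r)) (r + - r)" by (rule val_add[OF a val_Const])
    then have "val ((a + Const (- r))\<^sup>2) 0" by (intro val_square0) simp
    from val_add[OF val_add[OF this val_scale[OF a, of "2 * r"]] val_Const[of "- r\<^sup>2"]]
    show ?thesis by (simp add: Const_hom Const_power power2_eq_square algebra_simps)
  qed
  have val_mult: "val (a * b) (r * s)" if a: "val a r" and b: "val b s" for a b r s
  proof -
    have "val ((a + b)\<^sup>2 + - ((a + - b)\<^sup>2)) ((r + s)\<^sup>2 + - ((r + - s)\<^sup>2))"
      by (intro val_add val_square val_minus a b)
    then have "val (Const (1/4) * ((a + b)\<^sup>2 + - ((a + - b)\<^sup>2))) (1/4 * ((r + s)\<^sup>2 + - ((r + - s)\<^sup>2)))"
      by (rule val_scale)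
    moreover have "(a + b)\<^sup>2 + - ((a + - b)\<^sup>2) = Const 4 * (a * b)"
      by (simp add: power2_eq_square algebra_simps)
    moreover have "Const (1/4) * (Const 4 * (a * b)) = a * b"
      unfolding mult.assoc[symmetric] by (simp flip: Const_mult Const_numeral)
    moreover have "1/4 * ((r + s)\<^sup>2 + - ((r + - s)\<^sup>2)) = r * s"
      by (simp add: power2_eq_square algebra_simps)
    ultimately show ?thesis by simp
  qed
  define x where "x i = (SOME r. val (Var i) r)" for i
  have x: "val (Var i) (x i)" for i unfolding x_def using ex by (rule someI_ex)
  have val_eval: "val p (eval_poly p x)" for p
  proof -
    have "p \<in> polys UNIV" by simp
    then show ?thesis
      by (induction p rule: rpoly_induct_on) (auto intro: val_Const x val_add val_mult)
  qed
  have "0 \<le> eval_poly q x" if q: "q \<in> Q" for q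
  proof (rule field_le_epsilon)
    fix e :: real assume "0 < e"
    then have "(Const (eval_poly q x + e) - q) + q \<in> Q"
      using val_eval[of q] q unfolding val_def by (intro qm_add[OF qm]) auto
    then show "0 \<le> eval_poly q x + e" using qm_Const_neg[OF qm proper] by simp
  qed
  then show ?thesis by blast
qed

lemma quad_module_extend:
  fixes Q :: "'v rpoly set" and b :: "'v rpoly"
  assumes qm: "quad_module Q"
  defines "Q' \<equiv> {q + s * b | q s. q \<in> Q \<and> s \<in> sos UNIV}"
  shows "quad_module Q'" "Q \<subseteq> Q'" "b \<in> Q'"
proof -
  show sub: "Q \<subseteq> Q'"
  proof
    fix q assume "q \<in> Q"
    then have "q + 0 * b \<in> Q'" unfolding Q'_def using sos_0 by blast
    then show "q \<in> Q'" by simp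
  qed
  have "0 + 1\<^sup>2 * b \<in> Q'"
    unfolding Q'_def using qm_0[OF qm] sos_square[of 1 UNIV, OF polys_1] by blast
  then show "b \<in> Q'" by simp
  show "quad_module Q'"
    unfolding quad_module_def
  proof (intro conjI ballI allI)
    show "1 \<in> Q'" using sub qm_1[OF qm] by blast
  next
    fix u v assume "u \<in> Q'" "v \<in> Q'"
    then obtain q s q' s' where "u = q + s * b" "v = q' + s' * b" "q \<in> Q" "q' \<in> Q"
      "s \<in> sos UNIV" "s' \<in> sos UNIV" unfolding Q'_def by blast
    then have "u + v = (q + q') + (s + s') * b" "q + q' \<in> Q" "s + s' \<in> sos UNIV"
      by (auto simp: algebra_simps intro: qm_add[OF qm] sos_add)
    then show "u + v \<in> Q'" unfolding Q'_def by blast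
  next
    fix u c assume "u \<in> Q'"
    then obtain q s where "u = q + s * b" "q \<in> Q" "s \<in> sos UNIV" unfolding Q'_def by blast
    then have "c\<^sup>2 * u = c\<^sup>2 * q + (c\<^sup>2 * s) * b" "c\<^sup>2 * q \<in> Q" "c\<^sup>2 * s \<in> sos UNIV"
      by (simp_all add: distrib_left mult.assoc qm_square_mult[OF qm] sos_mult_square)
    then show "c\<^sup>2 * u \<in> Q'" unfolding Q'_def by blast
  qed
qed

text \<open>
  If neither \<open>a\<close> nor \<open>-a\<close> belonged to \<open>Q\<close>, then \<open>-1 = q + s a = q' - s' a\<close> with \<open>q, q' \<in> Q\<close> and sums of
  squares \<open>s\<close>, \<open>s'\<close>, by maximality. Eliminating \<open>a\<close> gives \<open>-s \<in> Q\<close>. So \<open>s\<close> lies in the support of \<open>Q\<close>, and so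
  does \<open>s a\<close>; but then \<open>-1 = q + s a \<in> Q\<close>.
\<close>

lemma maximal_quad_module_total:
  fixes Q :: "'v rpoly set"
  assumes qm: "quad_module Q" and proper: "-1 \<notin> Q"
    and max: "\<And>Q'. quad_module Q' \<Longrightarrow> -1 \<notin> Q' \<Longrightarrow> Q \<subseteq> Q' \<Longrightarrow> Q' = Q"
  shows "a \<in> Q \<or> - a \<in> Q"
proof (rule ccontr)
  assume neg: "\<not> (a \<in> Q \<or> - a \<in> Q)"
  have key: "\<exists>q\<in>Q. \<exists>s\<in>sos UNIV. -1 = q + s * b" if b: "b \<notin> Q" for b
  proof (rule ccontr)
    assume no: "\<not> (\<exists>q\<in>Q. \<exists>s\<in>sos UNIV. -1 = q + s * b)"
    define Q' where "Q' = {q + s * b | q s. q \<in> Q \<and> s \<in> sos UNIV}"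
    have "-1 \<notin> Q'" using no unfolding Q'_def by blast
    then have "Q' = Q" using quad_module_extend[OF qm, of b] unfolding Q'_def by (intro max) auto
    then show False using b quad_module_extend(3)[OF qm, of b] unfolding Q'_def by simp
  qed
  obtain q s where qs: "q \<in> Q" "s \<in> sos UNIV" "-1 = q + s * a" using key[of a] neg by blast
  obtain q' s' where qs': "q' \<in> Q" "s' \<in> sos UNIV" "-1 = q' + s' * (- a)" using key[of "- a"] neg by blast
  have sQ: "s \<in> Q" by (rule qm_sos[OF qm qs(2)])
  have "- s = s' + s' * q + s * q'"
  proof -
    have "- s' + - s = s' * (-1) + s * (-1)" by simp
    also have "\<dots> = s' * (q + s * a) + s * (q' + s' * (- a))" using qs(3) qs'(3) by simp
    also have "\<dots> = s' * q + s * q'" by (simp add: algebra_simps)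
    finally have eq: "- s' + - s = s' * q + s * q'" .
    have "- s = s' + (- s' + - s)" by simp
    then show ?thesis unfolding eq by (simp add: add.assoc)
  qed
  moreover have "\<dots> \<in> Q"
    by (intro qm_add[OF qm] qm_sos[OF qm qs'(2)] qm_sos_mult[OF qm qs'(2) qs(1)]
        qm_sos_mult[OF qm qs(2) qs'(1)])
  ultimately have nsQ: "- s \<in> Q" by simp
  \<comment> \<open>The support \<open>Q \<inter> -Q\<close> is an ideal, because \<open>4 a = (a + 1)\<^sup>2 - (a - 1)\<^sup>2\<close>.\<close>
  have "Const 4 * (s * a) = (a + 1)\<^sup>2 * s + (a - 1)\<^sup>2 * (- s)"
    by (simp add: power2_eq_square algebra_simps)
  moreover have "\<dots> \<in> Q" by (intro qm_add[OF qm] qm_square_mult[OF qm] sQ nsQ)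
  ultimately have "s * a \<in> Q" using qm_scaleD[OF qm, of 4] by simp
  then have "q + s * a \<in> Q" by (intro qm_add[OF qm] qs)
  then show False using qs(3) proper by simp
qed

text \<open>
  If the theorem failed, \<open>Q - f \<cdot> \<Sigma>\<close> would extend to a maximal quadratic module without \<open>-1\<close>, hence
  to a point at which \<open>Q\<close> is nonnegative and \<open>f\<close> is not positive. Thus \<open>\<sigma> f - 1 \<in> Q\<close> for a sum of
  squares \<open>\<sigma>\<close>. An identity then lowers the constant \<open>r\<close> in \<open>f + r \<in> Q\<close> by a fixed amount, again
  and again until it disappears.
\<close>

theorem Putinar:
  fixes Q :: "'v rpoly set"
  assumes qm: "quad_module Q" and arch: "archimedean Q"
    and pos: "\<And>x. (\<And>q. q \<in> Q \<Longrightarrow> 0 \<le> eval_poly q x) \<Longrightarrow> 0 < eval_poly f x"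
  shows "f \<in> Q"
proof -
  define Q1 where "Q1 = {q + s * (- f) | q s. q \<in> Q \<and> s \<in> sos UNIV}"
  have Q1: "quad_module Q1" and QQ1: "Q \<subseteq> Q1" and fQ1: "- f \<in> Q1"
    unfolding Q1_def using quad_module_extend[OF qm, of "- f"] by blast+
  have "-1 \<in> Q1"
  proof (rule ccontr)
    assume "-1 \<notin> Q1"
    define \<A> where "\<A> = {Q'. quad_module Q' \<and> -1 \<notin> Q' \<and> Q1 \<subseteq> Q'}"
    have "\<exists>M\<in>\<A>. \<forall>X\<in>\<A>. M \<subseteq> X \<longrightarrow> X = M"
    proof (rule subset_Zorn_nonempty)
      show "\<A> \<noteq> {}" using Q1 \<open>-1 \<notin> Q1\<close> unfolding \<A>_def by blast
    next
      fix \<C> assume ne: "\<C> \<noteq> {}" and ch: "subset.chain \<A> \<C>"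
      have mem: "quad_module X" "-1 \<notin> X" "Q1 \<subseteq> X" if "X \<in> \<C>" for X
        using ch that unfolding subset_chain_def \<A>_def by blast+
      have "quad_module (\<Union>\<C>)"
        unfolding quad_module_def
      proof (intro conjI ballI allI)
        show "1 \<in> \<Union>\<C>" using ne qm_1[OF mem(1)] by blast
      next
        fix u v assume "u \<in> \<Union>\<C>" "v \<in> \<Union>\<C>"
        then obtain X Y where XY: "X \<in> \<C>" "Y \<in> \<C>" "u \<in> X" "v \<in> Y" by blast
        then have "X \<subseteq> Y \<or> Y \<subseteq> X" using ch unfolding subset_chain_def by blast
        then obtain Z where "Z \<in> \<C>" "u \<in> Z" "v \<in> Z" using XY by blast
        then show "u + v \<in> \<Union>\<C>" using qm_add[OF mem(1)] by blast
      next
        fix u c assume "u \<in> \<Union>\<C>"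
        then obtain X where "X \<in> \<C>" "u \<in> X" by blast
        then show "c\<^sup>2 * u \<in> \<Union>\<C>" using qm_square_mult[OF mem(1)] by blast
      qed
      then show "\<Union>\<C> \<in> \<A>" using ne mem unfolding \<A>_def by blast
    qed
    then obtain M where "M \<in> \<A>" and max: "\<forall>X\<in>\<A>. M \<subseteq> X \<longrightarrow> X = M" by blast
    then have M: "quad_module M" "-1 \<notin> M" "Q1 \<subseteq> M" unfolding \<A>_def by auto
    have "a \<in> M \<or> - a \<in> M" for a
    proof (rule maximal_quad_module_total[OF M(1,2)])
      fix X assume "quad_module X" "-1 \<notin> X" "M \<subseteq> X"
      then show "X = M" using M(3) max unfolding \<A>_def by blast
    qed
    moreover have "archimedean M" using arch QQ1 M(3) unfolding archimedean_def by blast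
    ultimately obtain x where x: "\<And>q. q \<in> M \<Longrightarrow> 0 \<le> eval_poly q x"
      using total_quad_module_point[OF M(1) _ M(2)] by blast
    then have "0 < eval_poly f x" using pos QQ1 M(3) by blast
    moreover have "0 \<le> eval_poly (- f) x" using x fQ1 M(3) by blast
    ultimately show False by simp
  qed
  then obtain q s where q: "q \<in> Q" and s: "s \<in> sos UNIV" and eq: "-1 = q + s * (- f)"
    unfolding Q1_def by blast
  have "s * f - 1 = s * f + (q + s * (- f))" unfolding eq[symmetric] by simp
  then have sf: "s * f - 1 \<in> Q" using q by simp
  obtain N1 where N1: "Const N1 - s \<in> Q" using arch unfolding archimedean_def by blast
  obtain N2 where N2: "Const N2 - (1 + s\<^sup>2 * f) \<in> Q" using arch unfolding archimedean_def by blast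
  define k where "k = max 1 (max N1 N2)"
  have k: "0 < k" by (simp add: k_def)
  have k1: "Const (2 * k) - s \<in> Q"
    by (rule qm_Const_mono[OF qm N1]) (auto simp: k_def)
  have k2: "Const (2 * k) - (1 + s\<^sup>2 * f) \<in> Q"
    by (rule qm_Const_mono[OF qm N2]) (auto simp: k_def)
  have step: "f + Const (r - 1 / k\<^sup>2) \<in> Q" if r: "0 \<le> r" and fr: "f + Const r \<in> Q" for r
  proof -
    \<comment> \<open>The choice of \<open>k\<close> puts \<open>2 k - s\<close> and the last term into \<open>Q\<close>.\<close>
    have "Const (k\<^sup>2) * (f + Const (r - 1 / k\<^sup>2))
        = (Const k - s)\<^sup>2 * (f + Const r) + Const (2 * k) * (s * f - 1)
          + Const r * (s * (Const (2 * k) - s)) + (Const (2 * k) - (1 + s\<^sup>2 * f))"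
    proof -
      have "Const (k\<^sup>2) * Const (1 / k\<^sup>2) = 1" using k by (simp flip: Const_mult)
      then have "Const (k\<^sup>2) * (f + Const (r - 1 / k\<^sup>2)) = Const (k\<^sup>2) * (f + Const r) - 1"
        by (simp add: Const_diff algebra_simps)
      then show ?thesis by (simp add: Const_mult Const_power power2_eq_square algebra_simps)
    qed
    moreover have "\<dots> \<in> Q"
      using k r by (intro qm_add[OF qm] qm_square_mult[OF qm] qm_scale[OF qm] qm_sos_mult[OF qm s] fr sf k1 k2) auto
    ultimately show ?thesis using qm_scaleD[OF qm, of "k\<^sup>2"] k by simp
  qed
  obtain r0 where "Const r0 - (- f) \<in> Q" using arch unfolding archimedean_def by blast
  then have r0: "f + Const (max 0 r0) \<in> Q"
    using qm_Const_mono[OF qm, of r0 "- f" "max 0 r0"] by (simp add: add.commute)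
  define d where "d = 1 / k\<^sup>2"
  have d: "0 < d" using k by (simp add: d_def)
  have iter: "f + Const (max 0 (max 0 r0 - real n * d)) \<in> Q" for n
  proof (induction n)
    case 0
    show ?case using r0 by simp
  next
    case (Suc n)
    let ?r = "max 0 (max 0 r0 - real n * d)" and ?r' = "max 0 (max 0 r0 - real (Suc n) * d)"
    have "real (Suc n) * d = real n * d + d" by (simp add: algebra_simps)
    then have "0 \<le> ?r' - (?r - d)" using d by linarith
    then have "(f + Const (?r - d)) + Const (?r' - (?r - d)) \<in> Q"
      unfolding d_def by (intro qm_add[OF qm] step Suc.IH[unfolded d_def] qm_Const[OF qm]) auto
    moreover have "(f + Const (?r - d)) + Const (?r' - (?r - d)) = f + Const ?r'"
      by (simp only: Const_diff) (simp only: algebra_simps add_diff_cancel diff_add_cancel)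
    ultimately show ?case by metis
  qed
  obtain n :: nat where "max 0 r0 / d \<le> real n" using real_arch_simple by blast
  then have "max 0 (max 0 r0 - real n * d) = 0" using d by (simp add: field_simps)
  then show ?thesis using iter[of n] by simp
qed

section \<open>Quadratic forms with polynomial entries\<close>

lemma qm_mult_square: "quad_module Q \<Longrightarrow> a \<in> Q \<Longrightarrow> a * b\<^sup>2 \<in> Q"
  by (subst mult.commute) (rule qm_square_mult)

lemma quadratic_insert:
  fixes f :: "'j \<Rightarrow> 'a::comm_ring_1"
  assumes "finite J" "k \<notin> J" "\<And>i j. i \<in> insert k J \<Longrightarrow> j \<in> insert k J \<Longrightarrow> G i j = G j i"
  shows "(\<Sum>i\<in>insert k J. \<Sum>j\<in>insert k J. f i * f j * G i j)
       = G k k * (f k)\<^sup>2 + 2 * f k * (\<Sum>j\<in>J. G k j * f j) + (\<Sum>i\<in>J. \<Sum>j\<in>J. f i * f j * G i j)"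
proof -
  have "(\<Sum>i\<in>J. f i * f k * G i k) = f k * (\<Sum>j\<in>J. G k j * f j)"
    unfolding sum_distrib_left using assms(3) by (intro sum.cong) (auto simp: algebra_simps)
  moreover have "(\<Sum>j\<in>J. f k * f j * G k j) = f k * (\<Sum>j\<in>J. G k j * f j)"
    unfolding sum_distrib_left by (intro sum.cong) (auto simp: algebra_simps)
  ultimately show ?thesis
    using assms(1,2) by (simp add: sum.distrib power2_eq_square algebra_simps)
qed

text \<open>
  With \<open>e = b - a l\<close> for the column \<open>b\<close> of the pivot \<open>a\<close>, this is the form obtained by substituting
  \<open>- \<Sum> l\<^sub>j f\<^sub>j\<close> for the pivot variable, less \<open>c \<Sum> f\<^sub>j\<^sup>2\<close>. For \<open>e = 0\<close> its matrix is the Schur complement.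
\<close>

lemma quadratic_schur:
  fixes f :: "'j \<Rightarrow> 'a::comm_ring_1"
  assumes "finite J"
  shows "(\<Sum>i\<in>J. \<Sum>j\<in>J. f i * f j *
            (G i j - a * l i * l j - l i * e j - l j * e i - (if i = j then c else 0)))
       = (\<Sum>i\<in>J. \<Sum>j\<in>J. f i * f j * G i j) - a * (\<Sum>j\<in>J. l j * f j)\<^sup>2
         - 2 * (\<Sum>j\<in>J. l j * f j) * (\<Sum>j\<in>J. e j * f j) - c * (\<Sum>j\<in>J. (f j)\<^sup>2)"
proof -
  let ?L = "\<Sum>j\<in>J. l j * f j" and ?E = "\<Sum>j\<in>J. e j * f j"
  have 1: "(\<Sum>i\<in>J. \<Sum>j\<in>J. a * ((l i * f i) * (l j * f j))) = a * ?L\<^sup>2"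
    unfolding power2_eq_square sum_product by (simp only: sum_distrib_left)
  have 2: "(\<Sum>i\<in>J. \<Sum>j\<in>J. (l i * f i) * (e j * f j)) = ?L * ?E"
    by (simp add: sum_product)
  have 3: "(\<Sum>i\<in>J. \<Sum>j\<in>J. (e i * f i) * (l j * f j)) = ?E * ?L"
    by (simp add: sum_product)
  have 4: "(\<Sum>i\<in>J. \<Sum>j\<in>J. f i * f j * (if i = j then c else 0)) = c * (\<Sum>j\<in>J. (f j)\<^sup>2)"
    using assms by (simp add: if_distrib[of "\<lambda>x. _ * x"] sum.delta sum_distrib_left
        power2_eq_square mult.commute cong: if_cong)
  have "(\<Sum>i\<in>J. \<Sum>j\<in>J. f i * f j *
            (G i j - a * l i * l j - l i * e j - l j * e i - (if i = j then c else 0)))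
      = (\<Sum>i\<in>J. \<Sum>j\<in>J. f i * f j * G i j - a * ((l i * f i) * (l j * f j))
          - (l i * f i) * (e j * f j) - (e i * f i) * (l j * f j)
          - f i * f j * (if i = j then c else 0))"
    by (intro sum.cong refl) (simp add: right_diff_distrib mult_ac)
  also have "\<dots> = (\<Sum>i\<in>J. \<Sum>j\<in>J. f i * f j * G i j) - a * ?L\<^sup>2 - ?L * ?E - ?E * ?L
      - c * (\<Sum>j\<in>J. (f j)\<^sup>2)"
    by (simp only: sum_subtractf 1 2 3 4)
  finally show ?thesis by (simp add: algebra_simps)
qed

text \<open>The set where \<open>\<phi> \<le> 0\<close> is compact, so \<open>\<psi>\<close> has a positive minimum on it.\<close>

lemma compact_penalty:
  fixes \<phi> \<psi> :: "'a::topological_space \<Rightarrow> real"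
  assumes C: "compact C" and cont: "continuous_on C \<phi>" "continuous_on C \<psi>"
    and nonneg: "\<And>c. c \<in> C \<Longrightarrow> 0 \<le> \<psi> c" and pos: "\<And>c. c \<in> C \<Longrightarrow> \<psi> c = 0 \<Longrightarrow> 0 < \<phi> c"
  shows "\<exists>t\<ge>0. \<exists>\<delta>>0. \<forall>c\<in>C. \<delta> \<le> \<phi> c + t * \<psi> c"
proof (cases "C = {}")
  case True
  then show ?thesis by (auto intro!: exI[of _ 0] exI[of _ 1])
next
  case False
  define C0 where "C0 = C \<inter> \<phi> -` {..0}"
  have C0: "compact C0"
    unfolding C0_def
    by (rule closedin_compact[OF C continuous_closedin_preimage[OF cont(1) closed_atMost]])
  have "\<exists>t\<ge>0. \<forall>c\<in>C. 0 < \<phi> c + t * \<psi> c"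
  proof (cases "C0 = {}")
    case True
    then show ?thesis unfolding C0_def by (intro exI[of _ 0]) force
  next
    case ne: False
    have sub: "C0 \<subseteq> C" unfolding C0_def by blast
    obtain c0 where c0: "c0 \<in> C0" "\<forall>c\<in>C0. \<psi> c0 \<le> \<psi> c"
      using continuous_attains_inf[OF C0 ne continuous_on_subset[OF cont(2) sub]] by blast
    obtain c1 where c1: "c1 \<in> C0" "\<forall>c\<in>C0. \<phi> c1 \<le> \<phi> c"
      using continuous_attains_inf[OF C0 ne continuous_on_subset[OF cont(1) sub]] by blast
    have m: "0 < \<psi> c0"
      using c0(1) nonneg[of c0] pos[of c0] unfolding C0_def by force
    have p1: "\<phi> c1 \<le> 0" using c1(1) unfolding C0_def by auto
    define t where "t = (1 - \<phi> c1) / \<psi> c0"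
    have t: "0 \<le> t" using m p1 by (simp add: t_def)
    have "0 < \<phi> c + t * \<psi> c" if c: "c \<in> C" for c
    proof (cases "c \<in> C0")
      case True
      have "t * \<psi> c0 \<le> t * \<psi> c" using c0(2) True t by (intro mult_left_mono) auto
      moreover have "t * \<psi> c0 = 1 - \<phi> c1" using m by (simp add: t_def)
      ultimately show ?thesis using c1(2) True by force
    next
      case False
      then have "0 < \<phi> c" using c unfolding C0_def by auto
      moreover have "0 \<le> t * \<psi> c" using t nonneg[OF c] by simp
      ultimately show ?thesis by linarith
    qed
    then show ?thesis using t by blast
  qed
  then obtain t where t: "0 \<le> t" "\<forall>c\<in>C. 0 < \<phi> c + t * \<psi> c" by blast
  have "continuous_on C (\<lambda>c. \<phi> c + t * \<psi> c)" by (intro continuous_intros cont)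
  then obtain c where "c \<in> C" "\<forall>d\<in>C. \<phi> c + t * \<psi> c \<le> \<phi> d + t * \<psi> d"
    using continuous_attains_inf[OF C False] by blast
  then show ?thesis using t by (intro exI[of _ t] conjI exI[of _ "\<phi> c + t * \<psi> c"]) auto
qed

definition unit_sphere :: "'j set \<Rightarrow> ('j \<Rightarrow> real) set" where
  "unit_sphere J = {v. (\<Sum>i\<in>J. (v i)\<^sup>2) = 1 \<and> (\<forall>i. i \<notin> J \<longrightarrow> v i = 0)}"

lemma compact_coordinate_box:
  "compact {v :: 'j \<Rightarrow> real. (\<forall>i\<in>J. -1 \<le> v i \<and> v i \<le> 1) \<and> (\<forall>i. i \<notin> J \<longrightarrow> v i = 0)}"
proof -
  have "compactin (product_topology (\<lambda>i. euclidean) UNIV)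
      (PiE UNIV (\<lambda>i. if i \<in> J then {-1..1::real} else {0}))"
    by (subst compactin_PiE) auto
  moreover have "PiE UNIV (\<lambda>i. if i \<in> J then {-1..1::real} else {0})
      = {v. (\<forall>i\<in>J. -1 \<le> v i \<and> v i \<le> 1) \<and> (\<forall>i. i \<notin> J \<longrightarrow> v i = 0)}"
    by (auto simp: PiE_def Pi_def split: if_splits)
  ultimately show ?thesis by (simp add: euclidean_product_topology)
qed

lemma compact_unit_sphere:
  assumes "finite J"
  shows "compact (unit_sphere J)"
proof -
  let ?B = "{v :: 'a \<Rightarrow> real. (\<forall>i\<in>J. -1 \<le> v i \<and> v i \<le> 1) \<and> (\<forall>i. i \<notin> J \<longrightarrow> v i = 0)}"
  have "continuous_on ?B (\<lambda>v. \<Sum>i\<in>J. (v i)\<^sup>2)"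
    by (intro continuous_intros continuous_on_product_then_coordinatewise)
  then have "closedin (top_of_set ?B) (?B \<inter> (\<lambda>v. \<Sum>i\<in>J. (v i)\<^sup>2) -` {1})"
    by (intro continuous_closedin_preimage closed_singleton)
  then have "compact (?B \<inter> (\<lambda>v. \<Sum>i\<in>J. (v i)\<^sup>2) -` {1})"
    by (rule closedin_compact[OF compact_coordinate_box])
  moreover have "?B \<inter> (\<lambda>v. \<Sum>i\<in>J. (v i)\<^sup>2) -` {1} = unit_sphere J"
  proof -
    have "-1 \<le> v i \<and> v i \<le> 1" if "(\<Sum>i\<in>J. (v i)\<^sup>2) = 1" "i \<in> J" for v :: "'a \<Rightarrow> real" and i
    proof -
      have "(v i)\<^sup>2 \<le> (\<Sum>i\<in>J. (v i)\<^sup>2)" by (rule member_le_sum) (use that assms in auto)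
      then have "(v i)\<^sup>2 \<le> 1" using that by simp
      then show ?thesis by (simp add: abs_square_le_1 abs_le_iff)
    qed
    then show ?thesis unfolding unit_sphere_def by auto
  qed
  ultimately show ?thesis by simp
qed

lemma unit_sphere_normalise:
  assumes "finite J" "\<exists>i\<in>J. v i \<noteq> 0"
  obtains u where "u \<in> unit_sphere J"
    and "\<And>i. i \<in> J \<Longrightarrow> v i = sqrt (\<Sum>j\<in>J. (v j)\<^sup>2) * u i"
proof
  let ?N = "\<Sum>j\<in>J. (v j)\<^sup>2"
  obtain k where "k \<in> J" "v k \<noteq> 0" using assms(2) by blast
  then have N: "0 < ?N" using assms(1) by (intro sum_pos2[of J k]) auto
  define u where "u i = (if i \<in> J then v i / sqrt ?N else 0)" for i
  show "v i = sqrt ?N * u i" if "i \<in> J" for i using N that by (simp add: u_def)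
  have "(\<Sum>i\<in>J. (u i)\<^sup>2) = (\<Sum>i\<in>J. (v i)\<^sup>2 / ?N)"
    using N by (intro sum.cong) (auto simp: u_def power_divide)
  also have "\<dots> = 1" using N by (simp flip: sum_divide_distrib)
  finally show "u \<in> unit_sphere J" by (simp add: unit_sphere_def u_def)
qed

lemma quadratic_normalise:
  fixes g :: "'j \<Rightarrow> 'j \<Rightarrow> real"
  assumes "\<And>i. i \<in> J \<Longrightarrow> v i = sqrt (\<Sum>j\<in>J. (v j)\<^sup>2) * u i"
  shows "(\<Sum>i\<in>J. \<Sum>j\<in>J. v i * v j * g i j)
       = (\<Sum>j\<in>J. (v j)\<^sup>2) * (\<Sum>i\<in>J. \<Sum>j\<in>J. u i * u j * g i j)"
proof -
  define c where "c = sqrt (\<Sum>j\<in>J. (v j)\<^sup>2)"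
  have c: "c * c = (\<Sum>j\<in>J. (v j)\<^sup>2)" by (simp add: c_def sum_nonneg)
  have "(\<Sum>i\<in>J. \<Sum>j\<in>J. v i * v j * g i j) = (\<Sum>i\<in>J. \<Sum>j\<in>J. (c * c) * (u i * u j * g i j))"
    using assms by (intro sum.cong refl) (simp add: c_def[symmetric])
  then show ?thesis unfolding c by (simp add: sum_distrib_left)
qed

context
  fixes M :: "'v rpoly set" and K :: "('v \<Rightarrow> real) set"
  assumes qm: "quad_module M" and K: "compact K"
    and nonneg: "\<And>p x. p \<in> M \<Longrightarrow> x \<in> K \<Longrightarrow> 0 \<le> eval_poly p x"
    and pos: "\<And>p. (\<And>x. x \<in> K \<Longrightarrow> 0 < eval_poly p x) \<Longrightarrow> p \<in> M"
begin

lemma eval_poly_bounded: "\<exists>c>0. \<forall>x\<in>K. \<bar>eval_poly p x\<bar> < c"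
proof -
  have "compact ((\<lambda>x. eval_poly p x) ` K)"
    by (intro compact_continuous_image continuous_on_eval_poly K)
  then have "bounded ((\<lambda>x. eval_poly p x) ` K)" by (rule compact_imp_bounded)
  then obtain a where "0 < a" "\<forall>y\<in>(\<lambda>x. eval_poly p x) ` K. norm y < a"
    unfolding bounded_pos_less by blast
  then show ?thesis by (intro exI[of _ a]) auto
qed

text \<open>
  The pivot \<open>a\<close> is positive on \<open>K\<close>, and a partial sum of a geometric series inverts it up to a small
  error, so one square can be completed with polynomial coefficients. The small mixed terms
  \<open>2 \<epsilon> u f\<close> that are left become squares with multipliers \<open>(\<eta> \<plusminus> \<epsilon>) / 2 > 0\<close>. The remaining
  form is the restriction of the old one to a hyperplane, so it is again bounded below.
\<close>

lemma uniformly_definite_form_in_module: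
  fixes f :: "'j \<Rightarrow> 'v rpoly"
  assumes "finite J" "0 < \<delta>"
    and "\<And>i j. i \<in> J \<Longrightarrow> j \<in> J \<Longrightarrow> G i j = G j i"
    and "\<And>x v. x \<in> K \<Longrightarrow> \<delta> * (\<Sum>i\<in>J. (v i)\<^sup>2) \<le> (\<Sum>i\<in>J. \<Sum>j\<in>J. v i * v j * eval_poly (G i j) x)"
  shows "(\<Sum>i\<in>J. \<Sum>j\<in>J. f i * f j * G i j) \<in> M"
  using assms
proof (induction J arbitrary: G \<delta> f rule: finite_induct)
  case empty
  then show ?case by (simp add: qm_0[OF qm])
next
  case (insert k J)
  let ?a = "G k k" and ?b = "\<lambda>j. G k j"
  have sym: "G i j = G j i" if "i \<in> insert k J" "j \<in> insert k J" for i j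
    using insert.prems(2) that by blast
  have a_lower: "\<delta> \<le> eval_poly ?a x" if "x \<in> K" for x
  proof -
    define e where "e = (\<lambda>i. if i = k then 1 else 0 :: real)"
    have e: "e k = 1" "\<And>j. j \<in> J \<Longrightarrow> e j = 0" using insert.hyps by (auto simp: e_def)
    have "(\<Sum>i\<in>insert k J. (e i)\<^sup>2) = 1" using insert.hyps e by simp
    moreover have "(\<Sum>i\<in>insert k J. \<Sum>j\<in>insert k J. e i * e j * eval_poly (G i j) x) = eval_poly ?a x"
      using insert.hyps e by simp
    ultimately show ?thesis using insert.prems(3)[OF that, of e] by simp
  qed
  obtain c where c: "0 < c" "\<forall>x\<in>K. \<bar>eval_poly ?a x\<bar> < c" using eval_poly_bounded by blast
  define \<eta> where "\<eta> = \<delta> / (real (card J) + 2)"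
  have \<eta>: "0 < \<eta>" "\<eta> < \<delta>" "real (card J) * \<eta> < \<delta>"
    using insert.prems(1) by (auto simp: \<eta>_def field_simps add_strict_increasing)
  define \<tau> where "\<tau> = 1 - Const (1 / c) * ?a"
  have \<tau>: "0 \<le> eval_poly \<tau> x \<and> eval_poly \<tau> x \<le> max 0 (1 - \<delta> / c)" if "x \<in> K" for x
  proof -
    have "eval_poly \<tau> x = 1 - eval_poly ?a x / c" by (simp add: \<tau>_def)
    moreover have "eval_poly ?a x / c < 1" using c that by (auto simp: field_simps)
    moreover have "\<delta> / c \<le> eval_poly ?a x / c" using a_lower[OF that] c by (simp add: divide_right_mono)
    ultimately show ?thesis by linarith
  qed
  have "\<exists>B>0. \<forall>x\<in>K. \<bar>eval_poly (?b j) x\<bar> < B" for j by (rule eval_poly_bounded)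
  then obtain B where B: "\<And>j. 0 < B j" "\<And>j x. x \<in> K \<Longrightarrow> \<bar>eval_poly (?b j) x\<bar> < B j" by metis
  define B0 where "B0 = 1 + (\<Sum>j\<in>J. B j)"
  have B0: "0 < B0" "\<And>j. j \<in> J \<Longrightarrow> B j \<le> B0"
  proof -
    show "0 < B0" unfolding B0_def using B(1) by (intro add_pos_nonneg sum_nonneg) (auto intro: less_imp_le)
    fix j assume "j \<in> J"
    then have "B j \<le> (\<Sum>j\<in>J. B j)"
      using insert.hyps(1) B(1) by (intro member_le_sum) (auto intro: less_imp_le)
    then show "B j \<le> B0" by (simp add: B0_def)
  qed
  have "max 0 (1 - \<delta> / c) < 1" using insert.prems(1) c(1) by simp
  then obtain m where m: "max 0 (1 - \<delta> / c) ^ m < \<eta> / B0"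
    using real_arch_pow_inv[of "\<eta> / B0" "max 0 (1 - \<delta> / c)"] \<eta>(1) B0(1) by auto
  define r where "r = Const (1 / c) * (\<Sum>l<m. \<tau> ^ l)"
  have ar: "?a * r = 1 - \<tau> ^ m"
    unfolding one_diff_power_eq r_def by (simp add: \<tau>_def mult_ac)
  define l where "l j = ?b j * r" for j
  define \<epsilon> where "\<epsilon> j = ?b j * \<tau> ^ m" for j
  have b_split: "?b j = ?a * l j + \<epsilon> j" for j
  proof -
    have "?a * l j = ?b j * (?a * r)" by (simp add: l_def mult_ac)
    then show ?thesis unfolding ar by (simp add: \<epsilon>_def algebra_simps)
  qed
  have \<epsilon>_small: "\<bar>eval_poly (\<epsilon> j) x\<bar> < \<eta>" if "j \<in> J" "x \<in> K" for j x
  proof -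
    have "eval_poly \<tau> x ^ m \<le> max 0 (1 - \<delta> / c) ^ m" using \<tau>[OF that(2)] by (intro power_mono) auto
    then have "\<bar>eval_poly (\<epsilon> j) x\<bar> \<le> B0 * max 0 (1 - \<delta> / c) ^ m"
      unfolding \<epsilon>_def using \<tau>[OF that(2)] B(2)[OF that(2), of j] B0(2)[OF that(1)]
      by (simp add: abs_mult) (intro mult_mono, auto)
    also have "\<dots> < \<eta>" using m B0(1) by (simp add: field_simps)
    finally show ?thesis .
  qed
  define L where "L = (\<Sum>j\<in>J. l j * f j)"
  define u where "u = f k + L"
  define G' where "G' i j = G i j - ?a * l i * l j - l i * \<epsilon> j - l j * \<epsilon> i
      - (if i = j then Const \<eta> else 0)" for i j
  define h where "h = (Const (1/2) :: 'v rpoly)"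
  have h: "h * 2 = 1" unfolding h_def by (simp flip: Const_numeral Const_mult)
  have h_pos: "eval_poly h x = 1/2" for x by (simp add: h_def)
  have pair: "h * (Const \<eta> + e) * (u + g)\<^sup>2 + h * (Const \<eta> - e) * (u - g)\<^sup>2
      = Const \<eta> * u\<^sup>2 + Const \<eta> * g\<^sup>2 + 2 * u * (e * g)" for e g
  proof -
    have "h * (Const \<eta> + e) * (u + g)\<^sup>2 + h * (Const \<eta> - e) * (u - g)\<^sup>2
        = (h * 2) * (Const \<eta> * u\<^sup>2 + Const \<eta> * g\<^sup>2 + 2 * u * (e * g))"
      by (simp add: power2_eq_square algebra_simps)
    then show ?thesis unfolding h by simp
  qed
  have "(\<Sum>i\<in>insert k J. \<Sum>j\<in>insert k J. f i * f j * G i j)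
      = ?a * (f k)\<^sup>2 + 2 * f k * (\<Sum>j\<in>J. ?b j * f j) + (\<Sum>i\<in>J. \<Sum>j\<in>J. f i * f j * G i j)"
    by (rule quadratic_insert) (use insert.hyps sym in auto)
  also have "(\<Sum>j\<in>J. ?b j * f j) = ?a * L + (\<Sum>j\<in>J. \<epsilon> j * f j)"
    by (subst b_split) (simp add: L_def sum_distrib_left distrib_right sum.distrib mult.assoc)
  also have "?a * (f k)\<^sup>2 + 2 * f k * (?a * L + (\<Sum>j\<in>J. \<epsilon> j * f j)) + (\<Sum>i\<in>J. \<Sum>j\<in>J. f i * f j * G i j)
      = (?a - Const (real (card J) * \<eta>)) * u\<^sup>2
        + (\<Sum>j\<in>J. h * (Const \<eta> + \<epsilon> j) * (u + f j)\<^sup>2 + h * (Const \<eta> - \<epsilon> j) * (u - f j)\<^sup>2)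
        + (\<Sum>i\<in>J. \<Sum>j\<in>J. f i * f j * G' i j)"
  proof -
    have "(\<Sum>j\<in>J. h * (Const \<eta> + \<epsilon> j) * (u + f j)\<^sup>2 + h * (Const \<eta> - \<epsilon> j) * (u - f j)\<^sup>2)
        = of_nat (card J) * (Const \<eta> * u\<^sup>2) + Const \<eta> * (\<Sum>j\<in>J. (f j)\<^sup>2) + 2 * u * (\<Sum>j\<in>J. \<epsilon> j * f j)"
      unfolding pair by (simp add: sum.distrib sum_distrib_left)
    moreover have "(\<Sum>i\<in>J. \<Sum>j\<in>J. f i * f j * G' i j)
        = (\<Sum>i\<in>J. \<Sum>j\<in>J. f i * f j * G i j) - ?a * L\<^sup>2 - 2 * L * (\<Sum>j\<in>J. \<epsilon> j * f j)
          - Const \<eta> * (\<Sum>j\<in>J. (f j)\<^sup>2)"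
      unfolding G'_def L_def by (rule quadratic_schur[OF insert.hyps(1)])
    moreover have "Const (real (card J)) = (of_nat (card J) :: 'v rpoly)"
      unfolding Const_def by (rule single_of_nat)
    ultimately show ?thesis
      unfolding u_def by (simp add: Const_mult power2_eq_square algebra_simps)
  qed
  also have "\<dots> \<in> M"
  proof (rule qm_add[OF qm, OF qm_add[OF qm, OF _ qm_sum[OF qm, OF qm_add[OF qm]]]])
    have "?a - Const (real (card J) * \<eta>) \<in> M"
      using a_lower \<eta>(3) by (intro pos) force
    then show "(?a - Const (real (card J) * \<eta>)) * u\<^sup>2 \<in> M"
      by (rule qm_mult_square[OF qm])
  next
    fix j assume j: "j \<in> J"
    have "h * (Const \<eta> + \<epsilon> j) \<in> M" "h * (Const \<eta> - \<epsilon> j) \<in> M"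
      using \<epsilon>_small[OF j] by (auto intro!: pos simp: h_pos abs_less_iff) (smt (verit))+
    then show "h * (Const \<eta> + \<epsilon> j) * (u + f j)\<^sup>2 \<in> M" "h * (Const \<eta> - \<epsilon> j) * (u - f j)\<^sup>2 \<in> M"
      by (auto intro: qm_mult_square[OF qm])
  next
    show "(\<Sum>i\<in>J. \<Sum>j\<in>J. f i * f j * G' i j) \<in> M"
    proof (rule insert.IH[of "\<delta> - \<eta>"])
      show "0 < \<delta> - \<eta>" using \<eta> by simp
      show "G' i j = G' j i" if "i \<in> J" "j \<in> J" for i j
        using sym[of i j] that by (simp add: G'_def algebra_simps)
      show "(\<delta> - \<eta>) * (\<Sum>i\<in>J. (v i)\<^sup>2) \<le> (\<Sum>i\<in>J. \<Sum>j\<in>J. v i * v j * eval_poly (G' i j) x)"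
        if x: "x \<in> K" for x v
      proof -
        let ?e = "\<lambda>p. eval_poly p x"
        define Lv where "Lv = (\<Sum>j\<in>J. ?e (l j) * v j)"
        define Ev where "Ev = (\<Sum>j\<in>J. ?e (\<epsilon> j) * v j)"
        define w where "w = v(k := - Lv)"
        have wJ: "w j = v j" if "j \<in> J" for j using that insert.hyps(2) by (auto simp: w_def)
        have "(\<Sum>i\<in>insert k J. \<Sum>j\<in>insert k J. w i * w j * ?e (G i j))
            = ?e ?a * (w k)\<^sup>2 + 2 * w k * (\<Sum>j\<in>J. ?e (?b j) * w j) + (\<Sum>i\<in>J. \<Sum>j\<in>J. w i * w j * ?e (G i j))"
          by (rule quadratic_insert) (use insert.hyps sym in auto)
        also have "(\<Sum>j\<in>J. ?e (?b j) * w j) = (\<Sum>j\<in>J. (?e ?a * ?e (l j) + ?e (\<epsilon> j)) * v j)"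
        proof (intro sum.cong refl)
          fix j assume "j \<in> J"
          moreover have "?e (?b j) = ?e ?a * ?e (l j) + ?e (\<epsilon> j)" by (subst b_split) simp
          ultimately show "?e (?b j) * w j = (?e ?a * ?e (l j) + ?e (\<epsilon> j)) * v j" by (simp add: wJ)
        qed
        also have "\<dots> = ?e ?a * Lv + Ev"
          by (simp add: Lv_def Ev_def distrib_right sum.distrib sum_distrib_left mult.assoc)
        also have "(\<Sum>i\<in>J. \<Sum>j\<in>J. w i * w j * ?e (G i j)) = (\<Sum>i\<in>J. \<Sum>j\<in>J. v i * v j * ?e (G i j))"
          by (intro sum.cong refl) (simp add: wJ)
        finally have form: "(\<Sum>i\<in>insert k J. \<Sum>j\<in>insert k J. w i * w j * ?e (G i j))
            = - ?e ?a * Lv\<^sup>2 - 2 * Lv * Ev + (\<Sum>i\<in>J. \<Sum>j\<in>J. v i * v j * ?e (G i j))"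
          by (simp add: w_def power2_eq_square algebra_simps)
        have "(\<Sum>i\<in>insert k J. (w i)\<^sup>2) = Lv\<^sup>2 + (\<Sum>i\<in>J. (v i)\<^sup>2)"
          using insert.hyps wJ by (simp add: w_def)
        then have "\<delta> * (\<Sum>i\<in>J. (v i)\<^sup>2) \<le> \<delta> * (\<Sum>i\<in>insert k J. (w i)\<^sup>2)"
          using insert.prems(1) by (intro mult_left_mono) auto
        also have "\<dots> \<le> (\<Sum>i\<in>insert k J. \<Sum>j\<in>insert k J. w i * w j * ?e (G i j))"
          by (rule insert.prems(3)[OF x])
        finally have lower: "\<delta> * (\<Sum>i\<in>J. (v i)\<^sup>2)
            \<le> - ?e ?a * Lv\<^sup>2 - 2 * Lv * Ev + (\<Sum>i\<in>J. \<Sum>j\<in>J. v i * v j * ?e (G i j))"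
          unfolding form .
        have "?e (G' i j) = ?e (G i j) - ?e ?a * ?e (l i) * ?e (l j) - ?e (l i) * ?e (\<epsilon> j)
            - ?e (l j) * ?e (\<epsilon> i) - (if i = j then \<eta> else 0)" for i j
          by (simp add: G'_def)
        then have "(\<Sum>i\<in>J. \<Sum>j\<in>J. v i * v j * ?e (G' i j))
            = (\<Sum>i\<in>J. \<Sum>j\<in>J. v i * v j * ?e (G i j)) - ?e ?a * Lv\<^sup>2 - 2 * Lv * Ev - \<eta> * (\<Sum>j\<in>J. (v j)\<^sup>2)"
          unfolding Lv_def Ev_def by (simp only: quadratic_schur[OF insert.hyps(1)])
        then show ?thesis using lower by (simp add: left_diff_distrib)
      qed
    qed
  qed
  finally show ?case .
qed

text \<open>
  Adding \<open>t (w I - f f\<^sup>T)\<close> with \<open>w = |f|\<^sup>2\<close> to the matrix does not change the value of the form at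
  \<open>f\<close> itself. If this value is positive at a point, a large \<open>t\<close> makes the matrix positive definite there
  (Finsler's lemma). At the zeros of \<open>f\<close> the matrix has to be definite on its own.
\<close>

lemma positive_form_in_module:
  fixes f :: "'j \<Rightarrow> 'v rpoly"
  assumes J: "finite J" and sym: "\<And>i j. i \<in> J \<Longrightarrow> j \<in> J \<Longrightarrow> G i j = G j i"
    and off: "\<And>x. x \<in> K \<Longrightarrow> \<exists>i\<in>J. eval_poly (f i) x \<noteq> 0 \<Longrightarrow>
      0 < eval_poly (\<Sum>i\<in>J. \<Sum>j\<in>J. f i * f j * G i j) x"
    and on: "\<And>x v. x \<in> K \<Longrightarrow> \<forall>i\<in>J. eval_poly (f i) x = 0 \<Longrightarrow> \<exists>i\<in>J. v i \<noteq> 0 \<Longrightarrow>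
      0 < (\<Sum>i\<in>J. \<Sum>j\<in>J. v i * v j * eval_poly (G i j) x)"
  shows "(\<Sum>i\<in>J. \<Sum>j\<in>J. f i * f j * G i j) \<in> M"
proof -
  let ?S = "unit_sphere J"
  define \<phi> where "\<phi> = (\<lambda>(x, v). \<Sum>i\<in>J. \<Sum>j\<in>J. v i * v j * eval_poly (G i j) x)"
  define \<psi> where "\<psi> = (\<lambda>(x, v). (\<Sum>i\<in>J. (eval_poly (f i) x)\<^sup>2) * (\<Sum>i\<in>J. (v i)\<^sup>2)
      - (\<Sum>i\<in>J. eval_poly (f i) x * v i)\<^sup>2)"
  have proj: "continuous_on C (\<lambda>z. snd z i)" for C :: "(('v \<Rightarrow> real) \<times> ('j \<Rightarrow> real)) set" and i
    by (rule continuous_on_product_then_coordinatewise) (intro continuous_intros)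
  have ev: "continuous_on C (\<lambda>z. eval_poly p (fst z))" for C :: "(('v \<Rightarrow> real) \<times> ('j \<Rightarrow> real)) set" and p
    by (rule continuous_on_compose2[OF continuous_on_eval_poly]) (auto intro: continuous_intros)
  have cont: "continuous_on (K \<times> ?S) \<phi>" "continuous_on (K \<times> ?S) \<psi>"
    unfolding \<phi>_def \<psi>_def case_prod_unfold by (intro continuous_intros proj ev)+
  have "\<exists>t\<ge>0. \<exists>\<delta>>0. \<forall>c\<in>K \<times> ?S. \<delta> \<le> \<phi> c + t * \<psi> c"
  proof (rule compact_penalty)
    show "compact (K \<times> ?S)" by (intro compact_Times K compact_unit_sphere J)
    show "0 \<le> \<psi> c" if "c \<in> K \<times> ?S" for c
      unfolding \<psi>_def by (auto simp: case_prod_unfold intro!: Cauchy_Schwarz_ineq_sum)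
    show "0 < \<phi> c" if c: "c \<in> K \<times> ?S" and 0: "\<psi> c = 0" for c
    proof -
      obtain x v where xv: "c = (x, v)" "x \<in> K" "v \<in> ?S" using c by blast
      let ?g = "\<lambda>i. eval_poly (f i) x"
      have v1: "(\<Sum>i\<in>J. (v i)\<^sup>2) = 1" using xv unfolding unit_sphere_def by blast
      then have vne: "\<exists>i\<in>J. v i \<noteq> 0" by (metis (no_types, lifting) sum.neutral zero_eq_power2 zero_neq_one)
      show ?thesis
      proof (cases "\<forall>i\<in>J. ?g i = 0")
        case True
        then show ?thesis using on[OF xv(2) True vne] xv by (simp add: \<phi>_def)
      next
        case False
        define s where "s = (\<Sum>i\<in>J. ?g i * v i)"
        have ss: "(\<Sum>i\<in>J. (?g i)\<^sup>2) = s\<^sup>2"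
          using 0 v1 xv by (simp add: \<psi>_def s_def)
        \<comment> \<open>Equality in the Cauchy-Schwarz inequality makes \<open>f(x)\<close> a multiple of \<open>v\<close>.\<close>
        have "(\<Sum>i\<in>J. (?g i - s * v i)\<^sup>2) = (\<Sum>i\<in>J. (?g i)\<^sup>2) - 2 * s * s + s\<^sup>2 * (\<Sum>i\<in>J. (v i)\<^sup>2)"
          unfolding s_def[symmetric]
          by (subst (3) s_def) (simp add: power2_diff sum.distrib sum_subtractf sum_distrib_left
              power_mult_distrib algebra_simps)
        then have "(\<Sum>i\<in>J. (?g i - s * v i)\<^sup>2) = 0" using ss v1 by (simp add: power2_eq_square)
        then have gv: "?g i = s * v i" if "i \<in> J" for i
          using that J by (simp add: sum_nonneg_eq_0_iff)
        then have s0: "s \<noteq> 0" using False by auto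
        have "0 < eval_poly (\<Sum>i\<in>J. \<Sum>j\<in>J. f i * f j * G i j) x" using off[OF xv(2)] False by blast
        also have "\<dots> = (\<Sum>i\<in>J. \<Sum>j\<in>J. s\<^sup>2 * (v i * v j * eval_poly (G i j) x))"
          by (simp, intro sum.cong refl) (simp add: gv power2_eq_square)
        also have "\<dots> = s\<^sup>2 * \<phi> c" using xv by (simp add: \<phi>_def sum_distrib_left)
        finally show ?thesis using s0 by (simp add: zero_less_mult_iff)
      qed
    qed
  qed (fact cont)+
  then obtain t \<delta> where t: "0 \<le> t" "0 < \<delta>" "\<And>x v. x \<in> K \<Longrightarrow> v \<in> ?S \<Longrightarrow> \<delta> \<le> \<phi> (x, v) + t * \<psi> (x, v)"
    by blast
  define w where "w = (\<Sum>i\<in>J. (f i)\<^sup>2)"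
  define G' where "G' i j = G i j + Const t * ((if i = j then w else 0) - f i * f j)" for i j
  have expand: "(\<Sum>i\<in>J. \<Sum>j\<in>J. v i * v j * (g i j + s * ((if i = j then y else 0) - p i * p j)))
      = (\<Sum>i\<in>J. \<Sum>j\<in>J. v i * v j * g i j) + s * (y * (\<Sum>i\<in>J. (v i)\<^sup>2) - (\<Sum>i\<in>J. p i * v i)\<^sup>2)"
    for v p :: "'j \<Rightarrow> 'c::comm_ring_1" and g s y
  proof -
    have 1: "(\<Sum>i\<in>J. \<Sum>j\<in>J. v i * v j * (if i = j then y else 0)) = y * (\<Sum>i\<in>J. (v i)\<^sup>2)"
      using J by (simp add: if_distrib[of "\<lambda>x. _ * x"] sum.delta sum_distrib_left
          power2_eq_square mult.commute cong: if_cong)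
    have "(\<Sum>i\<in>J. \<Sum>j\<in>J. v i * v j * (g i j + s * ((if i = j then y else 0) - p i * p j)))
        = (\<Sum>i\<in>J. \<Sum>j\<in>J. v i * v j * g i j + s * (v i * v j * (if i = j then y else 0))
            - s * ((p i * v i) * (p j * v j)))"
      by (intro sum.cong refl) (simp add: algebra_simps)
    also have "\<dots> = (\<Sum>i\<in>J. \<Sum>j\<in>J. v i * v j * g i j) + s * (y * (\<Sum>i\<in>J. (v i)\<^sup>2))
        - s * (\<Sum>i\<in>J. p i * v i)\<^sup>2"
      by (simp only: sum_subtractf sum.distrib sum_distrib_left[symmetric] 1)
        (simp only: power2_eq_square sum_distrib_right)
    finally show ?thesis by (simp add: right_diff_distrib)
  qed
  have "(\<Sum>i\<in>J. \<Sum>j\<in>J. f i * f j * G' i j) \<in> M"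
  proof (rule uniformly_definite_form_in_module[OF J t(2)])
    show "G' i j = G' j i" if "i \<in> J" "j \<in> J" for i j
      using sym[OF that] by (simp add: G'_def mult.commute)
    show "\<delta> * (\<Sum>i\<in>J. (v i)\<^sup>2) \<le> (\<Sum>i\<in>J. \<Sum>j\<in>J. v i * v j * eval_poly (G' i j) x)"
      if x: "x \<in> K" for x v
    proof (cases "\<exists>i\<in>J. v i \<noteq> 0")
      case False
      then have "(\<Sum>i\<in>J. (v i)\<^sup>2) = 0" "(\<Sum>i\<in>J. \<Sum>j\<in>J. v i * v j * eval_poly (G' i j) x) = 0"
        by simp_all
      then show ?thesis by simp
    next
      case True
      obtain u where u: "u \<in> ?S" "\<And>i. i \<in> J \<Longrightarrow> v i = sqrt (\<Sum>j\<in>J. (v j)\<^sup>2) * u i"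
        using unit_sphere_normalise[OF J True] by blast
      have u1: "(\<Sum>i\<in>J. (u i)\<^sup>2) = 1" using u(1) unfolding unit_sphere_def by blast
      have "eval_poly (G' i j) x = eval_poly (G i j) x + t * ((if i = j then eval_poly w x else 0)
          - eval_poly (f i) x * eval_poly (f j) x)" for i j
        by (simp add: G'_def)
      then have "(\<Sum>i\<in>J. \<Sum>j\<in>J. u i * u j * eval_poly (G' i j) x) = \<phi> (x, u) + t * \<psi> (x, u)"
        by (simp only: expand) (simp add: \<phi>_def \<psi>_def w_def)
      then have "\<delta> \<le> (\<Sum>i\<in>J. \<Sum>j\<in>J. u i * u j * eval_poly (G' i j) x)" using t(3)[OF x u(1)] by simp
      then have "(\<Sum>i\<in>J. (v i)\<^sup>2) * \<delta>
          \<le> (\<Sum>i\<in>J. (v i)\<^sup>2) * (\<Sum>i\<in>J. \<Sum>j\<in>J. u i * u j * eval_poly (G' i j) x)"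
        by (intro mult_left_mono sum_nonneg) auto
      also have "\<dots> = (\<Sum>i\<in>J. \<Sum>j\<in>J. v i * v j * eval_poly (G' i j) x)"
        by (rule quadratic_normalise[OF u(2), symmetric])
      finally show ?thesis by (simp only: mult.commute)
    qed
  qed
  moreover have "(\<Sum>i\<in>J. \<Sum>j\<in>J. f i * f j * G' i j) = (\<Sum>i\<in>J. \<Sum>j\<in>J. f i * f j * G i j)"
    unfolding G'_def expand by (simp add: w_def power2_eq_square)
  ultimately show ?thesis by simp
qed

text \<open>
  The part \<open>P\<close> has the right first-order behaviour at the zeros of \<open>F\<close> but may exceed \<open>F\<close> elsewhere.
  It is damped by the square of \<open>\<beta> = (1 - w / c) ^ N\<close>, which is \<open>1\<close> at the zeros of \<open>w = |f|\<^sup>2\<close> and tiny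
  away from them. As \<open>1 - \<beta>\<^sup>2\<close> is a multiple of \<open>w\<close>, the difference is absorbed by the quadratic form,
  to whose matrix it adds a nonnegative multiple of the identity.
\<close>

theorem boundary_hessian_certificate:
  fixes f :: "'j \<Rightarrow> 'v rpoly"
  assumes J: "finite J" and sym: "\<And>i j. i \<in> J \<Longrightarrow> j \<in> J \<Longrightarrow> G i j = G j i"
    and F: "F = P + (\<Sum>i\<in>J. \<Sum>j\<in>J. f i * f j * G i j)" and P: "P \<in> M"
    and off: "\<And>x. x \<in> K \<Longrightarrow> \<exists>i\<in>J. eval_poly (f i) x \<noteq> 0 \<Longrightarrow> 0 < eval_poly F x"
    and on: "\<And>x v. x \<in> K \<Longrightarrow> \<forall>i\<in>J. eval_poly (f i) x = 0 \<Longrightarrow> \<exists>i\<in>J. v i \<noteq> 0 \<Longrightarrow>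
      0 < (\<Sum>i\<in>J. \<Sum>j\<in>J. v i * v j * eval_poly (G i j) x)"
  shows "F \<in> M"
proof -
  let ?S = "unit_sphere J"
  define w where "w = (\<Sum>i\<in>J. (f i)\<^sup>2)"
  have w_nonneg: "0 \<le> eval_poly w x" for x by (simp add: w_def sum_nonneg)
  have w_0: "eval_poly w x = 0 \<longleftrightarrow> (\<forall>i\<in>J. eval_poly (f i) x = 0)" for x
    using J by (simp add: w_def sum_nonneg_eq_0_iff)
  obtain c where c: "0 < c" "\<forall>x\<in>K. \<bar>eval_poly w x\<bar> < c" using eval_poly_bounded by blast
  obtain B where B: "0 < B" "\<forall>x\<in>K. \<bar>eval_poly P x\<bar> < B" using eval_poly_bounded by blast
  define \<tau> where "\<tau> = 1 - Const (1 / c) * w"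
  have \<tau>_eval: "eval_poly \<tau> x = 1 - eval_poly w x / c" for x by (simp add: \<tau>_def)
  have \<tau>: "0 \<le> eval_poly \<tau> x \<and> eval_poly \<tau> x \<le> 1" if "x \<in> K" for x
    using c w_nonneg[of x] that by (auto simp: \<tau>_eval field_simps abs_less_iff intro: less_imp_le)
  define g where "g x v = (\<Sum>i\<in>J. \<Sum>j\<in>J. v i * v j * eval_poly (G i j) x)" for x v
  \<comment> \<open>Outside \<open>L\<close> the form alone is positive, and \<open>L\<close> is a compact set without zeros of \<open>F\<close>.\<close>
  define L where "L = {x \<in> K. \<exists>v\<in>?S. g x v \<le> 0}"
  have "compact L"
  proof -
    have proj: "continuous_on C (\<lambda>z. snd z i)" for C :: "(('v \<Rightarrow> real) \<times> ('j \<Rightarrow> real)) set" and i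
      by (rule continuous_on_product_then_coordinatewise) (intro continuous_intros)
    have ev: "continuous_on C (\<lambda>z. eval_poly p (fst z))" for C :: "(('v \<Rightarrow> real) \<times> ('j \<Rightarrow> real)) set" and p
      by (rule continuous_on_compose2[OF continuous_on_eval_poly]) (auto intro: continuous_intros)
    have "continuous_on (K \<times> ?S) (\<lambda>z. g (fst z) (snd z))"
      unfolding g_def by (intro continuous_intros proj ev)
    then have "closedin (top_of_set (K \<times> ?S)) (K \<times> ?S \<inter> (\<lambda>z. g (fst z) (snd z)) -` {..0})"
      by (intro continuous_closedin_preimage closed_atMost)
    then have "compact (K \<times> ?S \<inter> (\<lambda>z. g (fst z) (snd z)) -` {..0})"
      by (rule closedin_compact[rotated]) (intro compact_Times K compact_unit_sphere J)
    then have "compact (fst ` (K \<times> ?S \<inter> (\<lambda>z. g (fst z) (snd z)) -` {..0}))"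
      by (intro compact_continuous_image continuous_intros)
    moreover have "fst ` (K \<times> ?S \<inter> (\<lambda>z. g (fst z) (snd z)) -` {..0}) = L"
      unfolding L_def by force
    ultimately show ?thesis by simp
  qed
  have L_off: "\<exists>i\<in>J. eval_poly (f i) x \<noteq> 0" if "x \<in> L" for x
  proof (rule ccontr)
    assume "\<not> ?thesis"
    then have "\<forall>i\<in>J. eval_poly (f i) x = 0" by blast
    moreover obtain v where v: "v \<in> ?S" "g x v \<le> 0" using \<open>x \<in> L\<close> unfolding L_def by blast
    have "(\<Sum>i\<in>J. (v i)\<^sup>2) = 1" using v(1) unfolding unit_sphere_def by blast
    then have "\<exists>i\<in>J. v i \<noteq> 0" by (metis (no_types, lifting) sum.neutral zero_eq_power2 zero_neq_one)
    ultimately have "0 < g x v" using on[of x v] \<open>x \<in> L\<close> unfolding L_def g_def by blast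
    then show False using v by simp
  qed
  have "\<exists>N. \<forall>x\<in>L. eval_poly \<tau> x ^ (2 * N) * eval_poly P x < eval_poly F x"
  proof (cases "L = {}")
    case False
    obtain x0 where x0: "x0 \<in> L" "\<forall>x\<in>L. eval_poly F x0 \<le> eval_poly F x"
      using continuous_attains_inf[OF \<open>compact L\<close> False continuous_on_eval_poly] by blast
    obtain x1 where x1: "x1 \<in> L" "\<forall>x\<in>L. eval_poly w x1 \<le> eval_poly w x"
      using continuous_attains_inf[OF \<open>compact L\<close> False continuous_on_eval_poly] by blast
    have LK: "L \<subseteq> K" unfolding L_def by blast
    have F0: "0 < eval_poly F x0" using off L_off x0(1) LK by blast
    have "0 < eval_poly w x1" using w_nonneg[of x1] w_0[of x1] L_off[OF x1(1)] by force
    then have rho: "0 \<le> eval_poly \<tau> x1" "eval_poly \<tau> x1 < 1"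
      using \<tau>[of x1] x1(1) LK c(1) by (auto simp: \<tau>_eval)
    obtain N where N: "eval_poly \<tau> x1 ^ N < eval_poly F x0 / B"
      using real_arch_pow_inv[of "eval_poly F x0 / B" "eval_poly \<tau> x1"] F0 B(1) rho by auto
    have "eval_poly \<tau> x ^ (2 * N) * eval_poly P x < eval_poly F x" if x: "x \<in> L" for x
    proof -
      have "eval_poly \<tau> x \<le> eval_poly \<tau> x1"
        unfolding \<tau>_eval using x1(2) x c(1) by (simp add: divide_right_mono)
      then have "eval_poly \<tau> x ^ (2 * N) \<le> eval_poly \<tau> x1 ^ (2 * N)"
        using \<tau>[of x] x LK by (intro power_mono) auto
      also have "\<dots> \<le> eval_poly \<tau> x1 ^ N" using rho by (intro power_decreasing) auto
      finally have "eval_poly \<tau> x ^ (2 * N) * eval_poly P x \<le> eval_poly \<tau> x1 ^ N * B"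
        using B x LK nonneg[OF P, of x] rho by (intro mult_mono) (auto simp: abs_less_iff intro: less_imp_le)
      also have "\<dots> < eval_poly F x0" using N B(1) by (simp add: field_simps)
      also have "\<dots> \<le> eval_poly F x" using x0(2) x by blast
      finally show ?thesis .
    qed
    then show ?thesis by blast
  qed simp
  then obtain N where N: "\<And>x. x \<in> L \<Longrightarrow> eval_poly \<tau> x ^ (2 * N) * eval_poly P x < eval_poly F x" by blast
  define \<mu> where "\<mu> = Const (1 / c) * (\<Sum>l<2 * N. \<tau> ^ l)"
  have w\<mu>: "w * \<mu> = 1 - \<tau> ^ (2 * N)"
    unfolding one_diff_power_eq \<mu>_def by (simp add: \<tau>_def mult_ac)
  have P\<mu>: "0 \<le> eval_poly (P * \<mu>) x" if "x \<in> K" for x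
    using c(1) \<tau>[OF that] nonneg[OF P that] by (simp add: \<mu>_def sum_nonneg)
  define G' where "G' i j = G i j + (if i = j then P * \<mu> else 0)" for i j
  have expand: "(\<Sum>i\<in>J. \<Sum>j\<in>J. v i * v j * (g i j + (if i = j then y else 0)))
      = (\<Sum>i\<in>J. \<Sum>j\<in>J. v i * v j * g i j) + y * (\<Sum>i\<in>J. (v i)\<^sup>2)"
    for v :: "'j \<Rightarrow> 'c::comm_ring_1" and g y
    using J by (simp add: distrib_left sum.distrib if_distrib[of "\<lambda>x. _ * x"] sum.delta
        sum_distrib_left power2_eq_square mult.commute cong: if_cong)
  have form: "(\<Sum>i\<in>J. \<Sum>j\<in>J. f i * f j * G' i j) = F - \<tau> ^ (2 * N) * P"
  proof -
    have "(\<Sum>i\<in>J. \<Sum>j\<in>J. f i * f j * G' i j) = (F - P) + P * (w * \<mu>)"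
      unfolding G'_def expand by (simp add: F w_def mult_ac)
    then show ?thesis unfolding w\<mu> by (simp add: algebra_simps)
  qed
  have form': "(\<Sum>i\<in>J. \<Sum>j\<in>J. v i * v j * eval_poly (G' i j) x)
      = g x v + eval_poly (P * \<mu>) x * (\<Sum>i\<in>J. (v i)\<^sup>2)" for x v
  proof -
    have "eval_poly (G' i j) x = eval_poly (G i j) x + (if i = j then eval_poly (P * \<mu>) x else 0)" for i j
      by (simp add: G'_def)
    then show ?thesis by (simp only: expand g_def)
  qed
  have "(\<Sum>i\<in>J. \<Sum>j\<in>J. f i * f j * G' i j) \<in> M"
  proof (rule positive_form_in_module[OF J])
    show "G' i j = G' j i" if "i \<in> J" "j \<in> J" for i j using sym[OF that] by (simp add: G'_def)
    show "0 < eval_poly (\<Sum>i\<in>J. \<Sum>j\<in>J. f i * f j * G' i j) x"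
      if x: "x \<in> K" and ne: "\<exists>i\<in>J. eval_poly (f i) x \<noteq> 0" for x
    proof (cases "x \<in> L")
      case True
      then show ?thesis unfolding form using N[OF True] by simp
    next
      case False
      obtain u where u: "u \<in> ?S" "\<And>i. i \<in> J \<Longrightarrow>
          eval_poly (f i) x = sqrt (\<Sum>j\<in>J. (eval_poly (f j) x)\<^sup>2) * u i"
        using unit_sphere_normalise[OF J ne] by blast
      have "0 < g x u" using False x u(1) unfolding L_def by force
      moreover have "0 < (\<Sum>j\<in>J. (eval_poly (f j) x)\<^sup>2)"
        using w_nonneg[of x] w_0[of x] ne by (force simp: w_def)
      ultimately have "0 < (\<Sum>j\<in>J. (eval_poly (f j) x)\<^sup>2) * g x u" by simp
      also have "\<dots> = (\<Sum>i\<in>J. \<Sum>j\<in>J. eval_poly (f i) x * eval_poly (f j) x * eval_poly (G i j) x)"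
        unfolding g_def by (rule quadratic_normalise[OF u(2), symmetric])
      finally have "0 < \<dots>" .
      moreover have "eval_poly (\<Sum>i\<in>J. \<Sum>j\<in>J. f i * f j * G' i j) x
          = (\<Sum>i\<in>J. \<Sum>j\<in>J. eval_poly (f i) x * eval_poly (f j) x * eval_poly (G' i j) x)"
        by simp
      moreover have "0 \<le> eval_poly (P * \<mu>) x * (\<Sum>j\<in>J. (eval_poly (f j) x)\<^sup>2)"
        by (intro mult_nonneg_nonneg P\<mu> x sum_nonneg) auto
      ultimately show ?thesis unfolding form' g_def by linarith
    qed
    show "0 < (\<Sum>i\<in>J. \<Sum>j\<in>J. v i * v j * eval_poly (G' i j) x)"
      if x: "x \<in> K" "\<forall>i\<in>J. eval_poly (f i) x = 0" "\<exists>i\<in>J. v i \<noteq> 0" for x v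
    proof -
      have "0 \<le> eval_poly (P * \<mu>) x * (\<Sum>i\<in>J. (v i)\<^sup>2)"
        by (intro mult_nonneg_nonneg P\<mu> x sum_nonneg) auto
      then show ?thesis unfolding form' using on[OF x] unfolding g_def by linarith
    qed
  qed
  then have "(F - \<tau> ^ (2 * N) * P) + (\<tau> ^ N)\<^sup>2 * P \<in> M"
    unfolding form by (intro qm_add[OF qm] qm_square_mult[OF qm] P)
  then show ?thesis by (simp add: power_mult[symmetric] mult.commute)
qed

end

section \<open>The quadratic module of the simplex\<close>

definition restrict_vars :: "'v set \<Rightarrow> 'v rpoly \<Rightarrow> 'v rpoly" where
  "restrict_vars V p = subst_poly Const (\<lambda>i. if i \<in> V then Var i else 0) p"

lemmas restrict_vars_hom = subst_poly_hom[OF real_ring_hom_Const,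
    of "\<lambda>i. if i \<in> V then Var i else 0" for V, folded restrict_vars_def]

lemma restrict_vars_polys: "restrict_vars V p \<in> polys V"
proof -
  have "p \<in> polys UNIV" by simp
  then show ?thesis
    by (induction p rule: rpoly_induct_on)
      (auto simp: restrict_vars_hom intro: polys_Var polys_add polys_mult)
qed

lemma restrict_vars_id: "p \<in> polys V \<Longrightarrow> restrict_vars V p = p"
  by (induction p rule: rpoly_induct_on) (auto simp: restrict_vars_hom)

lemma eval_restrict_vars: "eval_poly (restrict_vars V p) x = eval_poly p (\<lambda>i. if i \<in> V then x i else 0)"
proof -
  have "p \<in> polys UNIV" by simp
  then show ?thesis
    by (induction p rule: rpoly_induct_on) (auto simp: restrict_vars_hom)
qed

definition simplex_module :: "'v set \<Rightarrow> 'v rpoly set" where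
  "simplex_module V = {\<sigma>\<^sub>0 + (\<Sum>i\<in>V. Var i * \<sigma> i) + q * ((\<Sum>i\<in>V. Var i) - 1) | \<sigma>\<^sub>0 \<sigma> q.
     \<sigma>\<^sub>0 \<in> sos V \<and> (\<forall>i\<in>V. \<sigma> i \<in> sos V) \<and> q \<in> polys V}"

lemma simplex_module_truncation:
  assumes "finite V" "p \<in> simplex_module V"
  obtains r u v where "r \<ge> 1" "u \<in> quadratic_module V r" "v \<in> simplex_ideal V r" "p = u + v"
proof -
  obtain \<sigma>0 \<sigma> q where p: "p = \<sigma>0 + (\<Sum>i\<in>V. Var i * \<sigma> i) + q * ((\<Sum>i\<in>V. Var i) - 1)"
    and s: "\<sigma>0 \<in> sos V" "\<forall>i\<in>V. \<sigma> i \<in> sos V" "q \<in> polys V"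
    using assms(2) unfolding simplex_module_def by blast
  define d where "d = (\<Sum>i\<in>V. total_degree (Var i * \<sigma> i))"
  define r where "r = 1 + total_degree \<sigma>0 + d + total_degree (q * ((\<Sum>i\<in>V. Var i) - 1))"
  have "total_degree (Var i * \<sigma> i) \<le> r" if "i \<in> V" for i
  proof -
    have "total_degree (Var i * \<sigma> i) \<le> d"
      unfolding d_def by (rule member_le_sum) (use that assms(1) in auto)
    then show ?thesis by (simp add: r_def)
  qed
  then have "\<sigma>0 + (\<Sum>i\<in>V. Var i * \<sigma> i) \<in> quadratic_module V r"
    unfolding quadratic_module_def using s by (auto simp: r_def intro!: exI[of _ \<sigma>0] exI[of _ \<sigma>])
  moreover have "q * ((\<Sum>i\<in>V. Var i) - 1) \<in> simplex_ideal V r"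
    unfolding simplex_ideal_def using s by (auto simp: r_def)
  ultimately show ?thesis using that[of r] p by (simp add: r_def)
qed

context
  fixes V :: "'v set"
  assumes V: "finite V"
begin

lemma simplex_module_add: "p \<in> simplex_module V \<Longrightarrow> q \<in> simplex_module V \<Longrightarrow> p + q \<in> simplex_module V"
proof -
  assume "p \<in> simplex_module V" "q \<in> simplex_module V"
  then obtain a s u b t w where
    "p = a + (\<Sum>i\<in>V. Var i * s i) + u * ((\<Sum>i\<in>V. Var i) - 1)" "a \<in> sos V" "\<forall>i\<in>V. s i \<in> sos V" "u \<in> polys V"
    "q = b + (\<Sum>i\<in>V. Var i * t i) + w * ((\<Sum>i\<in>V. Var i) - 1)" "b \<in> sos V" "\<forall>i\<in>V. t i \<in> sos V" "w \<in> polys V"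
    unfolding simplex_module_def by blast
  then have "p + q = (a + b) + (\<Sum>i\<in>V. Var i * (s i + t i)) + (u + w) * ((\<Sum>i\<in>V. Var i) - 1)"
    "a + b \<in> sos V" "\<forall>i\<in>V. s i + t i \<in> sos V" "u + w \<in> polys V"
    by (auto simp: distrib_left distrib_right sum.distrib intro: sos_add polys_add)
  then show ?thesis unfolding simplex_module_def
    by (intro CollectI exI[of _ "a + b"] exI[of _ "\<lambda>i. s i + t i"] exI[of _ "u + w"]) simp
qed

lemma simplex_module_square_mult:
  assumes "p \<in> simplex_module V" "b \<in> polys V"
  shows "b\<^sup>2 * p \<in> simplex_module V"
proof -
  obtain a s u where
    "p = a + (\<Sum>i\<in>V. Var i * s i) + u * ((\<Sum>i\<in>V. Var i) - 1)" "a \<in> sos V" "\<forall>i\<in>V. s i \<in> sos V" "u \<in> polys V"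
    using assms(1) unfolding simplex_module_def by blast
  moreover from this have "b\<^sup>2 * a \<in> sos V" "\<forall>i\<in>V. b\<^sup>2 * s i \<in> sos V"
    using assms(2) sos_mult_square by blast+
  moreover from calculation have "b\<^sup>2 * u \<in> polys V"
    using assms(2) by (simp add: power2_eq_square polys_mult)
  moreover from calculation have
    "b\<^sup>2 * p = b\<^sup>2 * a + (\<Sum>i\<in>V. Var i * (b\<^sup>2 * s i)) + (b\<^sup>2 * u) * ((\<Sum>i\<in>V. Var i) - 1)"
    by (simp add: distrib_left sum_distrib_left mult_ac)
  ultimately show ?thesis unfolding simplex_module_def
    by (intro CollectI exI[of _ "b\<^sup>2 * a"] exI[of _ "\<lambda>i. b\<^sup>2 * s i"] exI[of _ "b\<^sup>2 * u"]) simp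
qed

lemma simplex_module_sos: "s \<in> sos V \<Longrightarrow> s \<in> simplex_module V"
  unfolding simplex_module_def
  by (intro CollectI exI[of _ s] exI[of _ "\<lambda>i. 0"] exI[of _ 0]) (simp add: sos_0)

lemma simplex_module_ideal: "q \<in> polys V \<Longrightarrow> q * ((\<Sum>i\<in>V. Var i) - 1) \<in> simplex_module V"
  unfolding simplex_module_def
  by (intro CollectI exI[of _ 0] exI[of _ "\<lambda>i. 0"] exI[of _ q]) (simp add: sos_0)

lemma simplex_module_Var:
  assumes "k \<in> V"
  shows "Var k \<in> simplex_module V"
proof -
  have "(\<Sum>i\<in>V. Var i * (if i = k then 1 else 0)) = (Var k :: 'v rpoly)"
    using V assms by (simp add: if_distrib[of "\<lambda>x. _ * x"] sum.delta cong: if_cong)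
  moreover have "(if i = k then 1 else 0) \<in> sos V" for i
    using sos_Const[of 1 V] sos_0[of V] by simp
  ultimately show ?thesis unfolding simplex_module_def
    by (intro CollectI exI[of _ 0] exI[of _ "\<lambda>i. if i = k then 1 else 0"] exI[of _ 0])
      (simp add: sos_0)
qed

lemma simplex_module_nonneg:
  assumes "p \<in> simplex_module V" "x \<in> standard_simplex V"
  shows "0 \<le> eval_poly p x"
proof -
  obtain a s u where
    p: "p = a + (\<Sum>i\<in>V. Var i * s i) + u * ((\<Sum>i\<in>V. Var i) - 1)" "a \<in> sos V" "\<forall>i\<in>V. s i \<in> sos V"
    using assms(1) unfolding simplex_module_def by blast
  have "eval_poly p x = eval_poly a x + (\<Sum>i\<in>V. x i * eval_poly (s i) x)"
    using assms(2) unfolding p(1) standard_simplex_def by simp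
  then show ?thesis using p assms(2) eval_sos_nonneg
    unfolding standard_simplex_def by (force intro!: add_nonneg_nonneg sum_nonneg mult_nonneg_nonneg)
qed

lemma compact_standard_simplex: "compact (standard_simplex V)"
proof -
  let ?B = "{v :: 'v \<Rightarrow> real. (\<forall>i\<in>V. -1 \<le> v i \<and> v i \<le> 1) \<and> (\<forall>i. i \<notin> V \<longrightarrow> v i = 0)}"
  \<comment> \<open>One continuous function whose zeros are the points that satisfy all conditions.\<close>
  let ?g = "\<lambda>v. \<bar>(\<Sum>i\<in>V. v i) - 1\<bar> + (\<Sum>i\<in>V. \<bar>v i\<bar> - v i)"
  have "continuous_on ?B ?g"
    by (intro continuous_intros continuous_on_product_then_coordinatewise)
  then have "closedin (top_of_set ?B) (?B \<inter> ?g -` {0})"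
    by (intro continuous_closedin_preimage closed_singleton)
  then have "compact (?B \<inter> ?g -` {0})"
    by (rule closedin_compact[OF compact_coordinate_box])
  moreover have "?B \<inter> ?g -` {0} = standard_simplex V"
  proof -
    have "-1 \<le> x i \<and> x i \<le> 1" if "x \<in> standard_simplex V" "i \<in> V" for x i
    proof -
      have "x i \<le> (\<Sum>i\<in>V. x i)"
        by (rule member_le_sum) (use that V in \<open>auto simp: standard_simplex_def\<close>)
      then show ?thesis using that by (force simp: standard_simplex_def)
    qed
    moreover have "?g v = 0 \<longleftrightarrow> (\<Sum>i\<in>V. v i) = 1 \<and> (\<forall>i\<in>V. 0 \<le> v i)" for v :: "'v \<Rightarrow> real"
    proof -
      have nn: "0 \<le> (\<Sum>i\<in>V. \<bar>v i\<bar> - v i)" by (intro sum_nonneg) auto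
      have "(\<Sum>i\<in>V. \<bar>v i\<bar> - v i) = 0 \<longleftrightarrow> (\<forall>i\<in>V. \<bar>v i\<bar> - v i = 0)"
        using V by (intro sum_nonneg_eq_0_iff) auto
      also have "\<dots> \<longleftrightarrow> (\<forall>i\<in>V. 0 \<le> v i)" by (auto simp: abs_if)
      finally have "(\<Sum>i\<in>V. \<bar>v i\<bar> - v i) = 0 \<longleftrightarrow> (\<forall>i\<in>V. 0 \<le> v i)" .
      then show ?thesis using nn by (auto simp: add_nonneg_eq_0_iff)
    qed
    ultimately show ?thesis unfolding standard_simplex_def by auto
  qed
  ultimately show ?thesis by simp
qed

text \<open>
  The variables outside \<open>V\<close> are set to zero, so that positivity on the simplex and membership are
  meaningful for all polynomials and not only for those in the variables of \<open>V\<close>.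
\<close>

definition extended_module :: "'v rpoly set" where
  "extended_module = {p. restrict_vars V p \<in> simplex_module V}"

lemma quad_module_extended: "quad_module extended_module"
  unfolding quad_module_def extended_module_def
  using simplex_module_add simplex_module_square_mult[OF _ restrict_vars_polys]
    simplex_module_sos[OF sos_Const[of 1]]
  by (auto simp: restrict_vars_hom)

lemma extended_Var: "i \<in> V \<Longrightarrow> Var i \<in> extended_module"
  by (simp add: extended_module_def restrict_vars_hom simplex_module_Var)

lemma extended_ideal: "q * ((\<Sum>i\<in>V. Var i) - 1) \<in> extended_module"
  using simplex_module_ideal[OF restrict_vars_polys, of q]
  by (simp add: extended_module_def restrict_vars_hom)

lemma eval_restrict_on_simplex:
  "x \<in> standard_simplex V \<Longrightarrow> eval_poly (restrict_vars V p) x = eval_poly p x"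
proof -
  assume "x \<in> standard_simplex V"
  then have "(\<lambda>i. if i \<in> V then x i else 0) = x" unfolding standard_simplex_def by auto
  then show ?thesis by (simp add: eval_restrict_vars)
qed

lemma extended_nonneg: "p \<in> extended_module \<Longrightarrow> x \<in> standard_simplex V \<Longrightarrow> 0 \<le> eval_poly p x"
  using simplex_module_nonneg[of "restrict_vars V p" x] eval_restrict_on_simplex[of x p]
  by (simp add: extended_module_def)

text \<open>
  On the hyperplane \<open>1 - x\<^sub>i\<close> is the sum of the other variables. Hence \<open>1 \<plusminus> x\<^sub>i\<close> belong to the module, and
  \<open>(1 + x)\<^sup>2 (1 - x) + (1 - x)\<^sup>2 (1 + x) = 2 (1 - x\<^sup>2)\<close>.
\<close>

lemma archimedean_extended: "archimedean extended_module"
proof (rule archimedean_from_variables[OF quad_module_extended])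
  fix i
  note qm = quad_module_extended
  show "\<exists>N. Const N - (Var i)\<^sup>2 \<in> extended_module"
  proof (cases "i \<in> V")
    case False
    then have "Const 0 - (Var i)\<^sup>2 \<in> extended_module"
      by (simp add: extended_module_def restrict_vars_hom simplex_module_sos sos_0)
    then show ?thesis by blast
  next
    case True
    let ?x = "Var i :: 'v rpoly"
    have "1 - ?x = (\<Sum>j\<in>V - {i}. Var j) + (-1) * ((\<Sum>j\<in>V. Var j) - 1)"
      using V True by (simp add: sum.remove)
    also have "\<dots> \<in> extended_module"
      by (rule qm_add[OF qm qm_sum[OF qm] extended_ideal]) (use extended_Var in auto)
    finally have "1 - ?x \<in> extended_module" .
    moreover have "1 + ?x \<in> extended_module"
      by (rule qm_add[OF qm qm_1[OF qm] extended_Var[OF True]])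
    ultimately have "(1 + ?x)\<^sup>2 * (1 - ?x) + (1 - ?x)\<^sup>2 * (1 + ?x) \<in> extended_module"
      by (rule qm_add[OF qm qm_square_mult[OF qm] qm_square_mult[OF qm]])
    also have "(1 + ?x)\<^sup>2 * (1 - ?x) + (1 - ?x)\<^sup>2 * (1 + ?x) = Const 2 * (Const 1 - ?x\<^sup>2)"
      by (simp add: power2_eq_square algebra_simps)
    finally have "Const 1 - ?x\<^sup>2 \<in> extended_module" by (rule qm_scaleD[OF qm, rotated]) simp
    then show ?thesis by blast
  qed
qed

lemma positive_on_simplex_in_module:
  assumes "\<And>x. x \<in> standard_simplex V \<Longrightarrow> 0 < eval_poly p x"
  shows "p \<in> extended_module"
proof (rule Putinar[OF quad_module_extended archimedean_extended])
  fix x assume x: "\<And>q. q \<in> extended_module \<Longrightarrow> 0 \<le> eval_poly q x"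
  have "0 \<le> x i" if "i \<in> V" for i using x[OF extended_Var[OF that]] by simp
  moreover have "(\<Sum>i\<in>V. x i) = 1"
    using x[OF extended_ideal[of 1]] x[OF extended_ideal[of "-1"]] by simp
  moreover have "x i = 0" if "i \<notin> V" for i
  proof -
    have "Var i \<in> extended_module" "- Var i \<in> extended_module"
      using that by (simp_all add: extended_module_def restrict_vars_hom simplex_module_sos sos_0)
    from this[THEN x] show ?thesis by simp
  qed
  ultimately show "0 < eval_poly p x" by (intro assms) (auto simp: standard_simplex_def)
qed

lemmas simplex_certificate = boundary_hessian_certificate[OF quad_module_extended
    compact_standard_simplex extended_nonneg positive_on_simplex_in_module]

end

lemma quadratic_module_nonneg:
  assumes "finite V" "x \<in> standard_simplex V" "p \<in> quadratic_module V r" "q \<in> simplex_ideal V r"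
  shows "0 \<le> eval_poly (p + q) x"
proof -
  have "p + q \<in> simplex_module V"
    using assms(3,4) unfolding quadratic_module_def simplex_ideal_def simplex_module_def by blast
  then show ?thesis by (rule simplex_module_nonneg[OF assms(1) _ assms(2)])
qed

lemma standard_simplex_nonempty:
  assumes "finite V" "V \<noteq> {}"
  shows "standard_simplex V \<noteq> {}"
proof -
  obtain k where "k \<in> V" using assms by blast
  then have "(\<lambda>i. if i = k then 1 else 0) \<in> standard_simplex V"
    using assms by (auto simp: standard_simplex_def sum.delta)
  then show ?thesis by blast
qed

lemma feasible_le_simplex_min:
  assumes "finite V" "V \<noteq> {}" "p \<in> quadratic_module V r" "q \<in> simplex_ideal V r" "f - Const c = p + q"
  shows "c \<le> simplex_min V f"
  unfolding simplex_min_def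
proof (rule cINF_greatest[OF standard_simplex_nonempty[OF assms(1,2)]])
  fix x assume "x \<in> standard_simplex V"
  then have "0 \<le> eval_poly (f - Const c) x"
    unfolding assms(5) by (rule quadratic_module_nonneg[OF assms(1) _ assms(3,4)])
  then show "c \<le> eval_poly f x" by simp
qed

lemma finite_convergence_if_attained:
  assumes V: "finite V" "V \<noteq> {}" and f: "f - Const (simplex_min V f) \<in> simplex_module V"
  shows "lasserre_finite_convergence V f"
proof -
  obtain r u v where r: "r \<ge> 1" "u \<in> quadratic_module V r" "v \<in> simplex_ideal V r"
    "f - Const (simplex_min V f) = u + v"
    using simplex_module_truncation[OF V(1) f] by blast
  have "lasserre_bound V f r = ereal (simplex_min V f)"
    unfolding lasserre_bound_def
  proof (rule antisym)
    show "Sup {ereal c |c. \<exists>p\<in>quadratic_module V r. \<exists>q\<in>simplex_ideal V r. f - Const c = p + q}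
        \<le> ereal (simplex_min V f)"
      using feasible_le_simplex_min[OF V] by (intro Sup_least) auto
    show "ereal (simplex_min V f)
        \<le> Sup {ereal c |c. \<exists>p\<in>quadratic_module V r. \<exists>q\<in>simplex_ideal V r. f - Const c = p + q}"
      using r by (intro Sup_upper) blast
  qed
  then show ?thesis unfolding lasserre_finite_convergence_def using r(1) by blast
qed

lemma finite_convergence_approximation:
  assumes V: "finite V" "V \<noteq> {}" and conv: "lasserre_finite_convergence V f"
  obtains r where "\<And>e. 0 < e \<Longrightarrow> \<exists>c\<le>simplex_min V f. simplex_min V f - e < c \<and>
      (\<exists>p\<in>quadratic_module V r. \<exists>q\<in>simplex_ideal V r. f - Const c = p + q)"
proof -
  obtain r where r: "lasserre_bound V f r = ereal (simplex_min V f)"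
    using conv unfolding lasserre_finite_convergence_def by blast
  have "\<exists>c\<le>simplex_min V f. simplex_min V f - e < c \<and>
      (\<exists>p\<in>quadratic_module V r. \<exists>q\<in>simplex_ideal V r. f - Const c = p + q)" if e: "0 < e" for e
  proof -
    have "ereal (simplex_min V f - e) < lasserre_bound V f r" using r e by simp
    then obtain z where "ereal (simplex_min V f - e) < z"
      "z \<in> {ereal c | c. \<exists>p\<in>quadratic_module V r. \<exists>q\<in>simplex_ideal V r. f - Const c = p + q}"
      unfolding lasserre_bound_def less_Sup_iff by blast
    then obtain c where "ereal (simplex_min V f - e) < ereal c"
      and c: "\<exists>p\<in>quadratic_module V r. \<exists>q\<in>simplex_ideal V r. f - Const c = p + q"
      by blast
    then have "simplex_min V f - e < c" by simp
    note c = this c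
    then show ?thesis using feasible_le_simplex_min[OF V] by blast
  qed
  then show ?thesis by (rule that)
qed

section \<open>Stable sets, critical edges and the Motzkin-Straus form\<close>

definition closed_adjacency :: "'v graph \<Rightarrow> 'v \<Rightarrow> 'v \<Rightarrow> real" where
  "closed_adjacency G i j = adjacency_matrix G i j + identity_matrix i j"

definition maximum_stable_set :: "'v graph \<Rightarrow> 'v set \<Rightarrow> bool" where
  "maximum_stable_set G S \<longleftrightarrow> stable_set G S \<and> card S = stability_number G"

context
  fixes G :: "'v graph"
  assumes G: "simple_graph G"
begin

lemma finite_vertices: "finite (fst G)"
  using G unfolding simple_graph_def by blast

lemma no_loop: "{v, v} \<notin> snd G"
  using G unfolding simple_graph_def by (auto simp: doubleton_eq_iff)

lemma edge_vertices: "{u, v} \<in> snd G \<Longrightarrow> u \<in> fst G \<and> v \<in> fst G \<and> u \<noteq> v"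
  using G no_loop[of u] unfolding simple_graph_def by (auto simp: doubleton_eq_iff)

lemma edgeE:
  assumes "e \<in> snd G"
  obtains u v where "e = {u, v}" "u \<in> fst G" "v \<in> fst G" "u \<noteq> v"
  using assms G unfolding simple_graph_def by blast

lemma closed_adjacency_refl [simp]: "closed_adjacency G v v = 1"
  using no_loop by (simp add: closed_adjacency_def adjacency_matrix_def identity_matrix_def)

lemma closed_adjacency_neq:
  "u \<noteq> v \<Longrightarrow> closed_adjacency G u v = (if {u, v} \<in> snd G then 1 else 0)"
  by (simp add: closed_adjacency_def adjacency_matrix_def identity_matrix_def)

lemma closed_adjacency_sym: "closed_adjacency G u v = closed_adjacency G v u"
  by (simp add: closed_adjacency_def adjacency_matrix_def identity_matrix_def insert_commute)

lemma stable_finite: "stable_set G S \<Longrightarrow> finite S"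
  using finite_vertices finite_subset unfolding stable_set_def by blast

lemma stable_sizes: "finite {card S | S. stable_set G S}" "{card S | S. stable_set G S} \<noteq> {}"
proof -
  have "{card S | S. stable_set G S} \<subseteq> {..card (fst G)}"
    using card_mono[OF finite_vertices] unfolding stable_set_def by auto
  then show "finite {card S | S. stable_set G S}" by (rule finite_subset) simp
  have "stable_set G {}" unfolding stable_set_def by simp
  then show "{card S | S. stable_set G S} \<noteq> {}" by blast
qed

lemma stable_card_le: "stable_set G S \<Longrightarrow> card S \<le> stability_number G"
  unfolding stability_number_def by (rule Max_ge[OF stable_sizes(1)]) blast

lemma maximum_stable_set_exists: "\<exists>S. maximum_stable_set G S"
  using Max_in[OF stable_sizes] unfolding stability_number_def maximum_stable_set_def by auto

lemma stability_number_pos: "fst G \<noteq> {} \<Longrightarrow> 0 < stability_number G"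
proof -
  assume "fst G \<noteq> {}"
  then obtain v where "v \<in> fst G" by blast
  then have "stable_set G {v}" unfolding stable_set_def by simp
  then show ?thesis using stable_card_le[of "{v}"] by simp
qed

lemma simple_delete_edge: "simple_graph (delete_edge G e)"
  using G unfolding simple_graph_def delete_edge_def by auto

end

definition degree_into :: "'v graph \<Rightarrow> 'v set \<Rightarrow> 'v \<Rightarrow> nat" where
  "degree_into G S k = card {i \<in> S. {k, i} \<in> snd G}"

text \<open>
  If \<open>k\<close> had a single neighbour \<open>i\<close> in the maximum stable set \<open>S\<close>, then \<open>S \<union> {k}\<close> would be stable
  after deleting the edge \<open>{i, k}\<close>, and this edge would be critical.
\<close>

lemma two_neighbours_if_no_critical_edge:
  assumes G: "simple_graph G" and nc: "\<nexists>e. critical_edge G e"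
    and S: "maximum_stable_set G S" and k: "k \<in> fst G" "k \<notin> S"
  shows "2 \<le> degree_into G S k"
proof (rule ccontr)
  let ?N = "{i \<in> S. {k, i} \<in> snd G}"
  assume "\<not> ?thesis"
  then have c: "card ?N \<le> 1" unfolding degree_into_def by simp
  have st: "stable_set G S" "card S = stability_number G" using S unfolding maximum_stable_set_def by auto
  have finS: "finite S" using stable_finite[OF G st(1)] .
  show False
  proof (cases "?N = {}")
    case True
    then have "{k, l} \<notin> snd G" "{l, k} \<notin> snd G" if "l \<in> S" for l
      using that insert_commute[of l k "{}"] by auto
    then have "stable_set G (insert k S)"
      using st(1) k unfolding stable_set_def by blast
    from stable_card_le[OF G this] show False using finS k st(2) by simp
  next
    case False
    then have "card ?N \<noteq> 0" using finS by simp
    then have "card ?N = 1" using c by linarith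
    then obtain i where N: "?N = {i}" by (auto simp: card_1_singleton_iff)
    then have i: "i \<in> S" "{k, i} \<in> snd G" by auto
    have only: "{k, l} \<notin> snd G - {{k, i}}" "{l, k} \<notin> snd G - {{k, i}}" if "l \<in> S" for l
      using that N insert_commute[of l k "{}"] by auto
    let ?H = "delete_edge G {k, i}"
    have H: "simple_graph ?H" by (rule simple_delete_edge[OF G])
    have "stable_set ?H (insert k S)"
      unfolding stable_set_def
    proof (intro conjI ballI impI)
      show "insert k S \<subseteq> fst ?H" using st(1) k unfolding stable_set_def delete_edge_def by auto
    next
      fix u v assume "u \<in> insert k S" "v \<in> insert k S" "u \<noteq> v"
      then consider "u \<in> S" "v \<in> S" | "u = k" "v \<in> S" | "v = k" "u \<in> S" by blast
      then show "{u, v} \<notin> snd ?H"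
      proof cases
        case 1 then show ?thesis using st(1) \<open>u \<noteq> v\<close> unfolding stable_set_def delete_edge_def by auto
      next
        case 2 then show ?thesis using only unfolding delete_edge_def by simp
      next
        case 3 then show ?thesis using only unfolding delete_edge_def by simp
      qed
    qed
    then have ge: "stability_number G + 1 \<le> stability_number ?H"
      using stable_card_le[OF H] finS k st(2) by force
    obtain T where T: "stable_set ?H T" "card T = stability_number ?H"
      using maximum_stable_set_exists[OF H] unfolding maximum_stable_set_def by blast
    have "stable_set G (T - {k})"
      using T(1) unfolding stable_set_def delete_edge_def by (auto simp: doubleton_eq_iff)
    then have "card (T - {k}) \<le> stability_number G" by (rule stable_card_le[OF G])
    moreover have "card T \<le> card (T - {k}) + 1"
      by (cases "card T") (auto simp: card_Diff_singleton_if)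
    ultimately have "stability_number ?H = stability_number G + 1" using ge T(2) by linarith
    then have "critical_edge G {k, i}" using i unfolding critical_edge_def by blast
    then show False using nc by blast
  qed
qed

text \<open>
  A stable set of size \<open>\<alpha> + 1\<close> in the graph without the edge must contain both of its ends; \<open>T\<close> is what
  remains without them.
\<close>

lemma critical_edge_exchange:
  assumes G: "simple_graph G" and e: "critical_edge G e"
  obtains i j T where "e = {i, j}" "i \<noteq> j" "{i, j} \<in> snd G" "i \<notin> T" "j \<notin> T"
    "maximum_stable_set G (insert i T)" "maximum_stable_set G (insert j T)"
proof -
  have eG: "e \<in> snd G" and num: "stability_number (delete_edge G e) = stability_number G + 1"
    using e unfolding critical_edge_def by auto
  obtain i j where ij: "e = {i, j}" "i \<noteq> j" using edgeE[OF G eG] by metis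
  let ?H = "delete_edge G e"
  have H: "simple_graph ?H" by (rule simple_delete_edge[OF G])
  obtain S where S: "stable_set ?H S" "card S = stability_number G + 1"
    using maximum_stable_set_exists[OF H] num unfolding maximum_stable_set_def by auto
  have sub: "stable_set G (S - {v})" if "v = i \<or> v = j" for v
    using S(1) that ij unfolding stable_set_def delete_edge_def by (auto simp: doubleton_eq_iff)
  have mem: "v \<in> S" if "v = i \<or> v = j" for v
  proof (rule ccontr)
    assume "v \<notin> S"
    then show False using sub[OF that] stable_card_le[OF G, of S] S(2) by simp
  qed
  define T where "T = S - {i, j}"
  have eqs: "insert j T = S - {i}" "insert i T = S - {j}" using mem[of i] mem[of j] ij unfolding T_def by auto
  have "card (S - {v}) = stability_number G" if "v \<in> S" for v
    using that S(2) stable_finite[OF H S(1)] by simp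
  then have "maximum_stable_set G (insert i T)" "maximum_stable_set G (insert j T)"
    unfolding maximum_stable_set_def eqs using sub mem by auto
  then show ?thesis using that[of i j T] ij eG unfolding T_def by auto
qed

lemma symmetric_form_add:
  fixes M :: "'v \<Rightarrow> 'v \<Rightarrow> 'a::comm_ring_1"
  assumes "\<And>i j. M i j = M j i"
  shows "(\<Sum>i\<in>V. \<Sum>j\<in>V. M i j * (x i + y i) * (x j + y j))
       = (\<Sum>i\<in>V. \<Sum>j\<in>V. M i j * x i * x j) + 2 * (\<Sum>i\<in>V. y i * (\<Sum>j\<in>V. M i j * x j))
         + (\<Sum>i\<in>V. \<Sum>j\<in>V. M i j * y i * y j)"
proof -
  have "(\<Sum>i\<in>V. \<Sum>j\<in>V. M i j * x i * y j) = (\<Sum>j\<in>V. \<Sum>i\<in>V. M i j * x i * y j)" by (rule sum.swap)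
  also have "\<dots> = (\<Sum>i\<in>V. y i * (\<Sum>j\<in>V. M i j * x j))"
    unfolding sum_distrib_left using assms by (intro sum.cong refl) (simp add: mult_ac)
  finally have 1: "(\<Sum>i\<in>V. \<Sum>j\<in>V. M i j * x i * y j) = (\<Sum>i\<in>V. y i * (\<Sum>j\<in>V. M i j * x j))" .
  have 2: "(\<Sum>i\<in>V. \<Sum>j\<in>V. M i j * y i * x j) = (\<Sum>i\<in>V. y i * (\<Sum>j\<in>V. M i j * x j))"
    unfolding sum_distrib_left by (intro sum.cong refl) (simp add: mult_ac)
  have "(\<Sum>i\<in>V. \<Sum>j\<in>V. M i j * (x i + y i) * (x j + y j))
      = (\<Sum>i\<in>V. \<Sum>j\<in>V. M i j * x i * x j + M i j * x i * y j + M i j * y i * x j + M i j * y i * y j)"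
    by (intro sum.cong refl) (simp add: algebra_simps)
  then show ?thesis by (simp add: sum.distrib 1 2)
qed

text \<open>
  The coefficients are carried by \<open>c\<close>, so that the same form can be taken for real vectors and for
  vectors of polynomials.
\<close>

definition clique_form :: "'v graph \<Rightarrow> ('v \<Rightarrow> 'a::comm_ring_1) \<Rightarrow> (real \<Rightarrow> 'a) \<Rightarrow> 'a" where
  "clique_form G x c = (\<Sum>i\<in>fst G. \<Sum>j\<in>fst G. c (closed_adjacency G i j) * x i * x j)"

abbreviation real_form :: "'v graph \<Rightarrow> ('v \<Rightarrow> real) \<Rightarrow> real" where
  "real_form G x \<equiv> clique_form G x (\<lambda>a. a)"

definition row :: "'v graph \<Rightarrow> ('v \<Rightarrow> real) \<Rightarrow> 'v \<Rightarrow> real" where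
  "row G x i = (\<Sum>j\<in>fst G. closed_adjacency G i j * x j)"

context
  fixes G :: "'v graph"
  assumes G: "simple_graph G"
begin

lemma real_form_add:
  "real_form G (\<lambda>i. x i + y i) = real_form G x + 2 * (\<Sum>i\<in>fst G. y i * row G x i) + real_form G y"
  unfolding clique_form_def row_def
  by (rule symmetric_form_add) (rule closed_adjacency_sym[OF G])

lemma real_form_eq_row: "real_form G x = (\<Sum>i\<in>fst G. x i * row G x i)"
  unfolding clique_form_def row_def sum_distrib_left by (intro sum.cong refl) (simp add: mult_ac)

text \<open>The form is linear in the direction \<open>e\<^sub>i - e\<^sub>j\<close> of an edge, as \<open>1 - 2 + 1 = 0\<close>.\<close>

lemma real_form_shift:
  assumes e: "{i, j} \<in> snd G"
  shows "real_form G (\<lambda>l. x l + (if l = i then s else if l = j then - s else 0))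
       = real_form G x + 2 * s * (row G x i - row G x j)"
proof -
  have ij: "i \<in> fst G" "j \<in> fst G" "i \<noteq> j" using edge_vertices[OF G e] by auto
  let ?b = "\<lambda>l. if l = i then s else if l = j then - s else 0"
  have pick: "(\<Sum>l\<in>fst G. ?b l * g l) = s * g i - s * g j" for g :: "'v \<Rightarrow> real"
  proof -
    have "(\<Sum>l\<in>fst G. ?b l * g l) = (\<Sum>l\<in>fst G. (if l = i then s * g i else 0) + (if l = j then - s * g j else 0))"
      using ij by (intro sum.cong) auto
    then show ?thesis using ij finite_vertices[OF G] by (simp add: sum.distrib)
  qed
  have row: "row G ?b k = s * closed_adjacency G k i - s * closed_adjacency G k j" for k
    using pick[of "closed_adjacency G k"] unfolding row_def by (simp add: mult.commute)
  have "closed_adjacency G i j = 1" "closed_adjacency G j i = 1"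
    using closed_adjacency_neq[OF G ij(3)] closed_adjacency_sym[OF G, of i j] e by auto
  then have "real_form G ?b = 0"
    unfolding real_form_eq_row pick using row G by simp
  then show ?thesis
    unfolding real_form_add pick by (simp add: algebra_simps)
qed

lemma row_stable:
  assumes S: "stable_set G S" and k: "k \<in> fst G"
  shows "row G (\<lambda>i. if i \<in> S then 1 else 0) k = (if k \<in> S then 1 else real (degree_into G S k))"
proof -
  have SV: "S \<subseteq> fst G" "finite S" using S stable_finite[OF G S] unfolding stable_set_def by auto
  have "row G (\<lambda>i. if i \<in> S then 1 else 0) k = (\<Sum>i\<in>S. closed_adjacency G k i)"
    unfolding row_def using SV finite_vertices[OF G]
    by (simp add: if_distrib[of "\<lambda>x. _ * x"] sum.If_cases Int_absorb1 cong: if_cong)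
  also have "\<dots> = (if k \<in> S then 1 else real (degree_into G S k))"
  proof (cases "k \<in> S")
    case True
    have "closed_adjacency G k i = (if i = k then 1 else 0)" if "i \<in> S" for i
      using S True that G unfolding stable_set_def by (auto simp: closed_adjacency_neq)
    then have "(\<Sum>i\<in>S. closed_adjacency G k i) = (\<Sum>i\<in>S. if i = k then 1 else 0)" by simp
    then show ?thesis using True SV by simp
  next
    case False
    then have "(\<Sum>i\<in>S. closed_adjacency G k i) = (\<Sum>i\<in>S. if {k, i} \<in> snd G then 1 else 0)"
      using G by (intro sum.cong refl closed_adjacency_neq) auto
    then show ?thesis using False SV by (simp add: degree_into_def sum.If_cases Int_def)
  qed
  finally show ?thesis .
qed

lemma real_form_stable_support:
  assumes S: "stable_set G S" and supp: "\<And>i. i \<in> fst G \<Longrightarrow> i \<notin> S \<Longrightarrow> x i = 0"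
  shows "real_form G x = (\<Sum>i\<in>S. (x i)\<^sup>2)"
proof -
  have SV: "S \<subseteq> fst G" "finite S" using S stable_finite[OF G S] unfolding stable_set_def by auto
  have "x i * row G x i = (if i \<in> S then (x i)\<^sup>2 else 0)" if i: "i \<in> fst G" for i
  proof (cases "i \<in> S")
    case True
    have "closed_adjacency G i j * x j = (if j = i then x i else 0)" if "j \<in> fst G" for j
    proof (cases "j = i")
      case False
      then have "closed_adjacency G i j = 0 \<or> x j = 0"
        using S True that supp[of j] closed_adjacency_neq[OF G, of i j] unfolding stable_set_def by metis
      then show ?thesis using False by auto
    qed (simp add: closed_adjacency_refl[OF G])
    then have "row G x i = (\<Sum>j\<in>fst G. if j = i then x i else 0)"
      unfolding row_def by (rule sum.cong[OF refl])
    then have "row G x i = x i" using i finite_vertices[OF G] by simp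
    then show ?thesis using True by (simp add: power2_eq_square)
  qed (use supp i in auto)
  then have "real_form G x = (\<Sum>i\<in>fst G. if i \<in> S then (x i)\<^sup>2 else 0)"
    unfolding real_form_eq_row by (rule sum.cong[OF refl])
  then show ?thesis using SV finite_vertices[OF G] by (simp add: sum.If_cases Int_absorb1)
qed

text \<open>
  Moving weight along an edge of the support, in the direction in which the linear function does not
  increase, empties one vertex. This ends at a stable support, where the form is \<open>\<Sum> x\<^sub>i\<^sup>2\<close> and the
  Cauchy-Schwarz inequality applies.
\<close>

lemma shift_along_edge:
  assumes nonneg: "\<And>i. i \<in> fst G \<Longrightarrow> 0 \<le> x i"
    and unstable: "\<not> stable_set G {i \<in> fst G. x i \<noteq> 0}"
  obtains i j where "{i, j} \<in> snd G" "0 < x i" "0 < x j" "row G x i \<le> row G x j"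
proof -
  obtain i j where ij: "i \<in> fst G" "j \<in> fst G" "x i \<noteq> 0" "x j \<noteq> 0" "{i, j} \<in> snd G"
    using unstable unfolding stable_set_def by auto
  then have "0 < x i" "0 < x j" using nonneg[of i] nonneg[of j] by auto
  moreover have "{j, i} \<in> snd G" using ij(5) by (simp add: insert_commute)
  ultimately show ?thesis
    using that[of i j] that[of j i] ij(5) by (cases "row G x i \<le> row G x j") simp_all
qed

lemma shift_props:
  fixes x :: "'v \<Rightarrow> real"
  assumes nonneg: "\<And>i. i \<in> fst G \<Longrightarrow> 0 \<le> x i"
    and e: "{i, j} \<in> snd G" "0 < x i" "0 < x j"
  defines "y \<equiv> \<lambda>l. x l + (if l = i then x j else if l = j then - x j else 0)"
  shows "\<And>l. l \<in> fst G \<Longrightarrow> 0 \<le> y l" "(\<Sum>l\<in>fst G. y l) = (\<Sum>l\<in>fst G. x l)"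
    "card {l \<in> fst G. y l \<noteq> 0} < card {l \<in> fst G. x l \<noteq> 0}" "0 < y i" "y j = 0"
proof -
  have ij: "i \<in> fst G" "j \<in> fst G" "i \<noteq> j" using edge_vertices[OF G e(1)] by auto
  have yi: "y i = x i + x j" and yj: "y j = 0" and yl: "\<And>l. l \<noteq> i \<Longrightarrow> l \<noteq> j \<Longrightarrow> y l = x l"
    using ij(3) by (auto simp: y_def)
  show "0 < y i" "y j = 0" using e yi yj by auto
  show "0 \<le> y l" if "l \<in> fst G" for l
    using nonneg[OF that] e yi yj yl[of l] by (cases "l = i"; cases "l = j") auto
  have "(\<Sum>l\<in>fst G. y l) = (\<Sum>l\<in>fst G. x l + ((if l = i then x j else 0) + (if l = j then - x j else 0)))"
    using ij(3) unfolding y_def by (intro sum.cong refl) simp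
  then show "(\<Sum>l\<in>fst G. y l) = (\<Sum>l\<in>fst G. x l)"
    using ij finite_vertices[OF G] by (simp add: sum.distrib)
  show "card {l \<in> fst G. y l \<noteq> 0} < card {l \<in> fst G. x l \<noteq> 0}"
  proof (rule psubset_card_mono)
    show "finite {l \<in> fst G. x l \<noteq> 0}" using finite_vertices[OF G] by simp
    have "x l \<noteq> 0" if "y l \<noteq> 0" for l
      using that e yj yl[of l] by (cases "l = i"; cases "l = j") auto
    moreover have "j \<in> {l \<in> fst G. x l \<noteq> 0}" "j \<notin> {l \<in> fst G. y l \<noteq> 0}" using ij e yj by auto
    ultimately show "{l \<in> fst G. y l \<noteq> 0} \<subset> {l \<in> fst G. x l \<noteq> 0}" by blast
  qed
qed

theorem Motzkin_Straus:
  assumes "\<And>i. i \<in> fst G \<Longrightarrow> 0 \<le> x i"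
  shows "(\<Sum>i\<in>fst G. x i)\<^sup>2 \<le> real (stability_number G) * real_form G x"
  using assms
proof (induction "card {i \<in> fst G. x i \<noteq> 0}" arbitrary: x rule: less_induct)
  case less
  let ?S = "{i \<in> fst G. x i \<noteq> 0}"
  show ?case
  proof (cases "stable_set G ?S")
    case True
    have "(\<Sum>i\<in>fst G. x i) = (\<Sum>i\<in>?S. x i)"
      using finite_vertices[OF G] by (intro sum.mono_neutral_right) auto
    then have "(\<Sum>i\<in>fst G. x i)\<^sup>2 \<le> (\<Sum>i\<in>?S. (x i)\<^sup>2) * (\<Sum>i\<in>?S. 1\<^sup>2)"
      using Cauchy_Schwarz_ineq_sum[of x "\<lambda>i. 1" ?S] by simp
    also have "\<dots> \<le> (\<Sum>i\<in>?S. (x i)\<^sup>2) * real (stability_number G)"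
      using stable_card_le[OF G True] by (intro mult_left_mono sum_nonneg) auto
    also have "(\<Sum>i\<in>?S. (x i)\<^sup>2) = real_form G x"
      by (rule real_form_stable_support[OF True, symmetric]) auto
    finally show ?thesis by (simp add: mult.commute)
  next
    case False
    obtain i j where e: "{i, j} \<in> snd G" "0 < x i" "0 < x j" "row G x i \<le> row G x j"
      using shift_along_edge[OF less.prems False] by blast
    let ?y = "\<lambda>l. x l + (if l = i then x j else if l = j then - x j else 0)"
    note y = shift_props[OF less.prems e(1-3)]
    have "(\<Sum>l\<in>fst G. ?y l)\<^sup>2 \<le> real (stability_number G) * real_form G ?y"
      by (rule less.hyps) (use y in auto)
    moreover have "real_form G ?y \<le> real_form G x"
      unfolding real_form_shift[OF e(1)] using e by (simp add: mult_le_0_iff)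
    then have "real (stability_number G) * real_form G ?y \<le> real (stability_number G) * real_form G x"
      by (intro mult_left_mono) auto
    ultimately show ?thesis using y(2) by simp
  qed
qed

text \<open>
  The same shifts, read backwards from the indicator vector of a maximum stable set: putting weight
  on a further vertex \<open>j\<close>, taken from a neighbour in the set, increases the form, with a slope proportional
  to the number of neighbours of \<open>j\<close> in the set minus one.
\<close>

lemma Motzkin_Straus_equality:
  assumes two: "\<And>S k. maximum_stable_set G S \<Longrightarrow> k \<in> fst G \<Longrightarrow> k \<notin> S \<Longrightarrow> 2 \<le> degree_into G S k"
    and "\<And>i. i \<in> fst G \<Longrightarrow> 0 \<le> x i"
    and "(\<Sum>i\<in>fst G. x i) = real (stability_number G)" "real_form G x = real (stability_number G)"
  shows "\<exists>S. maximum_stable_set G S \<and> (\<forall>i\<in>fst G. x i = (if i \<in> S then 1 else 0))"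
  using assms(2-)
proof (induction "card {i \<in> fst G. x i \<noteq> 0}" arbitrary: x rule: less_induct)
  case less
  let ?S = "{i \<in> fst G. x i \<noteq> 0}" and ?a = "real (stability_number G)"
  show ?case
  proof (cases "stable_set G ?S")
    case True
    have fin: "finite ?S" using finite_vertices[OF G] by simp
    have sum: "(\<Sum>i\<in>?S. x i) = ?a"
      unfolding less.prems(2)[symmetric] using finite_vertices[OF G] by (intro sum.mono_neutral_left) auto
    have sq: "(\<Sum>i\<in>?S. (x i)\<^sup>2) = ?a"
      using real_form_stable_support[OF True, of x] less.prems(3) by auto
    have "(\<Sum>i\<in>?S. (x i - 1)\<^sup>2) = ?a - 2 * ?a + real (card ?S)"
      by (simp add: power2_diff sum.distrib sum_subtractf sum sq flip: sum_distrib_left)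
    moreover have "0 \<le> (\<Sum>i\<in>?S. (x i - 1)\<^sup>2)" by (simp add: sum_nonneg)
    moreover have "card ?S \<le> stability_number G" by (rule stable_card_le[OF G True])
    ultimately have 0: "(\<Sum>i\<in>?S. (x i - 1)\<^sup>2) = 0" and c: "card ?S = stability_number G" by simp_all
    have "\<forall>i\<in>?S. x i = 1" using 0 fin by (simp add: sum_nonneg_eq_0_iff)
    then show ?thesis using True c unfolding maximum_stable_set_def by (intro exI[of _ ?S]) auto
  next
    case False
    obtain i j where e: "{i, j} \<in> snd G" "0 < x i" "0 < x j" "row G x i \<le> row G x j"
      using shift_along_edge[OF less.prems(1) False] by blast
    define y where "y = (\<lambda>l. x l + (if l = i then x j else if l = j then - x j else 0))"
    have ij: "i \<in> fst G" "j \<in> fst G" "i \<noteq> j" using edge_vertices[OF G e(1)] by auto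
    have y: "\<And>l. l \<in> fst G \<Longrightarrow> 0 \<le> y l" "(\<Sum>l\<in>fst G. y l) = (\<Sum>l\<in>fst G. x l)"
      "card {l \<in> fst G. y l \<noteq> 0} < card {l \<in> fst G. x l \<noteq> 0}" "0 < y i" "y j = 0"
      unfolding y_def using shift_props[OF less.prems(1) e(1-3)] by blast+
    have "real_form G y \<le> ?a"
      unfolding y_def real_form_shift[OF e(1)] using e less.prems(3) by (simp add: mult_le_0_iff)
    moreover have "?a\<^sup>2 \<le> ?a * real_form G y" using Motzkin_Straus[of y] y(1,2) less.prems(2) by simp
    then have "?a \<le> real_form G y"
      using stability_number_pos[OF G] ij(1) unfolding power2_eq_square
      by (subst (asm) mult_le_cancel_left_pos) auto
    ultimately have qy: "real_form G y = ?a" by simp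
    have "\<exists>S. maximum_stable_set G S \<and> (\<forall>l\<in>fst G. y l = (if l \<in> S then 1 else 0))"
      by (rule less.hyps) (use y less.prems(2) qy in auto)
    then obtain S where S: "maximum_stable_set G S" "\<forall>l\<in>fst G. y l = (if l \<in> S then 1 else 0)" by blast
    have iS: "i \<in> S" using S(2)[rule_format, OF ij(1)] y(4) by (auto split: if_splits)
    have jS: "j \<notin> S" using S(2)[rule_format, OF ij(2)] y(5) by (auto split: if_splits)
    \<comment> \<open>Going back from the vertex \<open>y\<close> to \<open>x\<close> the form increases, as \<open>j\<close> has two neighbours in \<open>S\<close>.\<close>
    have "row G y k = row G (\<lambda>i. if i \<in> S then 1 else 0) k" for k
      unfolding row_def using S(2) by (intro sum.cong) auto
    then have rows: "row G y i = 1" "row G y j = real (degree_into G S j)"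
      using row_stable S(1) ij iS jS unfolding maximum_stable_set_def by auto
    have "x = (\<lambda>l. y l + (if l = i then - x j else if l = j then - (- x j) else 0))"
      using ij by (auto simp: y_def)
    then have "real_form G x = real_form G y + 2 * (- x j) * (row G y i - row G y j)"
      using real_form_shift[OF e(1), of y "- x j"] by simp
    then have "2 * (- x j) * (1 - real (degree_into G S j)) = 0"
      using qy less.prems(3) rows by simp
    moreover have "2 \<le> degree_into G S j" by (rule two[OF S(1) ij(2) jS])
    ultimately show ?thesis using e(3) by simp
  qed
qed

end

section \<open>Contracting twins\<close>

lemma contract_edge_twin_edges:
  assumes G: "simple_graph G" and tw: "twin_pair G i j" and uv: "u \<noteq> i" "v \<noteq> i"
  shows "{u, v} \<in> snd (contract_edge G i j) \<longleftrightarrow> {u, v} \<in> snd G"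
proof
  let ?f = "\<lambda>v. if v = i then j else v"
  assume "{u, v} \<in> snd G"
  moreover have "{u, v} = ?f ` {u, v}" "{u, v} \<noteq> {i, j}" using uv by auto
  ultimately show "{u, v} \<in> snd (contract_edge G i j)"
    unfolding contract_edge_def snd_conv by (intro image_eqI[where x = "{u, v}"]) auto
next
  let ?f = "\<lambda>v. if v = i then j else v"
  assume "{u, v} \<in> snd (contract_edge G i j)"
  then obtain e where e: "e \<in> snd G" "e \<noteq> {i, j}" "{u, v} = ?f ` e"
    unfolding contract_edge_def by auto
  obtain a b where ab: "e = {a, b}" "a \<noteq> b" using edgeE[OF G e(1)] by metis
  have moved: "{j, b} \<in> snd G" if "{i, b} \<in> snd G" "b \<noteq> j" for b
  proof -
    have "b \<in> neighbours G i - {j}" using that by (simp add: neighbours_def insert_commute)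
    then have "b \<in> neighbours G j" using tw unfolding twin_pair_def by blast
    then show ?thesis by (simp add: neighbours_def insert_commute)
  qed
  show "{u, v} \<in> snd G"
  proof (cases "i \<in> e")
    case False
    then have "?f ` e = e" by (auto simp: image_iff)
    then show ?thesis using e by simp
  next
    case True
    then obtain c where c: "e = {i, c}" "c \<noteq> i" using ab by (metis insertE insert_commute singletonD)
    then have "c \<noteq> j" using e(2) by blast
    then have "{j, c} \<in> snd G" using moved[of c] e(1) c by simp
    moreover have "?f ` e = {j, c}" using c by auto
    ultimately show ?thesis using e(3) by simp
  qed
qed

text \<open>
  Contraction of twins amounts to passing to an induced subgraph \<open>H\<close> onto which the vertices retract
  in such a way that \<open>A + I\<close> is pulled back: twins have equal rows in \<open>A + I\<close>.
\<close>

lemma twin_contraction_retract: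
  assumes "contract_twin_step\<^sup>*\<^sup>* G H" "simple_graph G"
  shows "simple_graph H \<and> fst H \<subseteq> fst G \<and> (\<exists>\<rho>. (\<forall>v\<in>fst G. \<rho> v \<in> fst H) \<and> (\<forall>v\<in>fst H. \<rho> v = v) \<and>
    (\<forall>u\<in>fst G. \<forall>v\<in>fst G. closed_adjacency G u v = closed_adjacency H (\<rho> u) (\<rho> v)))"
  using assms
proof (induction rule: rtranclp_induct)
  case base
  then show ?case by (auto intro!: exI[of _ "\<lambda>v. v"])
next
  case (step H K)
  obtain i j where tw: "twin_pair H i j" and K: "K = contract_edge H i j"
    using step.hyps(2) unfolding contract_twin_step_def by blast
  have H: "simple_graph H" using step.IH step.prems by blast
  have sK: "simple_graph K" unfolding K by (rule simple_graph_contract_edge[OF H tw])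
  obtain \<rho> where sub: "fst H \<subseteq> fst G" and \<rho>: "\<forall>v\<in>fst G. \<rho> v \<in> fst H" "\<forall>v\<in>fst H. \<rho> v = v"
    "\<forall>u\<in>fst G. \<forall>v\<in>fst G. closed_adjacency G u v = closed_adjacency H (\<rho> u) (\<rho> v)"
    using step.IH step.prems by blast
  have eij: "{i, j} \<in> snd H" using tw unfolding twin_pair_def by blast
  have ij: "i \<in> fst H" "j \<in> fst H" "i \<noteq> j" using edge_vertices[OF H eij] by auto
  have fK: "fst K = fst H - {i}" unfolding K contract_edge_def by simp
  define f where "f v = (if v = i then j else v)" for v
  have same: "closed_adjacency H u v = closed_adjacency K u v" if "u \<noteq> i" "v \<noteq> i" for u v
    using contract_edge_twin_edges[OF H tw that]
    unfolding K closed_adjacency_def adjacency_matrix_def by simp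
  have row: "closed_adjacency H i v = closed_adjacency H j v" for v
  proof -
    consider "v = i" | "v = j" | "v \<noteq> i" "v \<noteq> j" by blast
    then show ?thesis
    proof cases
      case 3
      have "v \<in> neighbours H i - {j} \<longleftrightarrow> v \<in> neighbours H j - {i}"
        using tw unfolding twin_pair_def by simp
      then have "{i, v} \<in> snd H \<longleftrightarrow> {j, v} \<in> snd H"
        using 3 unfolding neighbours_def by (simp add: insert_commute)
      then show ?thesis
        using 3 closed_adjacency_neq[OF H, of i v] closed_adjacency_neq[OF H, of j v] by simp
    next
      case 1
      then show ?thesis
        using eij ij(3) closed_adjacency_neq[OF H, of j i] closed_adjacency_refl[OF H, of i]
        by (simp add: insert_commute)
    next
      case 2
      then show ?thesis
        using eij ij(3) closed_adjacency_neq[OF H, of i j] closed_adjacency_refl[OF H, of j] by simp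
    qed
  qed
  have frow: "closed_adjacency H u v = closed_adjacency H (f u) v" for u v
    using row by (simp add: f_def)
  have "closed_adjacency H u v = closed_adjacency K (f u) (f v)" for u v
  proof -
    have "closed_adjacency H u v = closed_adjacency H (f u) (f v)"
      using frow closed_adjacency_sym[OF H] by metis
    also have "\<dots> = closed_adjacency K (f u) (f v)"
      using ij by (intro same) (auto simp: f_def)
    finally show ?thesis .
  qed
  then have "(\<forall>v\<in>fst G. (f \<circ> \<rho>) v \<in> fst K) \<and> (\<forall>v\<in>fst K. (f \<circ> \<rho>) v = v) \<and>
    (\<forall>u\<in>fst G. \<forall>v\<in>fst G. closed_adjacency G u v = closed_adjacency K ((f \<circ> \<rho>) u) ((f \<circ> \<rho>) v))"
    using \<rho> ij fK by (auto simp: f_def)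
  then show ?case using sK sub fK by blast
qed

text \<open>
  Since the matrix is constant on the fibres of the retraction, the form depends only on the fibre
  sums. This holds for real vectors and for the variables themselves.
\<close>

lemma clique_form_retract:
  fixes x :: "'v \<Rightarrow> 'b::comm_ring_1"
  assumes fin: "finite (fst G)" "finite (fst H)" and \<rho>: "\<And>v. v \<in> fst G \<Longrightarrow> \<rho> v \<in> fst H"
    and adj: "\<And>u v. u \<in> fst G \<Longrightarrow> v \<in> fst G \<Longrightarrow> closed_adjacency G u v = closed_adjacency H (\<rho> u) (\<rho> v)"
  shows "clique_form G x c = clique_form H (\<lambda>h. \<Sum>v | v \<in> fst G \<and> \<rho> v = h. x v) c"
proof -
  let ?m = "\<lambda>a b. c (closed_adjacency H a b)"
  have group: "(\<Sum>h\<in>fst H. \<Sum>v | v \<in> fst G \<and> \<rho> v = h. g v) = (\<Sum>v\<in>fst G. g v)"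
    for g :: "'v \<Rightarrow> 'b"
    using sum.group[OF fin, of \<rho> g] \<rho> by auto
  have "clique_form H (\<lambda>h. \<Sum>v | v \<in> fst G \<and> \<rho> v = h. x v) c
      = (\<Sum>a\<in>fst H. \<Sum>b\<in>fst H. \<Sum>u | u \<in> fst G \<and> \<rho> u = a. \<Sum>v | v \<in> fst G \<and> \<rho> v = b. ?m a b * x u * x v)"
    unfolding clique_form_def
    by (intro sum.cong refl) (simp only: sum_distrib_left[of "c _"] sum_product)
  also have "\<dots> = (\<Sum>a\<in>fst H. \<Sum>u | u \<in> fst G \<and> \<rho> u = a. \<Sum>b\<in>fst H. \<Sum>v | v \<in> fst G \<and> \<rho> v = b.
      ?m (\<rho> u) (\<rho> v) * x u * x v)"
  proof (intro sum.cong refl)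
    fix a
    have "(\<Sum>b\<in>fst H. \<Sum>u | u \<in> fst G \<and> \<rho> u = a. \<Sum>v | v \<in> fst G \<and> \<rho> v = b. ?m a b * x u * x v)
        = (\<Sum>u | u \<in> fst G \<and> \<rho> u = a. \<Sum>b\<in>fst H. \<Sum>v | v \<in> fst G \<and> \<rho> v = b. ?m a b * x u * x v)"
      by (rule sum.swap)
    also have "\<dots> = (\<Sum>u | u \<in> fst G \<and> \<rho> u = a. \<Sum>b\<in>fst H. \<Sum>v | v \<in> fst G \<and> \<rho> v = b.
        ?m (\<rho> u) (\<rho> v) * x u * x v)"
      by (intro sum.cong refl) auto
    finally show "(\<Sum>b\<in>fst H. \<Sum>u | u \<in> fst G \<and> \<rho> u = a. \<Sum>v | v \<in> fst G \<and> \<rho> v = b. ?m a b * x u * x v)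
        = (\<Sum>u | u \<in> fst G \<and> \<rho> u = a. \<Sum>b\<in>fst H. \<Sum>v | v \<in> fst G \<and> \<rho> v = b.
        ?m (\<rho> u) (\<rho> v) * x u * x v)" .
  qed
  also have "\<dots> = (\<Sum>u\<in>fst G. \<Sum>v\<in>fst G. ?m (\<rho> u) (\<rho> v) * x u * x v)"
    by (simp only: group)
  also have "\<dots> = clique_form G x c"
    unfolding clique_form_def using adj by (intro sum.cong refl) simp
  finally show ?thesis by simp
qed

section \<open>A partition of unity at the vertices of the cube\<close>

text \<open>
  Hermite interpolation: the polynomial of degree \<open>5\<close> that has a triple zero at \<open>0\<close> and takes the
  value \<open>1\<close> to third order at \<open>1\<close>. Order three is what is needed for products of different bumps to
  vanish to third order at the vertices, so that they do not affect Hessians.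
\<close>

definition smoothstep :: "'a::comm_ring_1 \<Rightarrow> 'a" where
  "smoothstep p = p ^ 3 * (10 - 15 * p + 6 * p\<^sup>2)"

lemma one_minus_smoothstep: "1 - smoothstep p = (1 - p) ^ 3 * (1 + 3 * p + 6 * p\<^sup>2)"
  by (simp add: smoothstep_def power2_eq_square power3_eq_cube algebra_simps)

lemma smoothstep_0_1 [simp]: "smoothstep 0 = 0" "smoothstep 1 = 1"
  by (simp_all add: smoothstep_def)

text \<open>It is \<open>1\<close> at the vertex \<open>S\<close> of the cube \<open>{0, 1}\<^sup>W\<close> and \<open>0\<close> at the other vertices.\<close>

definition vertex_bump :: "'h set \<Rightarrow> ('h \<Rightarrow> 'a::comm_ring_1) \<Rightarrow> 'h set \<Rightarrow> 'a" where
  "vertex_bump W X S = (\<Prod>i\<in>S. smoothstep (X i)) * (\<Prod>i\<in>W - S. 1 - smoothstep (X i))"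

definition vertex_coordinate :: "('h \<Rightarrow> 'a::comm_ring_1) \<Rightarrow> 'h set \<Rightarrow> 'h \<Rightarrow> 'a" where
  "vertex_coordinate X S i = X i - (if i \<in> S then 1 else 0)"

text \<open>The cofactor of \<open>X\<^sub>i (X\<^sub>i - 1)\<close> in the product of the bump with the \<open>i\<close>-th local coordinate.\<close>

definition bump_cofactor :: "'h set \<Rightarrow> ('h \<Rightarrow> 'a::comm_ring_1) \<Rightarrow> 'h set \<Rightarrow> 'h \<Rightarrow> 'a" where
  "bump_cofactor W X S i = (if i \<in> S
     then (X i)\<^sup>2 * (10 - 15 * X i + 6 * (X i)\<^sup>2) * ((\<Prod>j\<in>S - {i}. smoothstep (X j)) * (\<Prod>j\<in>W - S. 1 - smoothstep (X j)))
     else - ((1 - X i)\<^sup>2 * (1 + 3 * X i + 6 * (X i)\<^sup>2) * ((\<Prod>j\<in>S. smoothstep (X j)) * (\<Prod>j\<in>W - S - {i}. 1 - smoothstep (X j)))))"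

lemma eval_smoothstep [simp]: "eval_poly (smoothstep p) x = smoothstep (eval_poly p x)"
  by (simp add: smoothstep_def)

lemma eval_vertex_bump [simp]:
  "eval_poly (vertex_bump W X S) x = vertex_bump W (\<lambda>i. eval_poly (X i) x) S"
  by (simp add: vertex_bump_def)

lemma eval_bump_cofactor [simp]:
  "eval_poly (bump_cofactor W X S i) x = bump_cofactor W (\<lambda>i. eval_poly (X i) x) S i"
  by (simp add: bump_cofactor_def)

context
  fixes W :: "'h set" and X :: "'h \<Rightarrow> 'a::comm_ring_1"
  assumes W: "finite W"
begin

lemma sum_vertex_bumps: "(\<Sum>S\<in>Pow W. vertex_bump W X S) = 1"
  using prod_add[OF W, of "\<lambda>i. smoothstep (X i)" "\<lambda>i. 1 - smoothstep (X i)"]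
  by (simp add: vertex_bump_def)

lemma vertex_bump_coordinate:
  assumes "S \<subseteq> W" "i \<in> W"
  shows "vertex_bump W X S * vertex_coordinate X S i = X i * (X i - 1) * bump_cofactor W X S i"
proof (cases "i \<in> S")
  case True
  have "(\<Prod>j\<in>S. smoothstep (X j)) = smoothstep (X i) * (\<Prod>j\<in>S - {i}. smoothstep (X j))"
    using True assms W by (intro prod.remove) (auto intro: finite_subset)
  then show ?thesis
    using True by (simp add: vertex_bump_def vertex_coordinate_def bump_cofactor_def smoothstep_def
        power2_eq_square power3_eq_cube mult_ac)
next
  case False
  have "(\<Prod>j\<in>W - S. 1 - smoothstep (X j))
      = (1 - smoothstep (X i)) * (\<Prod>j\<in>W - S - {i}. 1 - smoothstep (X j))"
    using False assms W by (intro prod.remove) auto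
  then have "vertex_bump W X S * vertex_coordinate X S i
      = ((1 - X i) ^ 3 * X i) * ((1 + 3 * X i + 6 * (X i)\<^sup>2) * ((\<Prod>j\<in>S. smoothstep (X j)) * (\<Prod>j\<in>W - S - {i}. 1 - smoothstep (X j))))"
    using False by (simp add: vertex_bump_def vertex_coordinate_def one_minus_smoothstep mult_ac)
  also have "(1 - X i) ^ 3 * X i = X i * (X i - 1) * (- ((1 - X i)\<^sup>2))"
    by (simp add: power2_eq_square power3_eq_cube algebra_simps)
  finally show ?thesis using False by (simp add: bump_cofactor_def mult_ac)
qed

text \<open>
  Modulo this ideal the bumps are orthogonal idempotents. Its elements have the form \<open>\<Sum> f\<^sub>i\<^sup>2 g\<^sub>i\<close> with
  \<open>f\<^sub>i = X\<^sub>i (X\<^sub>i - 1)\<close> and \<open>g\<^sub>i\<close> vanishing at the vertices of the cube.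
\<close>

definition cube_ideal :: "'a set" where
  "cube_ideal = {\<Sum>i\<in>W. (X i * (X i - 1)) ^ 3 * h i | h. True}"

lemma cube_ideal_0: "0 \<in> cube_ideal"
  unfolding cube_ideal_def by (intro CollectI exI[of _ "\<lambda>i. 0"]) simp

lemma cube_ideal_add: "a \<in> cube_ideal \<Longrightarrow> b \<in> cube_ideal \<Longrightarrow> a + b \<in> cube_ideal"
proof -
  assume "a \<in> cube_ideal" "b \<in> cube_ideal"
  then obtain g h where "a = (\<Sum>i\<in>W. (X i * (X i - 1)) ^ 3 * g i)" "b = (\<Sum>i\<in>W. (X i * (X i - 1)) ^ 3 * h i)"
    unfolding cube_ideal_def by blast
  then have "a + b = (\<Sum>i\<in>W. (X i * (X i - 1)) ^ 3 * (g i + h i))"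
    by (simp add: distrib_left sum.distrib)
  then show ?thesis unfolding cube_ideal_def by (intro CollectI exI[of _ "\<lambda>i. g i + h i"]) simp
qed

lemma cube_ideal_mult: "a \<in> cube_ideal \<Longrightarrow> a * b \<in> cube_ideal"
proof -
  assume "a \<in> cube_ideal"
  then obtain g where "a = (\<Sum>i\<in>W. (X i * (X i - 1)) ^ 3 * g i)"
    unfolding cube_ideal_def by blast
  then have "a * b = (\<Sum>i\<in>W. (X i * (X i - 1)) ^ 3 * (g i * b))"
    by (simp add: sum_distrib_right mult.assoc)
  then show ?thesis unfolding cube_ideal_def by (intro CollectI exI[of _ "\<lambda>i. g i * b"]) simp
qed

lemma cube_ideal_minus: "a \<in> cube_ideal \<Longrightarrow> - a \<in> cube_ideal"
  using cube_ideal_mult[of a "-1"] by simp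

lemma cube_ideal_sum: "(\<And>i. i \<in> A \<Longrightarrow> g i \<in> cube_ideal) \<Longrightarrow> (\<Sum>i\<in>A. g i) \<in> cube_ideal"
  by (induction A rule: infinite_finite_induct) (auto intro: cube_ideal_0 cube_ideal_add)

lemma cube_ideal_generator: "i \<in> W \<Longrightarrow> (X i * (X i - 1)) ^ 3 * b \<in> cube_ideal"
  unfolding cube_ideal_def using W
  by (intro CollectI exI[of _ "\<lambda>j. if j = i then b else 0"])
    (simp add: if_distrib[of "\<lambda>x. _ * x"] cong: if_cong)

lemma vertex_bump_orthogonal:
  assumes S: "S \<subseteq> W" and T: "T \<subseteq> W" and ne: "S \<noteq> T"
  shows "vertex_bump W X S * vertex_bump W X T \<in> cube_ideal"
proof -
  have key: "vertex_bump W X S * vertex_bump W X T \<in> cube_ideal"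
    if S: "S \<subseteq> W" and i: "i \<in> S" "i \<notin> T" for S T i
  proof -
    have iW: "i \<in> W" using S i by blast
    have "(\<Prod>j\<in>S. smoothstep (X j)) = smoothstep (X i) * (\<Prod>j\<in>S - {i}. smoothstep (X j))"
      using S i W by (intro prod.remove) (auto intro: finite_subset)
    moreover have "(\<Prod>j\<in>W - T. 1 - smoothstep (X j))
        = (1 - smoothstep (X i)) * (\<Prod>j\<in>W - T - {i}. 1 - smoothstep (X j))"
      using iW i W by (intro prod.remove) auto
    ultimately have "vertex_bump W X S * vertex_bump W X T
        = (smoothstep (X i) * (1 - smoothstep (X i))) *
          ((\<Prod>j\<in>S - {i}. smoothstep (X j)) * (\<Prod>j\<in>W - S. 1 - smoothstep (X j)) *
           ((\<Prod>j\<in>T. smoothstep (X j)) * (\<Prod>j\<in>W - T - {i}. 1 - smoothstep (X j))))"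
      by (simp add: vertex_bump_def mult_ac)
    moreover have "smoothstep (X i) * (1 - smoothstep (X i))
        = (X i * (X i - 1)) ^ 3 * (- ((10 - 15 * X i + 6 * (X i)\<^sup>2) * (1 + 3 * X i + 6 * (X i)\<^sup>2)))"
    proof -
      have "(1 - X i) ^ 3 = - ((X i - 1) ^ 3)" by (simp add: power3_eq_cube algebra_simps)
      then show ?thesis unfolding one_minus_smoothstep
        by (simp add: smoothstep_def power_mult_distrib mult_ac)
    qed
    ultimately show ?thesis using cube_ideal_generator[OF iW] by (simp add: mult.assoc cube_ideal_minus)
  qed
  have "(\<exists>i. i \<in> S \<and> i \<notin> T) \<or> (\<exists>i. i \<in> T \<and> i \<notin> S)" using ne by blast
  then show ?thesis
  proof
    assume "\<exists>i. i \<in> S \<and> i \<notin> T"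
    then show ?thesis using key[OF S] by blast
  next
    assume "\<exists>i. i \<in> T \<and> i \<notin> S"
    then have "vertex_bump W X T * vertex_bump W X S \<in> cube_ideal" using key[OF T] by blast
    then show ?thesis by (simp add: mult.commute)
  qed
qed

lemma vertex_bump_at_vertex:
  assumes "S \<subseteq> W" "T \<subseteq> W" "\<And>i. i \<in> W \<Longrightarrow> X i = (if i \<in> T then 1 else 0)"
  shows "vertex_bump W X S = (if S = T then 1 else 0)"
proof (cases "S = T")
  case True
  have "smoothstep (X i) = 1" if "i \<in> S" for i using that True assms by auto
  moreover have "1 - smoothstep (X i) = 1" if "i \<in> W - S" for i using that True assms by auto
  ultimately show ?thesis using True by (simp add: vertex_bump_def)
next
  case False
  then obtain i where i: "i \<in> S - T \<or> i \<in> T - S" by blast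
  then show ?thesis
  proof
    assume i: "i \<in> S - T"
    then have "smoothstep (X i) = 0" using assms by auto
    then have "(\<Prod>i\<in>S. smoothstep (X i)) = 0"
      using i assms(1) W by (intro prod_zero) (auto intro: finite_subset)
    then show ?thesis using False by (simp add: vertex_bump_def)
  next
    assume i: "i \<in> T - S"
    then have "1 - smoothstep (X i) = 0" using assms by auto
    then have "(\<Prod>i\<in>W - S. 1 - smoothstep (X i)) = 0"
      using i assms(2) W by (intro prod_zero) auto
    then show ?thesis using False by (simp add: vertex_bump_def)
  qed
qed

lemma bump_cofactor_at_vertex:
  assumes S: "S \<subseteq> W" and T: "T \<subseteq> W" and X: "\<And>i. i \<in> W \<Longrightarrow> X i = (if i \<in> T then 1 else 0)"
    and i: "i \<in> W"
  shows "bump_cofactor W X S i = (if S = T then (if i \<in> S then 1 else -1) else 0)"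
proof (cases "S = T")
  case True
  have "smoothstep (X j) = 1" if "j \<in> S" for j using that True X T by auto
  moreover have "1 - smoothstep (X j) = 1" if "j \<in> W - S" for j using that True X by auto
  ultimately show ?thesis using True X[OF i] by (simp add: bump_cofactor_def)
next
  case False
  then obtain l where l: "l \<in> S - T \<or> l \<in> T - S" by blast
  have "bump_cofactor W X S i = 0"
  proof (cases "l = i")
    case True
    then show ?thesis using l X[OF i] by (auto simp: bump_cofactor_def)
  next
    case False
    from l show ?thesis
    proof
      assume l: "l \<in> S - T"
      then have "smoothstep (X l) = 0" using X S by auto
      then have "(\<Prod>j\<in>S. smoothstep (X j)) = 0" "(\<Prod>j\<in>S - {i}. smoothstep (X j)) = 0"
        using l False S W by (auto intro!: prod_zero intro: finite_subset)
      then show ?thesis by (simp add: bump_cofactor_def)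
    next
      assume l: "l \<in> T - S"
      then have "1 - smoothstep (X l) = 0" using X T by auto
      then have "(\<Prod>j\<in>W - S. 1 - smoothstep (X j)) = 0" "(\<Prod>j\<in>W - S - {i}. 1 - smoothstep (X j)) = 0"
        using l False T W by (auto intro!: prod_zero)
      then show ?thesis by (simp add: bump_cofactor_def)
    qed
  qed
  then show ?thesis using False by simp
qed

end

section \<open>Graphs without critical edges: a certificate\<close>

text \<open>
  The variables are scaled so that the minimisers are \<open>0/1\<close>-vectors. Where the variables add up to \<open>\<alpha>\<close>
  this is the form minus its minimum \<open>\<alpha>\<close>. The multiple of the sum makes the partial derivatives in the
  directions of the support vanish at the minimisers.
\<close>

definition gap_form :: "'h graph \<Rightarrow> ('h \<Rightarrow> 'v rpoly) \<Rightarrow> 'v rpoly" where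
  "gap_form H X = clique_form H X Const - 2 * (\<Sum>i\<in>fst H. X i) + Const (real (stability_number H))"

text \<open>The slope of the gap form at the vertex \<open>S\<close> in the direction of \<open>k \<notin> S\<close>.\<close>

definition local_weight :: "'h graph \<Rightarrow> 'h set \<Rightarrow> 'h \<Rightarrow> real" where
  "local_weight H S k = 2 * (real (degree_into H S k) - 1)"

text \<open>
  The factor \<open>(1 - C X\<^sub>k)\<^sup>2\<close> has the value \<open>1\<close> and the slope \<open>- 2 C\<close> where \<open>X\<^sub>k = 0\<close>. Subtracting the linear
  part therefore adds \<open>2 C X\<^sub>k\<^sup>2\<close> times the weight to the quadratic part, and a large \<open>C\<close> makes that
  part definite.
\<close>

definition linear_part :: "'h graph \<Rightarrow> ('h \<Rightarrow> 'v rpoly) \<Rightarrow> real \<Rightarrow> 'h set \<Rightarrow> 'v rpoly" where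
  "linear_part H X C S = (\<Sum>k\<in>fst H - S. Const (local_weight H S k) * (X k * (1 - Const C * X k)\<^sup>2))"

definition hessian_part :: "'h graph \<Rightarrow> ('h \<Rightarrow> 'v rpoly) \<Rightarrow> real \<Rightarrow> 'h set \<Rightarrow> 'h \<Rightarrow> 'h \<Rightarrow> 'v rpoly" where
  "hessian_part H X C S i j = Const (closed_adjacency H i j) +
     (if i = j then (if i \<in> S then 0 else Const (local_weight H S i) * (2 * Const C - Const C ^ 2 * X i)) else 0)"

context
  fixes H :: "'h graph" and X :: "'h \<Rightarrow> 'v rpoly"
  assumes H: "simple_graph H"
begin

text \<open>
  Taylor expansion at the vertex \<open>S\<close>. For \<open>i \<in> S\<close> the entries of \<open>A + I\<close> in the row of \<open>i\<close> and the columns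
  of \<open>S\<close> add up to \<open>1\<close>, so the first-order term of \<open>i\<close> cancels.
\<close>

lemma gap_form_expansion:
  assumes S: "maximum_stable_set H S"
  shows "gap_form H X = linear_part H X C S
    + (\<Sum>i\<in>fst H. \<Sum>j\<in>fst H. vertex_coordinate X S i * vertex_coordinate X S j * hessian_part H X C S i j)"
proof -
  let ?W = "fst H" and ?z = "\<lambda>i. if i \<in> S then 1 else 0 :: real" and ?y = "vertex_coordinate X S"
  let ?M = "\<lambda>i j. Const (closed_adjacency H i j) :: 'v rpoly"
  let ?a = "real (stability_number H)"
  have st: "stable_set H S" "card S = stability_number H" using S unfolding maximum_stable_set_def by auto
  have W: "finite ?W" by (rule finite_vertices[OF H])
  have SW: "S \<subseteq> ?W" using st unfolding stable_set_def by blast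
  have Xzy: "X i = Const (?z i) + ?y i" for i by (simp add: vertex_coordinate_def)
  have "clique_form H X Const = (\<Sum>i\<in>?W. \<Sum>j\<in>?W. ?M i j * (Const (?z i) + ?y i) * (Const (?z j) + ?y j))"
    unfolding clique_form_def by (subst (1 2) Xzy) simp
  also have "\<dots> = (\<Sum>i\<in>?W. \<Sum>j\<in>?W. ?M i j * Const (?z i) * Const (?z j))
      + 2 * (\<Sum>i\<in>?W. ?y i * (\<Sum>j\<in>?W. ?M i j * Const (?z j))) + (\<Sum>i\<in>?W. \<Sum>j\<in>?W. ?M i j * ?y i * ?y j)"
    by (rule symmetric_form_add) (simp add: closed_adjacency_sym[OF H])
  also have "(\<Sum>i\<in>?W. \<Sum>j\<in>?W. ?M i j * Const (?z i) * Const (?z j)) = Const (real_form H ?z)"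
    unfolding clique_form_def by (simp only: Const_sum Const_mult)
  also have "real_form H ?z = ?a"
    using real_form_stable_support[OF H st(1), of ?z] st(2) by simp
  also have "(\<Sum>i\<in>?W. ?y i * (\<Sum>j\<in>?W. ?M i j * Const (?z j))) = (\<Sum>i\<in>?W. ?y i * Const (row H ?z i))"
    unfolding row_def by (simp only: Const_sum Const_mult)
  also have "\<dots> = (\<Sum>i\<in>?W. ?y i * (if i \<in> S then 1 else Const (real (degree_into H S i))))"
    by (intro sum.cong refl) (simp add: row_stable[OF H st(1)])
  finally have form: "clique_form H X Const = Const ?a
      + 2 * (\<Sum>i\<in>?W. ?y i * (if i \<in> S then 1 else Const (real (degree_into H S i))))
      + (\<Sum>i\<in>?W. \<Sum>j\<in>?W. ?M i j * ?y i * ?y j)" .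
  have "(\<Sum>i\<in>?W. X i) = (\<Sum>i\<in>?W. Const (?z i)) + (\<Sum>i\<in>?W. ?y i)"
    by (subst Xzy) (simp add: sum.distrib)
  also have "(\<Sum>i\<in>?W. Const (?z i) :: 'v rpoly) = Const (\<Sum>i\<in>?W. ?z i)" by (simp only: Const_sum)
  also have "(\<Sum>i\<in>?W. ?z i) = ?a" using W SW st(2) by (simp add: sum.If_cases Int_absorb1)
  finally have lin: "(\<Sum>i\<in>?W. X i) = Const ?a + (\<Sum>i\<in>?W. ?y i)" .
  have sub: "gap_form H X = 2 * (\<Sum>i\<in>?W. ?y i * (if i \<in> S then 1 else Const (real (degree_into H S i))) - ?y i)
      + (\<Sum>i\<in>?W. \<Sum>j\<in>?W. ?M i j * ?y i * ?y j)"
    unfolding gap_form_def form lin by (simp add: sum_subtractf algebra_simps)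
  have "2 * (\<Sum>i\<in>?W. ?y i * (if i \<in> S then 1 else Const (real (degree_into H S i))) - ?y i)
      = (\<Sum>i\<in>?W. if i \<in> S then 0 else Const (local_weight H S i) * X i)"
    unfolding sum_distrib_left
    by (intro sum.cong refl) (simp add: local_weight_def vertex_coordinate_def Const_hom algebra_simps)
  also have "\<dots> = (\<Sum>k\<in>?W - S. Const (local_weight H S k) * X k)"
    using W by (simp add: sum.If_cases Diff_eq)
  finally have first: "gap_form H X = (\<Sum>k\<in>?W - S. Const (local_weight H S k) * X k)
      + (\<Sum>i\<in>?W. \<Sum>j\<in>?W. ?M i j * ?y i * ?y j)" using sub by simp
  have "(\<Sum>i\<in>?W. \<Sum>j\<in>?W. ?y i * ?y j * hessian_part H X C S i j)
      = (\<Sum>i\<in>?W. \<Sum>j\<in>?W. ?M i j * ?y i * ?y j)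
        + (\<Sum>i\<in>?W. if i \<in> S then 0 else (X i)\<^sup>2 * (Const (local_weight H S i) * (2 * Const C - Const C ^ 2 * X i)))"
  proof -
    have "(\<Sum>i\<in>?W. \<Sum>j\<in>?W. ?y i * ?y j * hessian_part H X C S i j)
      = (\<Sum>i\<in>?W. \<Sum>j\<in>?W. ?M i j * ?y i * ?y j + (if i = j then ?y i * ?y i *
          (if i \<in> S then 0 else Const (local_weight H S i) * (2 * Const C - Const C ^ 2 * X i)) else 0))"
      unfolding hessian_part_def by (intro sum.cong refl) (simp add: distrib_left mult_ac)
    also have "\<dots> = (\<Sum>i\<in>?W. \<Sum>j\<in>?W. ?M i j * ?y i * ?y j)
        + (\<Sum>i\<in>?W. ?y i * ?y i * (if i \<in> S then 0 else Const (local_weight H S i) * (2 * Const C - Const C ^ 2 * X i)))"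
      using W by (simp add: sum.distrib)
    also have "(\<Sum>i\<in>?W. ?y i * ?y i * (if i \<in> S then 0 else Const (local_weight H S i) * (2 * Const C - Const C ^ 2 * X i)))
      = (\<Sum>i\<in>?W. if i \<in> S then 0 else (X i)\<^sup>2 * (Const (local_weight H S i) * (2 * Const C - Const C ^ 2 * X i)))"
      by (intro sum.cong refl) (simp add: vertex_coordinate_def power2_eq_square)
    finally show ?thesis .
  qed
  also have "(\<Sum>i\<in>?W. if i \<in> S then 0 else (X i)\<^sup>2 * (Const (local_weight H S i) * (2 * Const C - Const C ^ 2 * X i)))
      = (\<Sum>k\<in>?W - S. (X k)\<^sup>2 * (Const (local_weight H S k) * (2 * Const C - Const C ^ 2 * X k)))"
    using W by (simp add: sum.If_cases Diff_eq)
  finally have hess: "(\<Sum>i\<in>?W. \<Sum>j\<in>?W. ?y i * ?y j * hessian_part H X C S i j)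
      = (\<Sum>i\<in>?W. \<Sum>j\<in>?W. ?M i j * ?y i * ?y j)
        + (\<Sum>k\<in>?W - S. (X k)\<^sup>2 * (Const (local_weight H S k) * (2 * Const C - Const C ^ 2 * X k)))" .
  have "linear_part H X C S = (\<Sum>k\<in>?W - S. Const (local_weight H S k) * X k
      - (X k)\<^sup>2 * (Const (local_weight H S k) * (2 * Const C - Const C ^ 2 * X k)))"
    unfolding linear_part_def by (intro sum.cong refl) (simp add: power2_eq_square algebra_simps)
  then show ?thesis unfolding first hess by (simp add: sum_subtractf)
qed

text \<open>
  On vectors supported in the stable set \<open>S\<close> the form is a sum of squares, so a large multiple of the
  squares of the other coordinates makes it definite.
\<close>

lemma definite_correction_exists:
  assumes S: "maximum_stable_set H S" and weight: "\<And>k. k \<in> fst H \<Longrightarrow> k \<notin> S \<Longrightarrow> 2 \<le> local_weight H S k"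
  shows "\<exists>C. \<forall>v. (\<exists>i\<in>fst H. v i \<noteq> 0) \<longrightarrow> 0 < (\<Sum>i\<in>fst H. \<Sum>j\<in>fst H. v i * v j *
      (closed_adjacency H i j + (if i = j then (if i \<in> S then 0 else 2 * C * local_weight H S i) else 0)))"
proof -
  let ?W = "fst H"
  have st: "stable_set H S" using S unfolding maximum_stable_set_def by auto
  have W: "finite ?W" by (rule finite_vertices[OF H])
  have SW: "S \<subseteq> ?W" using st unfolding stable_set_def by blast
  define \<psi> where "\<psi> v = (\<Sum>k\<in>?W - S. (v k)\<^sup>2)" for v :: "'h \<Rightarrow> real"
  have "\<exists>t\<ge>0. \<exists>\<delta>>0. \<forall>v\<in>unit_sphere ?W. \<delta> \<le> real_form H v + t * \<psi> v"
  proof (rule compact_penalty[OF compact_unit_sphere[OF W]])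
    show "continuous_on (unit_sphere ?W) (real_form H)" "continuous_on (unit_sphere ?W) \<psi>"
      unfolding clique_form_def \<psi>_def
      by (intro continuous_intros continuous_on_product_then_coordinatewise)+
    show "0 \<le> \<psi> v" for v by (simp add: \<psi>_def sum_nonneg)
    show "0 < real_form H v" if v: "v \<in> unit_sphere ?W" "\<psi> v = 0" for v
    proof -
      have 0: "v i = 0" if "i \<in> ?W" "i \<notin> S" for i
        using v(2) that W by (simp add: \<psi>_def sum_nonneg_eq_0_iff)
      have "real_form H v = (\<Sum>i\<in>S. (v i)\<^sup>2)" by (rule real_form_stable_support[OF H st 0])
      also have "\<dots> = (\<Sum>i\<in>?W. (v i)\<^sup>2)"
        using 0 W SW by (intro sum.mono_neutral_left) auto
      finally show ?thesis using v(1) by (simp add: unit_sphere_def)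
    qed
  qed
  then obtain t \<delta> where t: "0 \<le> t" "0 < \<delta>" "\<And>v. v \<in> unit_sphere ?W \<Longrightarrow> \<delta> \<le> real_form H v + t * \<psi> v"
    by blast
  define g where "g i j = closed_adjacency H i j + (if i = j then (if i \<in> S then 0 else 2 * (t / 4) * local_weight H S i) else 0)" for i j
  have "0 < (\<Sum>i\<in>?W. \<Sum>j\<in>?W. v i * v j * g i j)" if ne: "\<exists>i\<in>?W. v i \<noteq> 0" for v
  proof -
    obtain u where u: "u \<in> unit_sphere ?W" "\<And>i. i \<in> ?W \<Longrightarrow> v i = sqrt (\<Sum>j\<in>?W. (v j)\<^sup>2) * u i"
      using unit_sphere_normalise[OF W ne] by blast
    have "(\<Sum>i\<in>?W. \<Sum>j\<in>?W. u i * u j * g i j)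
      = (\<Sum>i\<in>?W. \<Sum>j\<in>?W. closed_adjacency H i j * u i * u j + (if i = j then u i * u i *
          (if i \<in> S then 0 else 2 * (t / 4) * local_weight H S i) else 0))"
      unfolding g_def by (intro sum.cong refl) (simp add: distrib_left mult_ac)
    also have "\<dots> = real_form H u + (\<Sum>i\<in>?W. u i * u i * (if i \<in> S then 0 else 2 * (t / 4) * local_weight H S i))"
      using W by (simp add: sum.distrib clique_form_def)
    also have "(\<Sum>i\<in>?W. u i * u i * (if i \<in> S then 0 else 2 * (t / 4) * local_weight H S i))
      = (\<Sum>k\<in>?W - S. u k * u k * (2 * (t / 4) * local_weight H S k))"
      using W by (simp add: if_distrib[of "\<lambda>x. _ * x"] sum.If_cases Diff_eq cong: if_cong)
    finally have eq: "(\<Sum>i\<in>?W. \<Sum>j\<in>?W. u i * u j * g i j)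
      = real_form H u + (\<Sum>k\<in>?W - S. u k * u k * (2 * (t / 4) * local_weight H S k))" .
    have "t * \<psi> u \<le> (\<Sum>k\<in>?W - S. u k * u k * (2 * (t / 4) * local_weight H S k))"
      unfolding \<psi>_def sum_distrib_left
    proof (rule sum_mono)
      fix k assume "k \<in> ?W - S"
      then have "t * 2 \<le> t * local_weight H S k" using weight t(1) by (intro mult_left_mono) auto
      then have "(u k)\<^sup>2 * (t * 2) \<le> (u k)\<^sup>2 * (t * local_weight H S k)" by (rule mult_left_mono) simp
      then show "t * (u k)\<^sup>2 \<le> u k * u k * (2 * (t / 4) * local_weight H S k)"
        by (simp add: power2_eq_square mult_ac)
    qed
    then have "0 < (\<Sum>i\<in>?W. \<Sum>j\<in>?W. u i * u j * g i j)" unfolding eq using t(2) t(3)[OF u(1)] by linarith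
    moreover have "0 < (\<Sum>j\<in>?W. (v j)\<^sup>2)"
    proof -
      obtain k where "k \<in> ?W" "v k \<noteq> 0" using ne by blast
      then show ?thesis using W by (intro sum_pos2[of ?W k]) auto
    qed
    ultimately have "0 < (\<Sum>j\<in>?W. (v j)\<^sup>2) * (\<Sum>i\<in>?W. \<Sum>j\<in>?W. u i * u j * g i j)" by simp
    also have "\<dots> = (\<Sum>i\<in>?W. \<Sum>j\<in>?W. v i * v j * g i j)"
      by (rule quadratic_normalise[OF u(2), symmetric])
    finally show ?thesis .
  qed
  then show ?thesis unfolding g_def by blast
qed

lemma eval_gap_form:
  "eval_poly (gap_form H X) x = real_form H (\<lambda>i. eval_poly (X i) x)
     - 2 * (\<Sum>i\<in>fst H. eval_poly (X i) x) + real (stability_number H)"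
  by (simp add: gap_form_def clique_form_def)

end

text \<open>
  Near the vertex of a maximum stable set \<open>S\<close> the form is \<open>\<Sum> x\<^sub>k \<sigma>\<^sub>k\<close> plus a definite quadratic form in
  the local coordinates, because every vertex outside \<open>S\<close> has at least two neighbours in \<open>S\<close> and so
  a positive weight. The bumps glue these local representations together, because modulo the ideal
  generated by the \<open>(X\<^sub>i (X\<^sub>i - 1))\<^sup>3\<close> a polynomial is the sum of its products with the squares of the
  bumps. The total bump \<open>\<zeta>\<close> of the other vertices of the cube becomes one more entry of the vector of polynomials whose
  common zeros on the simplex are the minimisers.
\<close>

theorem gap_form_in_module:
  fixes H :: "'h graph" and X :: "'h \<Rightarrow> 'v rpoly"
  assumes H: "simple_graph H" and nc: "\<nexists>e. critical_edge H e" and V: "finite V"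
    and Xmod: "\<And>i. i \<in> fst H \<Longrightarrow> X i \<in> extended_module V"
    and Xsum: "\<And>x. x \<in> standard_simplex V \<Longrightarrow> (\<Sum>i\<in>fst H. eval_poly (X i) x) = real (stability_number H)"
    and pos: "0 < stability_number H"
  shows "gap_form H X \<in> extended_module V"
proof -
  let ?W = "fst H"
  note qm = quad_module_extended[OF V]
  have W: "finite ?W" by (rule finite_vertices[OF H])
  define Z where "Z = {S. maximum_stable_set H S}"
  have ZW: "S \<subseteq> ?W" if "S \<in> Z" for S
    using that unfolding Z_def maximum_stable_set_def stable_set_def by blast
  have Zsub: "Z \<subseteq> Pow ?W" using ZW by blast
  have finZ: "finite Z" by (rule finite_subset[OF Zsub]) (simp add: W)
  have two: "2 \<le> degree_into H S k" if "maximum_stable_set H S" "k \<in> ?W" "k \<notin> S" for S k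
    by (rule two_neighbours_if_no_critical_edge[OF H nc that])
  have weight: "2 \<le> local_weight H S k" if "S \<in> Z" "k \<in> ?W" "k \<notin> S" for S k
    using two[of S k] that unfolding Z_def local_weight_def by simp
  have "\<forall>S\<in>Z. \<exists>C. \<forall>v. (\<exists>i\<in>?W. v i \<noteq> 0) \<longrightarrow> 0 < (\<Sum>i\<in>?W. \<Sum>j\<in>?W. v i * v j *
      (closed_adjacency H i j + (if i = j then (if i \<in> S then 0 else 2 * C * local_weight H S i) else 0)))"
  proof
    fix S assume S: "S \<in> Z"
    then show "\<exists>C. \<forall>v. (\<exists>i\<in>?W. v i \<noteq> 0) \<longrightarrow> 0 < (\<Sum>i\<in>?W. \<Sum>j\<in>?W. v i * v j *
      (closed_adjacency H i j + (if i = j then (if i \<in> S then 0 else 2 * C * local_weight H S i) else 0)))"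
      by (intro definite_correction_exists[OF H] weight) (auto simp: Z_def)
  qed
  from bchoice[OF this] obtain C where "\<forall>S\<in>Z. \<forall>v. (\<exists>i\<in>?W. v i \<noteq> 0) \<longrightarrow> 0 < (\<Sum>i\<in>?W. \<Sum>j\<in>?W. v i * v j *
      (closed_adjacency H i j + (if i = j then (if i \<in> S then 0 else 2 * C S * local_weight H S i) else 0)))"
    by blast
  then have C: "\<And>S v. S \<in> Z \<Longrightarrow> \<exists>i\<in>?W. v i \<noteq> 0 \<Longrightarrow> 0 < (\<Sum>i\<in>?W. \<Sum>j\<in>?W. v i * v j *
      (closed_adjacency H i j + (if i = j then (if i \<in> S then 0 else 2 * C S * local_weight H S i) else 0)))"
    by blast
  let ?F = "gap_form H X" and ?E = "vertex_bump ?W X" and ?u = "bump_cofactor ?W X"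
  define f where "f i = X i * (X i - 1)" for i
  define \<eta> where "\<eta> = (\<Sum>S\<in>Z. ?E S)"
  define \<zeta> where "\<zeta> = (\<Sum>S\<in>Pow ?W - Z. ?E S)"
  have \<eta>\<zeta>: "\<eta> + \<zeta> = 1"
    unfolding \<eta>_def \<zeta>_def using sum_vertex_bumps[OF W, of X] W Zsub
    by (simp add: sum.subset_diff[of Z "Pow ?W"] add.commute)
  let ?N = "cube_ideal ?W X"
  note N = cube_ideal_add[OF W] cube_ideal_mult[OF W] cube_ideal_minus[OF W] cube_ideal_sum[OF W]
  have idem: "?E S - (?E S)\<^sup>2 \<in> ?N" if S: "S \<in> Z" for S
  proof -
    have "?E S - (?E S)\<^sup>2 = ?E S * (\<Sum>T\<in>Pow ?W. ?E T) - (?E S)\<^sup>2"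
      unfolding sum_vertex_bumps[OF W] by simp
    also have "\<dots> = (\<Sum>T\<in>Pow ?W - {S}. ?E S * ?E T)"
      using W S Zsub by (subst sum.remove[of _ S]) (auto simp: distrib_left power2_eq_square sum_distrib_left)
    also have "\<dots> \<in> ?N" using S ZW by (intro N(4) vertex_bump_orthogonal[OF W]) auto
    finally show ?thesis .
  qed
  have orth: "\<zeta> * \<eta> \<in> ?N"
    unfolding \<zeta>_def \<eta>_def sum_product using ZW
    by (intro N(4) vertex_bump_orthogonal[OF W]) auto
  define P where "P = (\<Sum>S\<in>Z. (?E S)\<^sup>2 * linear_part H X (C S) S)"
  let ?y = "\<lambda>S. vertex_coordinate X S" and ?h = "\<lambda>S. hessian_part H X (C S) S"
  define n where "n = (\<Sum>S\<in>Z. (?E S - (?E S)\<^sup>2) * ?F) + \<zeta> * \<eta> * ?F + - (\<zeta> * \<eta> * \<zeta>)"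
  have "n \<in> ?N"
    unfolding n_def by (intro N(1,3) N(4)[of Z]) (auto intro: N(2) idem orth)
  then obtain h where h: "n = (\<Sum>i\<in>?W. f i ^ 3 * h i)"
    unfolding cube_ideal_def[OF W] f_def by blast
  \<comment> \<open>The summand \<open>\<eta>\<close> makes the coefficient of \<open>\<zeta>\<^sup>2\<close> positive at the minimisers, where \<open>\<eta> = 1\<close>.\<close>
  have F1: "?F = (\<Sum>S\<in>Z. (?E S)\<^sup>2 * ?F) + \<zeta>\<^sup>2 * (?F + \<eta>) + n"
  proof -
    have "(\<Sum>S\<in>Z. (?E S)\<^sup>2 * ?F) + (\<Sum>S\<in>Z. (?E S - (?E S)\<^sup>2) * ?F) = \<eta> * ?F"
      unfolding \<eta>_def sum_distrib_right sum.distrib[symmetric]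
      by (intro sum.cong refl) (simp add: algebra_simps)
    moreover have "\<zeta>\<^sup>2 * (?F + \<eta>) + \<zeta> * \<eta> * ?F + - (\<zeta> * \<eta> * \<zeta>) = \<zeta> * (\<eta> + \<zeta>) * ?F"
      by (simp add: power2_eq_square algebra_simps)
    ultimately have "(\<Sum>S\<in>Z. (?E S)\<^sup>2 * ?F) + \<zeta>\<^sup>2 * (?F + \<eta>) + n = \<eta> * ?F + \<zeta> * (\<eta> + \<zeta>) * ?F"
      unfolding n_def by (simp add: algebra_simps)
    also have "\<zeta> * (\<eta> + \<zeta>) * ?F = \<zeta> * ?F" by (simp add: \<eta>\<zeta>)
    also have "\<eta> * ?F + \<zeta> * ?F = (\<eta> + \<zeta>) * ?F" by (rule distrib_right[symmetric])
    finally show ?thesis by (simp add: \<eta>\<zeta>)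
  qed
  define G0 where "G0 i j = (\<Sum>S\<in>Z. ?u S i * ?u S j * ?h S i j) + (if i = j then f i * h i else 0)" for i j
  have local: "(?E S)\<^sup>2 * ?F = (?E S)\<^sup>2 * linear_part H X (C S) S
      + (\<Sum>i\<in>?W. \<Sum>j\<in>?W. f i * f j * (?u S i * ?u S j * ?h S i j))" if S: "S \<in> Z" for S
  proof -
    have ey: "?E S * ?y S i = f i * ?u S i" if "i \<in> ?W" for i
      unfolding f_def by (rule vertex_bump_coordinate[OF W ZW[OF S] that])
    have "(?E S)\<^sup>2 * (\<Sum>i\<in>?W. \<Sum>j\<in>?W. ?y S i * ?y S j * ?h S i j)
        = (\<Sum>i\<in>?W. \<Sum>j\<in>?W. (?E S * ?y S i) * (?E S * ?y S j) * ?h S i j)"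
      unfolding sum_distrib_left by (intro sum.cong refl) (simp add: power2_eq_square mult_ac)
    also have "\<dots> = (\<Sum>i\<in>?W. \<Sum>j\<in>?W. f i * f j * (?u S i * ?u S j * ?h S i j))"
      by (intro sum.cong refl) (simp only: ey, simp only: mult_ac)
    finally show ?thesis
      using gap_form_expansion[OF H, of S X "C S"] S unfolding Z_def by (simp add: distrib_left)
  qed
  have quad: "(\<Sum>i\<in>?W. \<Sum>j\<in>?W. f i * f j * G0 i j)
      = (\<Sum>S\<in>Z. \<Sum>i\<in>?W. \<Sum>j\<in>?W. f i * f j * (?u S i * ?u S j * ?h S i j)) + n"
  proof -
    have "(\<Sum>i\<in>?W. \<Sum>j\<in>?W. f i * f j * G0 i j)
        = (\<Sum>i\<in>?W. \<Sum>j\<in>?W. (\<Sum>S\<in>Z. f i * f j * (?u S i * ?u S j * ?h S i j)) + (if i = j then f i * f i * (f i * h i) else 0))"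
      unfolding G0_def by (intro sum.cong refl) (simp add: distrib_left sum_distrib_left)
    also have "\<dots> = (\<Sum>i\<in>?W. \<Sum>j\<in>?W. \<Sum>S\<in>Z. f i * f j * (?u S i * ?u S j * ?h S i j)) + n"
      using W by (simp add: sum.distrib h power3_eq_cube mult_ac)
    also have "(\<Sum>i\<in>?W. \<Sum>j\<in>?W. \<Sum>S\<in>Z. f i * f j * (?u S i * ?u S j * ?h S i j))
        = (\<Sum>i\<in>?W. \<Sum>S\<in>Z. \<Sum>j\<in>?W. f i * f j * (?u S i * ?u S j * ?h S i j))"
      by (rule sum.cong[OF refl]) (rule sum.swap)
    also have "\<dots> = (\<Sum>S\<in>Z. \<Sum>i\<in>?W. \<Sum>j\<in>?W. f i * f j * (?u S i * ?u S j * ?h S i j))"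
      by (rule sum.swap)
    finally show ?thesis .
  qed
  have F2: "?F = P + ((\<Sum>i\<in>?W. \<Sum>j\<in>?W. f i * f j * G0 i j) + \<zeta>\<^sup>2 * (?F + \<eta>))"
  proof -
    have "(\<Sum>S\<in>Z. (?E S)\<^sup>2 * ?F)
        = P + (\<Sum>S\<in>Z. \<Sum>i\<in>?W. \<Sum>j\<in>?W. f i * f j * (?u S i * ?u S j * ?h S i j))"
      unfolding P_def by (simp add: local sum.distrib)
    then show ?thesis using F1 unfolding quad by (simp add: algebra_simps)
  qed
  define J where "J = insert None (Some ` ?W)"
  define fo where "fo k = (case k of None \<Rightarrow> \<zeta> | Some i \<Rightarrow> f i)" for k
  define Go where "Go k l = (case k of
      None \<Rightarrow> (case l of None \<Rightarrow> ?F + \<eta> | Some j \<Rightarrow> 0)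
    | Some i \<Rightarrow> (case l of None \<Rightarrow> 0 | Some j \<Rightarrow> G0 i j))" for k l
  have block: "(\<Sum>k\<in>J. \<Sum>l\<in>J. v k * v l * g k l)
      = g None None * (v None)\<^sup>2 + (\<Sum>i\<in>?W. \<Sum>j\<in>?W. v (Some i) * v (Some j) * g (Some i) (Some j))"
    if "\<And>i. g None (Some i) = 0" "\<And>i. g (Some i) None = 0"
    for v :: "'h option \<Rightarrow> 'b::comm_ring_1" and g
    unfolding J_def using W that by (simp add: sum.reindex power2_eq_square mult_ac)
  have F3: "?F = P + (\<Sum>k\<in>J. \<Sum>l\<in>J. fo k * fo l * Go k l)"
    by (subst block) (use F2 in \<open>simp_all add: fo_def Go_def mult.commute add.commute\<close>)
  have G0_sym: "G0 i j = G0 j i" for i j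
    by (cases "i = j") (simp_all add: G0_def hessian_part_def closed_adjacency_sym[OF H, of i j] mult_ac)
  have Xnn: "0 \<le> eval_poly (X i) x" if "i \<in> ?W" "x \<in> standard_simplex V" for i x
    by (rule extended_nonneg[OF V Xmod[OF that(1)] that(2)])
  have gap: "eval_poly ?F x = real_form H (\<lambda>i. eval_poly (X i) x) - real (stability_number H)"
    if "x \<in> standard_simplex V" for x
    unfolding eval_gap_form[OF H] using Xsum[OF that] by simp
  have gap_nn: "0 \<le> eval_poly ?F x" if x: "x \<in> standard_simplex V" for x
  proof -
    have "(real (stability_number H))\<^sup>2 \<le> real (stability_number H) * real_form H (\<lambda>i. eval_poly (X i) x)"
      using Motzkin_Straus[OF H, of "\<lambda>i. eval_poly (X i) x"] Xnn x Xsum[OF x] by simp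
    then show ?thesis using pos gap[OF x] by (simp add: power2_eq_square)
  qed
  have \<eta>_eval: "eval_poly \<eta> x = 1 - eval_poly \<zeta> x" for x
    using arg_cong[OF \<eta>\<zeta>, of "\<lambda>p. eval_poly p x"] by simp
  have \<zeta>_vertex: "eval_poly \<zeta> x = (if T \<in> Z then 0 else 1)"
    if T: "T \<subseteq> ?W" and X: "\<And>i. i \<in> ?W \<Longrightarrow> eval_poly (X i) x = (if i \<in> T then 1 else 0)" for T x
  proof -
    have "eval_poly \<zeta> x = (\<Sum>S\<in>Pow ?W - Z. if S = T then 1 else 0)"
      unfolding \<zeta>_def using vertex_bump_at_vertex[OF W _ T, of _ "\<lambda>i. eval_poly (X i) x"] X
      by (auto intro!: sum.cong)
    then show ?thesis using T W by simp
  qed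
  have Go_eval: "eval_poly (Go None None) x = eval_poly ?F x + eval_poly \<eta> x"
    "eval_poly (Go None (Some i)) x = 0" "eval_poly (Go (Some i) None) x = 0"
    "eval_poly (Go (Some i) (Some j)) x = eval_poly (G0 i j) x" for x i j
    by (simp_all add: Go_def)
  show ?thesis
  proof (rule simplex_certificate[OF V, of J Go ?F P fo])
    show "finite J" using W by (simp add: J_def)
    show "Go k l = Go l k" for k l using G0_sym by (simp add: Go_def split: option.split)
    show "?F = P + (\<Sum>k\<in>J. \<Sum>l\<in>J. fo k * fo l * Go k l)" by (rule F3)
    show "P \<in> extended_module V"
      unfolding P_def linear_part_def
    proof (intro qm_sum[OF qm] qm_square_mult[OF qm])
      fix S k assume S: "S \<in> Z" and k: "k \<in> ?W - S"
      have "X k * (1 - Const (C S) * X k)\<^sup>2 \<in> extended_module V"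
        by (rule qm_mult_square[OF qm Xmod]) (use k in auto)
      then show "Const (local_weight H S k) * (X k * (1 - Const (C S) * X k)\<^sup>2) \<in> extended_module V"
        by (rule qm_scale[OF qm, rotated]) (use weight[OF S, of k] k in auto)
    qed
    show "0 < eval_poly ?F x" if x: "x \<in> standard_simplex V" and ne: "\<exists>k\<in>J. eval_poly (fo k) x \<noteq> 0" for x
    proof (rule ccontr)
      assume "\<not> ?thesis"
      then have "real_form H (\<lambda>i. eval_poly (X i) x) = real (stability_number H)"
        using gap_nn[OF x] gap[OF x] by simp
      then obtain S where S: "maximum_stable_set H S" "\<forall>i\<in>?W. eval_poly (X i) x = (if i \<in> S then 1 else 0)"
        using Motzkin_Straus_equality[OF H two, of "\<lambda>i. eval_poly (X i) x"] Xnn x Xsum[OF x] by blast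
      then have "S \<in> Z" by (simp add: Z_def)
      then have "eval_poly \<zeta> x = 0" using \<zeta>_vertex[OF ZW] S(2) by simp
      moreover have "eval_poly (f i) x = 0" if "i \<in> ?W" for i
        using S(2) that by (simp add: f_def)
      ultimately show False using ne by (auto simp: J_def fo_def)
    qed
    show "0 < (\<Sum>k\<in>J. \<Sum>l\<in>J. v k * v l * eval_poly (Go k l) x)"
      if x: "x \<in> standard_simplex V" and zero: "\<forall>k\<in>J. eval_poly (fo k) x = 0"
        and ne: "\<exists>k\<in>J. v k \<noteq> 0" for x v
    proof -
      define T where "T = {i \<in> ?W. eval_poly (X i) x = 1}"
      have TW: "T \<subseteq> ?W" unfolding T_def by blast
      have "eval_poly (f i) x = 0" if "i \<in> ?W" for i using zero that by (force simp: J_def fo_def)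
      then have XT: "eval_poly (X i) x = (if i \<in> T then 1 else 0)" if "i \<in> ?W" for i
        using that by (force simp: f_def T_def)
      have \<zeta>0: "eval_poly \<zeta> x = 0" using zero by (force simp: J_def fo_def)
      then have TZ: "T \<in> Z" using \<zeta>_vertex[OF TW XT] by (auto split: if_splits)
      define sg where "sg i = (if i \<in> T then 1 else -1 :: real)" for i
      define gg where "gg i j = closed_adjacency H i j
          + (if i = j then (if i \<in> T then 0 else 2 * C T * local_weight H T i) else 0)" for i j
      have u_eval: "eval_poly (?u S i) x = (if S = T then sg i else 0)" if "S \<in> Z" "i \<in> ?W" for S i
        unfolding eval_bump_cofactor sg_def
        using bump_cofactor_at_vertex[OF W ZW[OF that(1)] TW, of "\<lambda>i. eval_poly (X i) x" i] XT that(2) by auto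
      have h_eval: "eval_poly (?h T i j) x = gg i j" if "i \<in> ?W" for i j
        using XT[OF that] by (cases "i = j") (simp_all add: hessian_part_def gg_def)
      have G0_eval: "eval_poly (G0 i j) x = sg i * sg j * gg i j" if ij: "i \<in> ?W" "j \<in> ?W" for i j
      proof -
        have "eval_poly (G0 i j) x = (\<Sum>S\<in>Z. eval_poly (?u S i) x * eval_poly (?u S j) x * eval_poly (?h S i j) x)"
          using XT[OF ij(1)]
          by (cases "i = j"; cases "i \<in> T") (simp_all add: G0_def f_def del: eval_bump_cofactor)
        also have "\<dots> = (\<Sum>S\<in>Z. if S = T then sg i * sg j * gg i j else 0)"
          using u_eval ij h_eval by (intro sum.cong refl) auto
        finally show ?thesis using TZ finZ by simp
      qed
      have "(\<Sum>k\<in>J. \<Sum>l\<in>J. v k * v l * eval_poly (Go k l) x)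
          = (eval_poly ?F x + 1) * (v None)\<^sup>2
            + (\<Sum>i\<in>?W. \<Sum>j\<in>?W. v (Some i) * v (Some j) * eval_poly (G0 i j) x)"
        by (subst block) (simp_all add: Go_eval \<eta>_eval \<zeta>0)
      also have "(\<Sum>i\<in>?W. \<Sum>j\<in>?W. v (Some i) * v (Some j) * eval_poly (G0 i j) x)
          = (\<Sum>i\<in>?W. \<Sum>j\<in>?W. (sg i * v (Some i)) * (sg j * v (Some j)) * gg i j)"
        by (intro sum.cong refl) (simp add: G0_eval mult_ac)
      finally have total: "(\<Sum>k\<in>J. \<Sum>l\<in>J. v k * v l * eval_poly (Go k l) x)
          = (eval_poly ?F x + 1) * (v None)\<^sup>2
            + (\<Sum>i\<in>?W. \<Sum>j\<in>?W. (sg i * v (Some i)) * (sg j * v (Some j)) * gg i j)" .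
      have first: "0 \<le> (eval_poly ?F x + 1) * (v None)\<^sup>2" using gap_nn[OF x] by simp
      show ?thesis
      proof (cases "\<exists>i\<in>?W. v (Some i) \<noteq> 0")
        case True
        then have "\<exists>i\<in>?W. sg i * v (Some i) \<noteq> 0" by (auto simp: sg_def)
        from C[OF TZ this] show ?thesis unfolding total gg_def using first by linarith
      next
        case False
        then have "v None \<noteq> 0" using ne by (auto simp: J_def)
        then have "0 < (eval_poly ?F x + 1) * (v None)\<^sup>2" using gap_nn[OF x] by simp
        moreover have "(\<Sum>i\<in>?W. \<Sum>j\<in>?W. (sg i * v (Some i)) * (sg j * v (Some j)) * gg i j) = 0"
          using False by (intro sum.neutral ballI) simp
        ultimately show ?thesis unfolding total by simp
      qed
    qed
  qed
qed

section \<open>Bounds for univariate polynomials of bounded degree\<close>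

text \<open>
  Dividing \<open>p - p(a)\<close> by \<open>s - a\<close> lowers the degree, and the quotient is bounded on the right half of
  the interval, where \<open>s - a\<close> is bounded below.
\<close>

lemma coeff_bounded_on_interval:
  fixes a b :: real
  assumes "a < b"
  shows "\<exists>C>0. \<forall>p B. degree p \<le> r \<longrightarrow> (\<forall>s. a \<le> s \<and> s \<le> b \<longrightarrow> \<bar>poly p s\<bar> \<le> B) \<longrightarrow> (\<forall>i. \<bar>coeff p i\<bar> \<le> C * B)"
  using assms
proof (induction r arbitrary: a)
  case 0
  have "\<bar>coeff p i\<bar> \<le> 1 * B"
    if p: "degree p \<le> 0" and B: "\<forall>s. a \<le> s \<and> s \<le> b \<longrightarrow> \<bar>poly p s\<bar> \<le> B" for p :: "real poly" and B i
  proof -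
    obtain c where c: "p = [:c:]" using p by (metis degree_eq_zeroE le_zero_eq)
    have "\<bar>c\<bar> \<le> B" using B[rule_format, of a] 0 by (simp add: c)
    then show ?thesis by (cases i) (auto simp: c)
  qed
  then show ?case by (intro exI[of _ 1]) auto
next
  case (Suc r)
  define m where "m = (a + b) / 2"
  have m: "a < m" "m < b" using Suc.prems by (auto simp: m_def)
  obtain C where C: "0 < C" "\<And>p B i. degree p \<le> r \<Longrightarrow> (\<And>s. m \<le> s \<Longrightarrow> s \<le> b \<Longrightarrow> \<bar>poly p s\<bar> \<le> B) \<Longrightarrow> \<bar>coeff p i\<bar> \<le> C * B"
    using Suc.IH[OF m(2)] by blast
  define C1 where "C1 = C * (2 / (m - a))"
  have C1: "0 < C1" using C m by (simp add: C1_def)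
  have "\<bar>coeff p i\<bar> \<le> (1 + (\<bar>a\<bar> + 1) * C1) * B"
    if p: "degree p \<le> Suc r" and B: "\<forall>s. a \<le> s \<and> s \<le> b \<longrightarrow> \<bar>poly p s\<bar> \<le> B" for p :: "real poly" and B i
  proof -
    define q where "q = synthetic_div p a"
    have pq: "p = [:- a, 1:] * q + [:poly p a:]"
      unfolding q_def by (rule synthetic_div_correct'[symmetric])
    have pa: "\<bar>poly p a\<bar> \<le> B" using B Suc.prems by simp
    have "\<bar>poly q s\<bar> \<le> 2 * B / (m - a)" if s: "m \<le> s" "s \<le> b" for s
    proof -
      have "poly p s = (s - a) * poly q s + poly p a" by (subst pq) (simp add: algebra_simps)
      then have "\<bar>(s - a) * poly q s\<bar> \<le> 2 * B" using B[rule_format, of s] s m pa by linarith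
      moreover have "(m - a) * \<bar>poly q s\<bar> \<le> \<bar>(s - a) * poly q s\<bar>"
        unfolding abs_mult using s m by (intro mult_right_mono) auto
      ultimately show ?thesis using m by (simp add: field_simps)
    qed
    moreover have "degree q \<le> r" using p by (simp add: q_def degree_synthetic_div)
    ultimately have q: "\<bar>coeff q l\<bar> \<le> C1 * B" for l
      using C(2)[of q "2 * B / (m - a)" l] by (simp add: C1_def)
    have "coeff p i = - a * coeff q i + (case i of 0 \<Rightarrow> poly p a | Suc l \<Rightarrow> coeff q l)"
      by (subst pq) (simp add: coeff_pCons split: nat.split)
    moreover have "\<bar>- a * coeff q i\<bar> \<le> \<bar>a\<bar> * (C1 * B)"
      unfolding abs_mult using q by (simp add: mult_left_mono)
    moreover have "0 \<le> B" using pa by simp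
    then have "0 \<le> C1 * B" using C1 by simp
    then have "\<bar>poly p a\<bar> \<le> B + C1 * B" "\<bar>coeff q l\<bar> \<le> B + C1 * B" for l
      using pa q[of l] \<open>0 \<le> B\<close> by auto
    then have "\<bar>case i of 0 \<Rightarrow> poly p a | Suc l \<Rightarrow> coeff q l\<bar> \<le> B + C1 * B"
      by (simp split: nat.split)
    ultimately show ?thesis by (simp add: algebra_simps)
  qed
  moreover have "0 < 1 + (\<bar>a\<bar> + 1) * C1" using C1 by (simp add: add_pos_nonneg)
  ultimately show ?case by blast
qed

lemma coeff_bounded_on_intervalE:
  fixes a b :: real
  assumes "a < b"
  obtains C where "0 < C" "\<And>p B i. degree p \<le> r \<Longrightarrow>
    (\<And>s. a \<le> s \<Longrightarrow> s \<le> b \<Longrightarrow> \<bar>poly p s\<bar> \<le> B) \<Longrightarrow> \<bar>coeff p i\<bar> \<le> C * B"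
  using coeff_bounded_on_interval[OF assms, of r] by blast

lemma poly_bound_from_coeffs:
  fixes p :: "real poly"
  assumes "\<And>i. \<bar>coeff p i\<bar> \<le> A" "degree p \<le> r"
  shows "\<bar>poly p s\<bar> \<le> A * (\<Sum>i\<le>r. \<bar>s\<bar> ^ i)"
proof -
  have A: "0 \<le> A" using assms(1)[of 0] by linarith
  have "poly p s = (\<Sum>i\<le>degree p. coeff p i * s ^ i)" by (rule poly_altdef)
  also have "\<bar>\<dots>\<bar> \<le> (\<Sum>i\<le>degree p. \<bar>coeff p i * s ^ i\<bar>)" by (rule sum_abs)
  also have "\<dots> \<le> (\<Sum>i\<le>degree p. A * \<bar>s\<bar> ^ i)"
    by (intro sum_mono) (simp add: abs_mult power_abs mult_right_mono assms(1))
  also have "\<dots> \<le> (\<Sum>i\<le>r. A * \<bar>s\<bar> ^ i)"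
    using assms(2) A by (intro sum_mono2) auto
  finally show ?thesis by (simp add: sum_distrib_left)
qed

text \<open>
  A large linear term would make \<open>p\<close> negative at one of the points \<open>\<plusminus> sqrt e\<close>, where the terms of
  higher order contribute only a multiple of \<open>e\<close>.
\<close>

lemma nonneg_poly_derivative_bound:
  fixes p :: "real poly"
  assumes nonneg: "\<And>s. 0 \<le> poly p s" and A: "\<And>i. \<bar>coeff p i\<bar> \<le> A" and deg: "degree p \<le> r"
    and e: "0 < e" "e \<le> 1" "poly p 0 \<le> e"
  shows "\<bar>coeff p 1\<bar> \<le> sqrt e * (1 + A * (real r + 1))"
proof -
  obtain c0 c1 q where p: "p = pCons c0 (pCons c1 q)" by (metis pCons_cases)
  have cq: "\<bar>coeff q i\<bar> \<le> A" for i using A[of "Suc (Suc i)"] by (simp add: p)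
  have dq: "degree q \<le> r" using deg by (auto simp: p split: if_splits)
  define d where "d = sqrt e"
  have d: "0 < d" "d \<le> 1" "d * d = e" using e by (auto simp: d_def)
  have key: "0 \<le> e + s * c1 + e * (A * (real r + 1))" if s: "\<bar>s\<bar> = d" for s
  proof -
    have "A * (\<Sum>i\<le>r. \<bar>s\<bar> ^ i) \<le> A * (\<Sum>i\<le>r. 1)"
      using d s A[of 0] by (intro mult_left_mono sum_mono power_le_one) auto
    then have "\<bar>poly q s\<bar> \<le> A * (real r + 1)"
      using poly_bound_from_coeffs[OF cq dq, of s] by (simp add: add.commute)
    moreover have ss: "s * s = e" using s d(3) by (metis abs_mult_self_eq)
    ultimately have "s * s * poly q s \<le> e * (A * (real r + 1))"
      unfolding ss using e by (intro mult_left_mono) auto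
    then show ?thesis using nonneg[of s] e(3) by (simp add: p algebra_simps)
  qed
  have "d * \<bar>c1\<bar> \<le> e + e * (A * (real r + 1))" using key[of d] key[of "- d"] d by (simp add: abs_if)
  also have "\<dots> = d * (d * (1 + A * (real r + 1)))" using d(3) by (simp add: algebra_simps)
  finally have "\<bar>c1\<bar> \<le> d * (1 + A * (real r + 1))" using d(1) by simp
  then show ?thesis by (simp add: p d_def)
qed

text \<open>
  In a representation of an almost vanishing linear function the terms \<open>a\<close> and \<open>b\<close> contribute almost
  nothing to the derivative at \<open>0\<close>, so \<open>g\<close> has to supply the slope. The constant depends only
  on the bounds for the degree and the slope.
\<close>

lemma slope_supplied_by_multiplier:
  fixes Lmax :: real
  assumes "0 \<le> Lmax"
  obtains D where "0 < D" "\<And>(a::real poly) b g t L e e'.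
    degree a \<le> r \<Longrightarrow> degree b \<le> r \<Longrightarrow> (\<And>s. 0 \<le> poly a s) \<Longrightarrow> (\<And>s. 0 \<le> poly b s) \<Longrightarrow> (\<And>s. 0 \<le> poly g s) \<Longrightarrow>
    1/2 \<le> t \<Longrightarrow> t \<le> 3/4 \<Longrightarrow> \<bar>L\<bar> \<le> Lmax \<Longrightarrow> 0 \<le> e \<Longrightarrow> e \<le> e' \<Longrightarrow> 0 < e' \<Longrightarrow> e' \<le> 1/2 \<Longrightarrow>
    (\<And>s. L * s + e = poly a s + (t - s) * poly b s + s * poly g s) \<Longrightarrow> \<bar>poly g 0 - L\<bar> \<le> D * sqrt e'"
proof -
  obtain C where C: "0 < C" "\<And>(p::real poly) B i. degree p \<le> r \<Longrightarrow> (\<And>s. 0 \<le> s \<Longrightarrow> s \<le> 1/4 \<Longrightarrow> \<bar>poly p s\<bar> \<le> B) \<Longrightarrow> \<bar>coeff p i\<bar> \<le> C * B"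
    by (rule coeff_bounded_on_intervalE[of 0 "1/4" r]) (simp, blast)
  define B where "B = Lmax + 1"
  have B: "0 < B" using assms by (simp add: B_def)
  define D where "D = (1 + C * B * (real r + 1)) + 2 + 2 * (1 + C * (4 * B) * (real r + 1))"
  have "0 < 1 + C * B * (real r + 1)" by (rule add_pos_nonneg) (use C(1) B in simp_all)
  moreover have "0 < 1 + C * (4 * B) * (real r + 1)" by (rule add_pos_nonneg) (use C(1) B in simp_all)
  ultimately have D: "0 < D" unfolding D_def by (intro add_pos_pos[OF add_pos_pos] mult_pos_pos) auto
  have bound: "\<bar>poly g 0 - L\<bar> \<le> D * sqrt e'"
    if deg: "degree a \<le> r" "degree b \<le> r" and nn: "\<And>s. 0 \<le> poly a s" "\<And>s. 0 \<le> poly b s" "\<And>s. 0 \<le> poly g s"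
      and t: "1/2 \<le> t" "t \<le> 3/4" and L: "\<bar>L\<bar> \<le> Lmax" and e: "0 \<le> e" "e \<le> e'" "0 < e'" "e' \<le> 1/2"
      and eq: "\<And>s. L * s + e = poly a s + (t - s) * poly b s + s * poly g s"
    for a b g :: "real poly" and t L e e'
  proof -
    have bound: "poly a s \<le> B \<and> poly b s \<le> 4 * B" if s: "0 \<le> s" "s \<le> 1/4" for s
    proof -
      have "L * s \<le> Lmax * 1" using L s assms by (intro mult_mono) auto
      then have lhs: "L * s + e \<le> B" using e by (simp add: B_def)
      have "0 \<le> s * poly g s" "0 \<le> (t - s) * poly b s" using nn s t by auto
      moreover have "1/4 * poly b s \<le> (t - s) * poly b s" using nn s t by (intro mult_right_mono) auto
      ultimately show ?thesis using eq[of s] lhs nn(1)[of s] by linarith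
    qed
    have ca: "\<bar>coeff a i\<bar> \<le> C * B" for i using bound nn by (intro C(2) deg) auto
    have cb: "\<bar>coeff b i\<bar> \<le> C * (4 * B)" for i using bound nn by (intro C(2) deg) auto
    have at0: "poly a 0 + t * poly b 0 = e" using eq[of 0] by simp
    have tb: "1/2 * poly b 0 \<le> t * poly b 0" using nn t by (intro mult_right_mono) auto
    have a0: "poly a 0 \<le> e'" and b0: "poly b 0 \<le> 2 * e'"
      using at0 tb nn(1)[of 0] nn(2)[of 0] e t by auto
    have da: "\<bar>coeff a 1\<bar> \<le> sqrt e' * (1 + C * B * (real r + 1))"
      by (rule nonneg_poly_derivative_bound[OF nn(1) ca deg(1)]) (use e a0 in auto)
    have "\<bar>coeff b 1\<bar> \<le> sqrt (2 * e') * (1 + C * (4 * B) * (real r + 1))"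
      by (rule nonneg_poly_derivative_bound[OF nn(2) cb deg(2)]) (use e b0 in auto)
    also have "\<dots> \<le> (2 * sqrt e') * (1 + C * (4 * B) * (real r + 1))"
    proof (rule mult_right_mono)
      have "sqrt (2 * e') \<le> sqrt (4 * e')" using e by simp
      also have "\<dots> = 2 * sqrt e'" by (simp add: real_sqrt_mult)
      finally show "sqrt (2 * e') \<le> 2 * sqrt e'" .
      show "0 \<le> 1 + C * (4 * B) * (real r + 1)" using C(1) B by simp
    qed
    finally have db: "\<bar>coeff b 1\<bar> \<le> (2 * sqrt e') * (1 + C * (4 * B) * (real r + 1))" .
    have "[:e, L:] = a + [:t, -1:] * b + [:0, 1:] * g"
      using eq by (intro poly_eq_poly_eq_iff[THEN iffD1] ext) (simp add: algebra_simps)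
    then have "coeff [:e, L:] 1 = coeff (a + [:t, -1:] * b + [:0, 1:] * g) 1" by simp
    then have slope: "L = coeff a 1 + t * coeff b 1 - poly b 0 + poly g 0"
      by (simp add: coeff_pCons poly_0_coeff_0)
    have "\<bar>t * coeff b 1\<bar> \<le> 1 * \<bar>coeff b 1\<bar>" unfolding abs_mult using t by (intro mult_right_mono) auto
    then have tb1: "\<bar>t * coeff b 1\<bar> \<le> (2 * sqrt e') * (1 + C * (4 * B) * (real r + 1))" using db by linarith
    have "e' \<le> sqrt e'"
    proof -
      have "sqrt e' * sqrt e' \<le> sqrt e' * 1" using e by (intro mult_left_mono) auto
      then show ?thesis using e by simp
    qed
    then have "\<bar>poly b 0\<bar> \<le> 2 * sqrt e'" using b0 nn(2)[of 0] by linarith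
    then have "\<bar>poly g 0 - L\<bar> \<le> sqrt e' * (1 + C * B * (real r + 1)) + 2 * sqrt e'
        + (2 * sqrt e') * (1 + C * (4 * B) * (real r + 1))"
      using slope da tb1 by linarith
    also have "\<dots> = D * sqrt e'" by (simp add: D_def algebra_simps)
    finally show ?thesis .
  qed
  show thesis by (rule that[OF D], rule bound) assumption+
qed

section \<open>Critical edges prevent finite convergence\<close>

abbreviation standard_quadratic :: "'v graph \<Rightarrow> 'v rpoly" where
  "standard_quadratic G \<equiv> quadratic_form (fst G) (\<lambda>i j. adjacency_matrix G i j + identity_matrix i j)"

lemma standard_quadratic_eq: "standard_quadratic G = clique_form G Var Const"
  by (simp add: quadratic_form_def clique_form_def closed_adjacency_def)

lemma eval_standard_quadratic: "eval_poly (standard_quadratic G) x = real_form G x"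
  unfolding standard_quadratic_eq by (simp add: clique_form_def)

lemma clique_form_scale: "clique_form G (\<lambda>i. c * x i) d = c\<^sup>2 * clique_form G x d"
  unfolding clique_form_def sum_distrib_left
  by (intro sum.cong refl) (simp add: power2_eq_square mult_ac)

context
  fixes G H :: "'v graph" and \<rho> :: "'v \<Rightarrow> 'v"
  assumes G: "simple_graph G" and H: "simple_graph H" and sub: "fst H \<subseteq> fst G" and ne: "fst G \<noteq> {}"
    and \<rho>: "\<And>v. v \<in> fst G \<Longrightarrow> \<rho> v \<in> fst H" "\<And>v. v \<in> fst H \<Longrightarrow> \<rho> v = v"
    and adj: "\<And>u v. u \<in> fst G \<Longrightarrow> v \<in> fst G \<Longrightarrow> closed_adjacency G u v = closed_adjacency H (\<rho> u) (\<rho> v)"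
begin

lemma fibre_sum:
  fixes g :: "'v \<Rightarrow> 'b::comm_monoid_add"
  shows "(\<Sum>h\<in>fst H. \<Sum>v | v \<in> fst G \<and> \<rho> v = h. g v) = (\<Sum>v\<in>fst G. g v)"
  using sum.group[OF finite_vertices[OF G] finite_vertices[OF H], of \<rho> g] \<rho>(1) by auto

lemma real_form_on_subgraph:
  assumes supp: "\<And>v. v \<notin> fst H \<Longrightarrow> x v = 0"
  shows "real_form G x = real_form H x"
proof -
  have "real_form G x = real_form H (\<lambda>h. \<Sum>v | v \<in> fst G \<and> \<rho> v = h. x v)"
    by (rule clique_form_retract[OF finite_vertices[OF G] finite_vertices[OF H] \<rho>(1) adj])
  also have "\<dots> = real_form H x"
  proof -
    have "(\<Sum>v | v \<in> fst G \<and> \<rho> v = h. x v) = x h" if h: "h \<in> fst H" for h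
    proof -
      have "(\<Sum>v | v \<in> fst G \<and> \<rho> v = h. x v) = (\<Sum>v\<in>{h}. x v)"
      proof (rule sum.mono_neutral_right)
        show "finite {v \<in> fst G. \<rho> v = h}" using finite_vertices[OF G] by simp
        show "{h} \<subseteq> {v \<in> fst G. \<rho> v = h}" using h sub \<rho>(2) by auto
        show "\<forall>v\<in>{v \<in> fst G. \<rho> v = h} - {h}. x v = 0" using supp \<rho>(2) by force
      qed
      then show ?thesis by simp
    qed
    then show ?thesis unfolding clique_form_def by simp
  qed
  finally show ?thesis .
qed

lemma subgraph_nonempty: "fst H \<noteq> {}"
  using ne \<rho>(1) by blast

lemma stability_pos: "0 < stability_number H"
  by (rule stability_number_pos[OF H subgraph_nonempty])

lemma simplex_min_standard_quadratic:
  "simplex_min (fst G) (standard_quadratic G) = 1 / real (stability_number H)"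
proof -
  let ?a = "real (stability_number H)"
  have a: "0 < ?a" using stability_pos by simp
  have lower: "1 / ?a \<le> eval_poly (standard_quadratic G) x" if x: "x \<in> standard_simplex (fst G)" for x
  proof -
    define Y where "Y h = (\<Sum>v | v \<in> fst G \<and> \<rho> v = h. x v)" for h
    have "(\<Sum>h\<in>fst H. Y h) = 1" using fibre_sum[of x] x unfolding Y_def standard_simplex_def by simp
    moreover have "0 \<le> Y h" for h using x unfolding Y_def standard_simplex_def by (intro sum_nonneg) auto
    ultimately have "1 \<le> ?a * real_form H Y" using Motzkin_Straus[OF H, of Y] by simp
    moreover have "real_form G x = real_form H Y"
      unfolding Y_def by (rule clique_form_retract[OF finite_vertices[OF G] finite_vertices[OF H] \<rho>(1) adj])
    ultimately show ?thesis unfolding eval_standard_quadratic using a by (simp add: field_simps)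
  qed
  obtain S where S: "stable_set H S" "card S = stability_number H"
    using maximum_stable_set_exists[OF H] unfolding maximum_stable_set_def by blast
  have SH: "S \<subseteq> fst H" using S unfolding stable_set_def by blast
  define x where "x v = (1 / ?a) * (if v \<in> S then 1 else 0)" for v
  have "(\<Sum>v\<in>fst G. x v) = 1"
    unfolding x_def sum_distrib_left[symmetric] using SH sub finite_vertices[OF G] S(2) a
    by (simp add: sum.If_cases Int_absorb1)
  then have xs: "x \<in> standard_simplex (fst G)"
    using SH sub by (auto simp: standard_simplex_def x_def)
  have "real_form G x = real_form H x"
    by (rule real_form_on_subgraph) (use SH in \<open>auto simp: x_def\<close>)
  also have "\<dots> = (1 / ?a)\<^sup>2 * ?a"
    unfolding x_def clique_form_scale using real_form_stable_support[OF H S(1), of "\<lambda>i. if i \<in> S then 1 else 0"] S(2)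
    by simp
  finally have "eval_poly (standard_quadratic G) x = 1 / ?a"
    unfolding eval_standard_quadratic using a by (simp add: power2_eq_square)
  then show ?thesis
    unfolding simplex_min_def
    by (intro cInf_eq_minimum) (use xs lower in \<open>auto simp: image_iff intro!: bexI[of _ x]\<close>)
qed

text \<open>
  Let \<open>S = T \<union> {i}\<close> and \<open>S' = T \<union> {j}\<close> be maximum stable sets. All points of the segment between
  their indicator vectors are minimisers, and the slope of the form at these points in the direction
  of \<open>k\<close> is a nonconstant affine function of the position \<open>t\<close>, because \<open>k\<close> is adjacent to \<open>i\<close>
  and not to \<open>j\<close>. The multiplier of \<open>x\<^sub>k\<close> has to supply this slope, but it is nonnegative on the whole
  line through the segment.
\<close>

lemma no_finite_convergence:
  assumes e: "{i, j} \<in> snd H" and T: "i \<notin> T" "j \<notin> T"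
    and Si: "maximum_stable_set H (insert i T)" and Sj: "maximum_stable_set H (insert j T)"
    and k: "{k, i} \<in> snd H" "{k, j} \<notin> snd H" "k \<noteq> j"
  shows "\<not> lasserre_finite_convergence (fst G) (standard_quadratic G)"
proof
  assume conv: "lasserre_finite_convergence (fst G) (standard_quadratic G)"
  let ?f = "standard_quadratic G" and ?V = "fst G"
  define \<alpha> where "\<alpha> = real (stability_number H)"
  have \<alpha>: "0 < \<alpha>" using stability_pos by (simp add: \<alpha>_def)
  have V: "finite ?V" by (rule finite_vertices[OF G])
  have st: "stable_set H (insert i T)" "stable_set H (insert j T)"
    "card (insert i T) = stability_number H" "card (insert j T) = stability_number H"
    using Si Sj unfolding maximum_stable_set_def by auto
  have finT: "finite T" using stable_finite[OF H st(1)] by simp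
  have TH: "T \<subseteq> fst H" using st(1) unfolding stable_set_def by auto
  have ij: "i \<in> fst H" "j \<in> fst H" "i \<noteq> j" using edge_vertices[OF H e] by auto
  have ki: "k \<in> fst H" "k \<noteq> i" using edge_vertices[OF H k(1)] by auto
  have kT: "k \<notin> T" using st(1) k(1) ki(2) unfolding stable_set_def by blast
  define \<kappa> where "\<kappa> = real (degree_into H T k) - 1"
  define Xt where "Xt t v = (if v \<in> insert j T then 1 else 0) + (if v = i then t else if v = j then - t else 0)"
    for t :: real and v
  define X where "X t s v = Xt t v + (if v = k then s else if v = i then - s else 0)" for t s :: real and v
  have X_vals: "v \<in> T \<Longrightarrow> X t s v = 1" "X t s i = t - s" "X t s j = 1 - t" "X t s k = s"
    "v \<notin> T \<Longrightarrow> v \<noteq> i \<Longrightarrow> v \<noteq> j \<Longrightarrow> v \<noteq> k \<Longrightarrow> X t s v = 0" for t s v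
    using T ij(3) ki(2) k(3) kT by (auto simp: X_def Xt_def)
  have row_Xt: "row H (Xt t) l = (1 - t) * row H (\<lambda>v. if v \<in> insert j T then 1 else 0) l
      + t * row H (\<lambda>v. if v \<in> insert i T then 1 else 0) l" for t l
    unfolding row_def sum_distrib_left sum.distrib[symmetric]
    using T ij(3) by (intro sum.cong refl) (auto simp: Xt_def algebra_simps)
  have di: "degree_into H (insert j T) i = 1"
  proof -
    have "{l \<in> insert j T. {i, l} \<in> snd H} = {j}"
      using st(1) e T unfolding stable_set_def by auto
    then show ?thesis unfolding degree_into_def by simp
  qed
  have dj: "degree_into H (insert j T) k = degree_into H T k"
  proof -
    have "{l \<in> insert j T. {k, l} \<in> snd H} = {l \<in> T. {k, l} \<in> snd H}" using k(2) by auto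
    then show ?thesis unfolding degree_into_def by simp
  qed
  have dk: "degree_into H (insert i T) k = degree_into H T k + 1"
  proof -
    have "{l \<in> insert i T. {k, l} \<in> snd H} = insert i {l \<in> T. {k, l} \<in> snd H}" using k(1) by auto
    then show ?thesis unfolding degree_into_def using finT T by simp
  qed
  have rows: "row H (Xt t) i = 1" "row H (Xt t) k = \<kappa> + 1 + t" for t
    unfolding row_Xt row_stable[OF H st(2) ij(1)] row_stable[OF H st(1) ij(1)]
      row_stable[OF H st(2) ki(1)] row_stable[OF H st(1) ki(1)]
    using T ij(3) ki(2) k(3) kT by (auto simp: di dj dk \<kappa>_def algebra_simps)
  have form: "real_form H (X t s) = \<alpha> + 2 * s * (\<kappa> + t)" for t s
  proof -
    have "real_form H (\<lambda>v. if v \<in> insert j T then 1 else 0) = \<alpha>"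
      using real_form_stable_support[OF H st(2), of "\<lambda>v. if v \<in> insert j T then 1 else 0"] st(4)
      by (simp add: \<alpha>_def)
    moreover have "row H (\<lambda>v. if v \<in> insert j T then 1 else 0) i = 1"
      "row H (\<lambda>v. if v \<in> insert j T then 1 else 0) j = 1"
      using row_stable[OF H st(2) ij(1)] row_stable[OF H st(2) ij(2)] T ij(3) di by simp_all
    ultimately have "real_form H (Xt t) = \<alpha>"
      using real_form_shift[OF H e, of "\<lambda>v. if v \<in> insert j T then 1 else 0" t]
      unfolding Xt_def by simp
    then show ?thesis
      using real_form_shift[OF H k(1), of "Xt t" s] rows unfolding X_def by simp
  qed
  define x where "x t s v = (1 / \<alpha>) * X t s v" for t s v
  have x_out: "x t s v = 0" if "v \<notin> fst H" for t s v
    using X_vals(5)[of v t s] that TH ij ki(1) by (force simp: x_def)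
  have f_x: "eval_poly ?f (x t s) = 1 / \<alpha> + 2 * s * (\<kappa> + t) / \<alpha>\<^sup>2" for t s
  proof -
    have "eval_poly ?f (x t s) = real_form H (x t s)"
      unfolding eval_standard_quadratic by (rule real_form_on_subgraph[OF x_out])
    also have "\<dots> = (1 / \<alpha>)\<^sup>2 * (\<alpha> + 2 * s * (\<kappa> + t))" unfolding x_def clique_form_scale form ..
    also have "\<dots> = 1 / \<alpha> + 2 * s * (\<kappa> + t) / \<alpha>\<^sup>2" using \<alpha> by (simp add: power2_eq_square field_simps)
    finally show ?thesis .
  qed
  have split_sum: "(\<Sum>v\<in>?V. x t s v * g v)
      = (1 / \<alpha>) * ((\<Sum>v\<in>T. g v) + (t - s) * g i + (1 - t) * g j + s * g k)" for t s g
  proof -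
    have "(\<Sum>v\<in>?V. x t s v * g v) = (\<Sum>v\<in>insert i (insert j (insert k T)). x t s v * g v)"
      using V TH ij ki(1) sub X_vals(5)[of _ t s]
      by (intro sum.mono_neutral_right) (auto simp: x_def)
    also have "\<dots> = x t s i * g i + x t s j * g j + x t s k * g k + (\<Sum>v\<in>T. x t s v * g v)"
      using finT T ij(3) ki(2) k(3) kT by (simp add: add.assoc)
    also have "(\<Sum>v\<in>T. x t s v * g v) = (\<Sum>v\<in>T. (1 / \<alpha>) * g v)"
      by (intro sum.cong refl) (simp add: x_def X_vals)
    also have "\<dots> = (1 / \<alpha>) * (\<Sum>v\<in>T. g v)" by (rule sum_distrib_left[symmetric])
    also have "x t s i * g i + x t s j * g j + x t s k * g k + (1 / \<alpha>) * (\<Sum>v\<in>T. g v)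
        = (1 / \<alpha>) * ((\<Sum>v\<in>T. g v) + (t - s) * g i + (1 - t) * g j + s * g k)"
      unfolding x_def X_vals by (simp only: distrib_left mult.assoc add_ac)
    finally show ?thesis .
  qed
  have x_sum: "(\<Sum>v\<in>?V. x t s v) = 1" for t s
  proof -
    have "real (card T) + 1 = \<alpha>" using st(3) finT T by (simp add: \<alpha>_def)
    then show ?thesis using split_sum[of t s "\<lambda>v. 1"] \<alpha> by simp
  qed
  have sm: "simplex_min ?V ?f = 1 / \<alpha>" unfolding \<alpha>_def by (rule simplex_min_standard_quadratic)
  obtain r where r: "\<And>d. 0 < d \<Longrightarrow> \<exists>c\<le>1 / \<alpha>. 1 / \<alpha> - d < c \<and>
      (\<exists>p\<in>quadratic_module ?V r. \<exists>q\<in>simplex_ideal ?V r. ?f - Const c = p + q)"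
    by (rule finite_convergence_approximation[OF V ne conv, unfolded sm]) (rule that)
  define Lmax where "Lmax = 2 * (\<bar>\<kappa>\<bar> + 1)"
  obtain D where D: "0 < D" and slope: "\<And>(a::real poly) b g t L e e'.
    degree a \<le> r \<Longrightarrow> degree b \<le> r \<Longrightarrow> (\<And>s. 0 \<le> poly a s) \<Longrightarrow> (\<And>s. 0 \<le> poly b s) \<Longrightarrow> (\<And>s. 0 \<le> poly g s) \<Longrightarrow>
    1/2 \<le> t \<Longrightarrow> t \<le> 3/4 \<Longrightarrow> \<bar>L\<bar> \<le> Lmax \<Longrightarrow> 0 \<le> e \<Longrightarrow> e \<le> e' \<Longrightarrow> 0 < e' \<Longrightarrow> e' \<le> 1/2 \<Longrightarrow>
    (\<And>s. L * s + e = poly a s + (t - s) * poly b s + s * poly g s) \<Longrightarrow> \<bar>poly g 0 - L\<bar> \<le> D * sqrt e'"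
  proof (rule slope_supplied_by_multiplier[of Lmax r], goal_cases)
    case 1
    show ?case by (simp add: Lmax_def)
  next
    case (2 D)
    show ?case by (rule 2(1)[OF 2(2)], rule 2(3)) assumption+
  qed
  obtain C where C: "0 < C" and coeffs: "\<And>(p::real poly) B i. degree p \<le> Suc r \<Longrightarrow>
      (\<And>s. 1/2 \<le> s \<Longrightarrow> s \<le> 3/4 \<Longrightarrow> \<bar>poly p s\<bar> \<le> B) \<Longrightarrow> \<bar>coeff p i\<bar> \<le> C * B"
    by (rule coeff_bounded_on_intervalE[of "1/2" "3/4" "Suc r"]) (simp, blast)
  \<comment> \<open>At the position \<open>t\<^sub>0\<close>, outside the segment, the slope would have to be \<open>-2\<close>.\<close>
  define t0 where "t0 = - \<kappa> - 1"
  define B where "B = (\<Sum>l\<le>Suc r. \<bar>t0\<bar> ^ l)"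
  have B: "0 < B" unfolding B_def by (rule sum_pos2[of _ 0]) auto
  define e' where "e' = min (1/2) ((1 / (C * D * B))\<^sup>2)"
  have e': "0 < e'" "e' \<le> 1/2" using C D B by (auto simp: e'_def)
  have small: "C * (D * sqrt e') * B \<le> 1"
  proof -
    have "sqrt e' \<le> sqrt ((1 / (C * D * B))\<^sup>2)" unfolding e'_def by (intro real_sqrt_le_mono) simp
    then have "sqrt e' \<le> 1 / (C * D * B)" using C D B by simp
    then show ?thesis using C D B by (simp add: field_simps)
  qed
  have "0 < e' / \<alpha>\<^sup>2" using e' \<alpha> by simp
  from r[OF this] obtain c where c: "c \<le> 1 / \<alpha>" "1 / \<alpha> - e' / \<alpha>\<^sup>2 < c"
    and "\<exists>p\<in>quadratic_module ?V r. \<exists>q\<in>simplex_ideal ?V r. ?f - Const c = p + q" by (elim exE conjE)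
  then obtain p q where p: "p \<in> quadratic_module ?V r" and q: "q \<in> simplex_ideal ?V r"
    and fpq: "?f - Const c = p + q" by (elim bexE)
  obtain \<sigma>0 \<sigma> where p_eq: "p = \<sigma>0 + (\<Sum>l\<in>?V. Var l * \<sigma> l)" and \<sigma>: "\<sigma>0 \<in> sos ?V" "\<forall>l\<in>?V. \<sigma> l \<in> sos ?V"
    and deg: "total_degree \<sigma>0 \<le> r" "\<forall>l\<in>?V. total_degree (Var l * \<sigma> l) \<le> r"
    using p unfolding quadratic_module_def mem_Collect_eq by (elim exE conjE)
  have deg\<sigma>: "total_degree (\<sigma> l) \<le> r" if "l \<in> ?V" for l
    by (rule total_degree_Var_mult) (use deg(2) that in blast)
  define e where "e = \<alpha>\<^sup>2 * (1 / \<alpha> - c)"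
  have h1: "\<alpha>\<^sup>2 * (1 / \<alpha>) = \<alpha>" using \<alpha> by (simp add: power2_eq_square)
  have h2: "\<alpha>\<^sup>2 * (y / \<alpha>\<^sup>2) = y" for y using \<alpha> by simp
  have e: "0 \<le> e" "e \<le> e'"
  proof -
    show "0 \<le> e" using c(1) by (simp add: e_def)
    have "\<alpha>\<^sup>2 * (1 / \<alpha> - c) \<le> \<alpha>\<^sup>2 * (e' / \<alpha>\<^sup>2)" using c(2) by (intro mult_left_mono) auto
    then show "e \<le> e'" unfolding e_def h2 .
  qed
  have main: "2 * (\<kappa> + t) * s + e = \<alpha>\<^sup>2 * eval_poly \<sigma>0 (x t s) + \<alpha> * ((\<Sum>l\<in>T. eval_poly (\<sigma> l) (x t s))
      + (t - s) * eval_poly (\<sigma> i) (x t s) + (1 - t) * eval_poly (\<sigma> j) (x t s) + s * eval_poly (\<sigma> k) (x t s))" for t s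
  proof -
    let ?R = "(\<Sum>l\<in>T. eval_poly (\<sigma> l) (x t s)) + (t - s) * eval_poly (\<sigma> i) (x t s)
      + (1 - t) * eval_poly (\<sigma> j) (x t s) + s * eval_poly (\<sigma> k) (x t s)"
    obtain q' where "q = q' * ((\<Sum>l\<in>?V. Var l) - 1)" using q unfolding simplex_ideal_def by blast
    then have "eval_poly q (x t s) = 0" using x_sum[of t s] by simp
    then have "eval_poly ?f (x t s) - c = eval_poly \<sigma>0 (x t s) + (\<Sum>l\<in>?V. x t s l * eval_poly (\<sigma> l) (x t s))"
      using arg_cong[OF fpq, of "\<lambda>p. eval_poly p (x t s)"] unfolding p_eq by simp
    then have eq: "1 / \<alpha> + 2 * s * (\<kappa> + t) / \<alpha>\<^sup>2 - c = eval_poly \<sigma>0 (x t s) + (1 / \<alpha>) * ?R"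
      unfolding f_x split_sum .
    have "2 * (\<kappa> + t) * s + e = \<alpha>\<^sup>2 * (1 / \<alpha> - c) + \<alpha>\<^sup>2 * (2 * s * (\<kappa> + t) / \<alpha>\<^sup>2)"
      unfolding h2 e_def by (simp only: mult_ac add_ac)
    also have "\<dots> = \<alpha>\<^sup>2 * (1 / \<alpha> + 2 * s * (\<kappa> + t) / \<alpha>\<^sup>2 - c)"
      unfolding distrib_left[symmetric] by (rule arg_cong[of _ _ "\<lambda>y. \<alpha>\<^sup>2 * y"]) simp
    also have "\<dots> = \<alpha>\<^sup>2 * eval_poly \<sigma>0 (x t s) + (\<alpha>\<^sup>2 * (1 / \<alpha>)) * ?R"
      unfolding eq by (simp only: distrib_left mult.assoc)
    finally show ?thesis unfolding h1 .
  qed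
  have nonneg: "0 \<le> eval_poly \<sigma>0 y" "l \<in> ?V \<Longrightarrow> 0 \<le> eval_poly (\<sigma> l) y" for l y
    using \<sigma> eval_sos_nonneg by blast+
  have mem: "i \<in> ?V" "j \<in> ?V" "k \<in> ?V" "T \<subseteq> ?V" using ij ki TH sub by auto
  define g where "g = smult \<alpha> (along_line (x 0 0) (\<lambda>v. x 1 0 v - x 0 0 v) (\<sigma> k))"
  have x_aff: "x t s = (\<lambda>v. x t 0 v + s * (x t 1 v - x t 0 v))" "x t 0 = (\<lambda>v. x 0 0 v + t * (x 1 0 v - x 0 0 v))" for t s
    by (auto simp: x_def X_def Xt_def algebra_simps fun_eq_iff)
  have g_eval: "poly g t = \<alpha> * eval_poly (\<sigma> k) (x t 0)" for t
    unfolding g_def by (simp add: poly_along_line x_aff(2)[symmetric])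
  have near: "\<bar>poly g t - 2 * (\<kappa> + t)\<bar> \<le> D * sqrt e'" if t: "1/2 \<le> t" "t \<le> 3/4" for t
  proof -
    let ?A = "along_line (x t 0) (\<lambda>v. x t 1 v - x t 0 v)"
    have A: "poly (?A p) s = eval_poly p (x t s)" for p s
      by (simp add: poly_along_line x_aff(1)[of t s, symmetric])
    let ?a = "smult (\<alpha>\<^sup>2) (?A \<sigma>0) + smult \<alpha> (\<Sum>l\<in>T. ?A (\<sigma> l)) + smult (\<alpha> * (1 - t)) (?A (\<sigma> j))"
    have "\<bar>poly (smult \<alpha> (?A (\<sigma> k))) 0 - 2 * (\<kappa> + t)\<bar> \<le> D * sqrt e'"
    proof (rule slope[of ?a "smult \<alpha> (?A (\<sigma> i))" _ t _ e])
      show "degree ?a \<le> r"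
        using mem deg(1) deg\<sigma> finT
        by (intro degree_add_le order_trans[OF degree_smult_le] degree_sum_le degree_along_line) auto
      show "degree (smult \<alpha> (?A (\<sigma> i))) \<le> r"
        using mem deg\<sigma> by (intro order_trans[OF degree_smult_le] degree_along_line)
      show "0 \<le> poly ?a s" for s
        using \<alpha> t mem nonneg by (auto simp: A poly_sum intro!: add_nonneg_nonneg mult_nonneg_nonneg sum_nonneg)
      show "0 \<le> poly (smult \<alpha> (?A (\<sigma> i))) s" "0 \<le> poly (smult \<alpha> (?A (\<sigma> k))) s" for s
        using \<alpha> mem nonneg by (auto simp: A)
      show "\<bar>2 * (\<kappa> + t)\<bar> \<le> Lmax" using t by (auto simp: Lmax_def)
      show "2 * (\<kappa> + t) * s + e = poly ?a s + (t - s) * poly (smult \<alpha> (?A (\<sigma> i))) s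
          + s * poly (smult \<alpha> (?A (\<sigma> k))) s" for s
        unfolding main by (simp add: A poly_sum algebra_simps)
    qed (use t e e' in auto)
    then show ?thesis by (simp add: A g_eval)
  qed
  define d where "d = g - [:2 * \<kappa>, 2:]"
  have d_eval: "poly d t = poly g t - 2 * (\<kappa> + t)" for t by (simp add: d_def algebra_simps)
  have deg_d: "degree d \<le> Suc r"
    unfolding d_def g_def using degree_along_line[OF deg\<sigma>[OF mem(3)], of "x 0 0" "\<lambda>v. x 1 0 v - x 0 0 v"]
    by (intro degree_diff_le order_trans[OF degree_smult_le]) auto
  have "\<bar>coeff d l\<bar> \<le> C * (D * sqrt e')" for l
    by (rule coeffs[OF deg_d]) (use near in \<open>auto simp: d_eval\<close>)
  then have "\<bar>poly d t0\<bar> \<le> C * (D * sqrt e') * B"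
    unfolding B_def by (rule poly_bound_from_coeffs[OF _ deg_d])
  moreover have "poly d t0 = poly g t0 + 2" by (simp add: d_eval t0_def)
  moreover have "0 \<le> poly g t0" unfolding g_eval using \<alpha> nonneg(2)[OF mem(3)] by simp
  ultimately show False using small by linarith
qed

lemma finite_convergence_without_critical_edges:
  assumes nc: "\<nexists>e. critical_edge H e"
  shows "lasserre_finite_convergence (fst G) (standard_quadratic G)"
proof (rule finite_convergence_if_attained[OF finite_vertices[OF G] ne])
  let ?V = "fst G" and ?f = "standard_quadratic G" and ?\<alpha> = "real (stability_number H)"
  note V = finite_vertices[OF G]
  note qm = quad_module_extended[OF V]
  have \<alpha>: "0 < ?\<alpha>" using stability_pos by simp
  let ?Y = "\<lambda>h. \<Sum>v | v \<in> ?V \<and> \<rho> v = h. Var v :: 'v rpoly"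
  define X where "X = (\<lambda>h. Const ?\<alpha> * ?Y h)"
  have "gap_form H X \<in> extended_module ?V"
  proof (rule gap_form_in_module[OF H nc V])
    show "X h \<in> extended_module ?V" for h
      unfolding X_def by (intro qm_scale[OF qm] qm_sum[OF qm] extended_Var[OF V]) auto
    show "(\<Sum>h\<in>fst H. eval_poly (X h) x) = ?\<alpha>" if x: "x \<in> standard_simplex ?V" for x
    proof -
      have "(\<Sum>h\<in>fst H. eval_poly (X h) x) = ?\<alpha> * (\<Sum>h\<in>fst H. \<Sum>v | v \<in> ?V \<and> \<rho> v = h. x v)"
        by (simp add: X_def sum_distrib_left)
      then show ?thesis using x fibre_sum[of x] unfolding standard_simplex_def by simp
    qed
    show "0 < stability_number H" by (rule stability_pos)
  qed
  moreover have "gap_form H X = Const (?\<alpha>\<^sup>2) * (?f - Const (1 / ?\<alpha>)) - Const (2 * ?\<alpha>) * ((\<Sum>v\<in>?V. Var v) - 1)"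
  proof -
    have "clique_form H X Const = Const (?\<alpha>\<^sup>2) * clique_form H ?Y Const"
      unfolding X_def clique_form_scale by (simp only: Const_power)
    also have "clique_form H ?Y Const = ?f"
      unfolding standard_quadratic_eq
      by (rule clique_form_retract[OF V finite_vertices[OF H] \<rho>(1) adj, symmetric])
    finally have form: "clique_form H X Const = Const (?\<alpha>\<^sup>2) * ?f" .
    have "(\<Sum>h\<in>fst H. X h) = Const ?\<alpha> * (\<Sum>h\<in>fst H. ?Y h)"
      unfolding X_def by (rule sum_distrib_left[symmetric])
    also have "(\<Sum>h\<in>fst H. ?Y h) = (\<Sum>v\<in>?V. Var v)" by (rule fibre_sum)
    finally have lin: "(\<Sum>h\<in>fst H. X h) = Const ?\<alpha> * (\<Sum>v\<in>?V. Var v)" .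
    have "Const (?\<alpha>\<^sup>2) * Const (1 / ?\<alpha>) = (Const ?\<alpha> :: 'v rpoly)"
      using \<alpha> by (simp add: power2_eq_square flip: Const_mult)
    then show ?thesis
      unfolding gap_form_def form lin by (simp add: right_diff_distrib Const_mult mult.assoc)
  qed
  ultimately have "(Const (?\<alpha>\<^sup>2) * (?f - Const (1 / ?\<alpha>)) - Const (2 * ?\<alpha>) * ((\<Sum>v\<in>?V. Var v) - 1))
      + Const (2 * ?\<alpha>) * ((\<Sum>v\<in>?V. Var v) - 1) \<in> extended_module ?V"
    by (intro qm_add[OF qm] extended_ideal[OF V]) simp
  then have "Const (?\<alpha>\<^sup>2) * (?f - Const (1 / ?\<alpha>)) \<in> extended_module ?V" by simp
  then have "?f - Const (1 / ?\<alpha>) \<in> extended_module ?V"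
    by (rule qm_scaleD[OF qm, rotated]) (use \<alpha> in simp)
  moreover have "?f - Const (1 / ?\<alpha>) \<in> polys ?V"
    unfolding standard_quadratic_eq clique_form_def
    by (intro polys_diff polys_sum polys_mult polys_Var) auto
  ultimately show "?f - Const (simplex_min ?V ?f) \<in> simplex_module ?V"
    unfolding simplex_min_standard_quadratic using extended_module_def[OF V] restrict_vars_id by force
qed

lemma critical_edge_prevents_finite_convergence:
  assumes twin_free: "\<nexists>i j. twin_pair H i j" and e: "critical_edge H e"
  shows "\<not> lasserre_finite_convergence (fst G) (standard_quadratic G)"
proof -
  obtain i j T where T: "i \<noteq> j" "{i, j} \<in> snd H" "i \<notin> T" "j \<notin> T"
    "maximum_stable_set H (insert i T)" "maximum_stable_set H (insert j T)"
    using critical_edge_exchange[OF H e] by metis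
  have "neighbours H i - {j} \<noteq> neighbours H j - {i}"
    using twin_free T(2) unfolding twin_pair_def by blast
  then obtain k where "k \<in> neighbours H i \<and> k \<noteq> j \<and> (k \<notin> neighbours H j \<or> k = i) \<or>
      k \<in> neighbours H j \<and> k \<noteq> i \<and> (k \<notin> neighbours H i \<or> k = j)" by blast
  then consider "{k, i} \<in> snd H" "{k, j} \<notin> snd H" "k \<noteq> j" | "{k, j} \<in> snd H" "{k, i} \<notin> snd H" "k \<noteq> i"
    using no_loop[OF H, of i] no_loop[OF H, of j] unfolding neighbours_def by auto
  then show ?thesis
  proof cases
    case 1
    show ?thesis by (rule no_finite_convergence[OF T(2-6) 1])
  next
    case 2
    have ji: "{j, i} \<in> snd H" using T(2) by (simp add: insert_commute)
    show ?thesis by (rule no_finite_convergence[OF ji T(4,3,6,5) 2])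
  qed
qed

end

theorem theorem3:
  fixes n :: nat and E :: "nat set set" and H :: "nat graph"
  assumes "n \<ge> 1"
    and "simple_graph ({1..n}, E)"
    and "twin_contraction ({1..n}, E) H"
  shows "lasserre_finite_convergence {1..n}
           (quadratic_form {1..n}
              (\<lambda>i j. adjacency_matrix ({1..n}, E) i j + identity_matrix i j))
         \<longleftrightarrow> (\<nexists>e. critical_edge H e)"
proof -
  let ?G = "({1..n}, E)"
  have contraction: "contract_twin_step\<^sup>*\<^sup>* ?G H" and twin_free: "\<nexists>i j. twin_pair H i j"
    using assms(3) unfolding twin_contraction_def by auto
  obtain \<rho> where H: "simple_graph H" "fst H \<subseteq> fst ?G"
    and \<rho>: "\<forall>v\<in>fst ?G. \<rho> v \<in> fst H" "\<forall>v\<in>fst H. \<rho> v = v"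
      "\<forall>u\<in>fst ?G. \<forall>v\<in>fst ?G. closed_adjacency ?G u v = closed_adjacency H (\<rho> u) (\<rho> v)"
    using twin_contraction_retract[OF contraction assms(2)] by blast
  have ne: "fst ?G \<noteq> {}" using assms(1) by simp
  note retract = assms(2) H ne \<rho>[rule_format]
  have "lasserre_finite_convergence (fst ?G) (standard_quadratic ?G)" if "\<nexists>e. critical_edge H e"
    by (rule finite_convergence_without_critical_edges[OF retract that])
  moreover have "\<not> lasserre_finite_convergence (fst ?G) (standard_quadratic ?G)" if "critical_edge H e" for e
    by (rule critical_edge_prevents_finite_convergence[OF retract twin_free that])
  ultimately have "lasserre_finite_convergence (fst ?G) (standard_quadratic ?G) \<longleftrightarrow> (\<nexists>e. critical_edge H e)"
    by blast
  then show ?thesis by simp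
qed

end
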